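(* Let $\Gamma$ be a countable discrete group acting by trace-preserving automorphisms on a finite von Neumann algebra $(M,\tau)$ with separable predual, and let $\mathcal U\subseteq\mathrm{Sub}(M)$ be a URA. Then the Pimsner–Popa index $[M:N]$ does not depend on $N\in\mathcal U$.
   Context: $\tau$ is a faithful normal tracial state. $\mathrm{Sub}(M)$ is the set of unital von Neumann subalgebras of $M$ with the Effros–Maréchal topology: the smallest topology for which all maps $N\mapsto E_N(x)\in \mathrm{L}^2(M,\tau)$, $x\in M$, are norm continuous, $E_N$ being the $\tau$-preserving conditional expectation onto $N$. Writing $\alpha$ for the action, $\Gamma$ acts on $\mathrm{Sub}(M)$ by $g\cdot N=\alpha_g(N)$. A URA is a minimal (non-empty) closed $\Gamma$-invariant subset of $\mathrm{Sub}(M)$. For $N\in\mathrm{Sub}(M)$ the Pimsner–Popa index is $[M:N]=\lambda(N)^{-1}\in[1,\infty]$, where $\lambda(N)=\sup\{c>0:E_N(x)\geq cx\ \forall x\in M^+\}\in[0,1]$ ($\lambda(N)=0$ if there is no such $c$) and $M^+$ is the positive cone of $M$. *)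

theory Defs
  imports "HOL-Analysis.Analysis" "HOL-Algebra.Group"
begin

section \<open>Complex Hilbert spaces\<close>

text \<open>
  A complex Hilbert space is a real Hilbert space with a compatible complex structure. The
  complex inner product is linear in the first argument, and its real part is the real inner
  product, so the norm and the topology are those of the underlying real Hilbert space.
\<close>

class complex_hilbert_space = real_inner + complete_space +
  fixes scaleC :: "complex \<Rightarrow> 'a \<Rightarrow> 'a"  (infixr \<open>*\<^sub>C\<close> 75)
    and cinner :: "'a \<Rightarrow> 'a \<Rightarrow> complex"
  assumes scaleC_add_right: "c *\<^sub>C (x + y) = c *\<^sub>C x + c *\<^sub>C y"
    and scaleC_add_left: "(c + d) *\<^sub>C x = c *\<^sub>C x + d *\<^sub>C x"
    and scaleC_scaleC: "c *\<^sub>C d *\<^sub>C x = (c * d) *\<^sub>C x"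
    and scaleC_of_real: "complex_of_real r *\<^sub>C x = r *\<^sub>R x"
    and cinner_commute: "cinner x y = cnj (cinner y x)"
    and cinner_add_left: "cinner (x + y) z = cinner x z + cinner y z"
    and cinner_scaleC_left: "cinner (c *\<^sub>C x) y = c * cinner x y"
    and Re_cinner: "Re (cinner x y) = inner x y"

lemma norm_scaleC:
  fixes x :: "'a::complex_hilbert_space"
  shows "norm (c *\<^sub>C x) = cmod c * norm x"
proof -
  have im: "Im (cinner x x) = 0"
    using cinner_commute[of x x] by (simp add: complex_eq_iff)
  have "cinner (c *\<^sub>C x) (c *\<^sub>C x) = c * cnj (c * cinner x x)"
    by (metis cinner_scaleC_left cinner_commute)
  also have "\<dots> = (c * cnj c) * cnj (cinner x x)"
    by simp
  also have "c * cnj c = complex_of_real ((cmod c)\<^sup>2)"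
    by (rule complex_norm_square[symmetric])
  finally have "inner (c *\<^sub>C x) (c *\<^sub>C x) = (cmod c)\<^sup>2 * inner x x"
    using im by (simp add: Re_cinner[symmetric] del: of_real_power)
  then show ?thesis
    by (simp add: norm_eq_sqrt_inner real_sqrt_mult)
qed

section \<open>Bounded operators\<close>

text \<open>
  The library type \<open>'h \<Rightarrow>\<^sub>L 'h\<close> consists of the bounded real-linear operators with the operator
  norm; \<open>B(H)\<close> is its subset of complex-linear operators.
\<close>

type_synonym 'h operator = "'h \<Rightarrow>\<^sub>L 'h"

definition bounded_operators :: "'h::complex_hilbert_space operator set" where
  "bounded_operators = {T. \<forall>c \<xi>. blinfun_apply T (c *\<^sub>C \<xi>) = c *\<^sub>C blinfun_apply T \<xi>}"

lift_definition op_scaleC :: "complex \<Rightarrow> 'h::complex_hilbert_space operator \<Rightarrow> 'h operator"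
  is "\<lambda>c T \<xi>. c *\<^sub>C T \<xi>"
proof -
  fix c :: complex and T :: "'h \<Rightarrow> 'h"
  assume "bounded_linear T"
  moreover have "bounded_linear (\<lambda>x::'h. c *\<^sub>C x)"
  proof (rule bounded_linear_intro[where K = "cmod c"])
    show "c *\<^sub>C (x + y) = c *\<^sub>C x + c *\<^sub>C y" for x y :: 'h
      by (rule scaleC_add_right)
    show "c *\<^sub>C (r *\<^sub>R x) = r *\<^sub>R (c *\<^sub>C x)" for r and x :: 'h
      by (simp add: scaleC_of_real[symmetric] scaleC_scaleC mult.commute)
    show "norm (c *\<^sub>C x) \<le> norm x * cmod c" for x :: 'h
      by (simp add: norm_scaleC)
  qed
  ultimately show "bounded_linear (\<lambda>\<xi>. c *\<^sub>C T \<xi>)"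
    by (rule bounded_linear_compose[rotated])
qed

definition op_adjoint :: "'h::complex_hilbert_space operator \<Rightarrow> 'h operator" where
  "op_adjoint T = (THE S. \<forall>\<xi> \<eta>.
     cinner (blinfun_apply T \<xi>) \<eta> = cinner \<xi> (blinfun_apply S \<eta>))"

definition positive_operator :: "'h::complex_hilbert_space operator \<Rightarrow> bool" where
  "positive_operator T \<longleftrightarrow>
     T \<in> bounded_operators \<and> (\<forall>\<xi>. cinner (blinfun_apply T \<xi>) \<xi> \<in> \<real>\<^sub>\<ge>\<^sub>0)"

definition operator_le :: "'h::complex_hilbert_space operator \<Rightarrow> 'h operator \<Rightarrow> bool" where
  "operator_le S T \<longleftrightarrow> positive_operator (T - S)"

section \<open>Von Neumann algebras\<close>

definition commutant :: "'h::complex_hilbert_space operator set \<Rightarrow> 'h operator set" where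
  "commutant S = {T \<in> bounded_operators. \<forall>s\<in>S. T o\<^sub>L s = s o\<^sub>L T}"

text \<open>
  Being a bicommutant makes \<open>M\<close> a complex algebra containing the identity operator.
\<close>

definition von_neumann_algebra :: "'h::complex_hilbert_space operator set \<Rightarrow> bool" where
  "von_neumann_algebra M \<longleftrightarrow>
     M \<subseteq> bounded_operators \<and> (\<forall>x\<in>M. op_adjoint x \<in> M) \<and> commutant (commutant M) = M"

definition positive_cone :: "'h::complex_hilbert_space operator set \<Rightarrow> 'h operator set" where
  "positive_cone M = {x \<in> M. positive_operator x}"

definition linear_functional_on ::
    "'h::complex_hilbert_space operator set \<Rightarrow> ('h operator \<Rightarrow> complex) \<Rightarrow> bool" where
  "linear_functional_on M \<phi> \<longleftrightarrow>
     (\<forall>x\<in>M. \<forall>y\<in>M. \<phi> (x + y) = \<phi> x + \<phi> y) \<and> (\<forall>c. \<forall>x\<in>M. \<phi> (op_scaleC c x) = c * \<phi> x)"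

text \<open>
  The ultraweak topology on \<open>B(H)\<close> is the initial topology for the functionals
  \<open>T \<mapsto> \<Sum>k. \<langle>T \<xi>\<^sub>k, \<eta>\<^sub>k\<rangle>\<close> with \<open>(\<xi>\<^sub>k)\<close> and \<open>(\<eta>\<^sub>k)\<close> square-summable. The predual of \<open>M\<close> is the
  space of ultraweakly continuous linear functionals on \<open>M\<close>; these are the normal functionals.
\<close>

definition ultraweak_topology :: "'h::complex_hilbert_space operator topology" where
  "ultraweak_topology = topology_generated_by
     {{T \<in> bounded_operators. (\<Sum>k. cinner (blinfun_apply T (\<xi> k)) (\<eta> k)) \<in> W} | \<xi> \<eta> W.
        summable (\<lambda>k::nat. (norm (\<xi> k))\<^sup>2) \<and> summable (\<lambda>k. (norm (\<eta> k))\<^sup>2) \<and> open W}"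

definition normal_functional ::
    "'h::complex_hilbert_space operator set \<Rightarrow> ('h operator \<Rightarrow> complex) \<Rightarrow> bool" where
  "normal_functional M \<phi> \<longleftrightarrow> linear_functional_on M \<phi> \<and>
     continuous_map (subtopology ultraweak_topology M) euclidean \<phi>"

definition separable_predual :: "'h::complex_hilbert_space operator set \<Rightarrow> bool" where
  "separable_predual M \<longleftrightarrow>
     (\<exists>D. countable D \<and> (\<forall>\<psi>\<in>D. normal_functional M \<psi>) \<and>
        (\<forall>\<phi>. normal_functional M \<phi> \<longrightarrow>
           (\<forall>\<epsilon>>0. \<exists>\<psi>\<in>D. \<forall>x\<in>M. norm x \<le> 1 \<longrightarrow> cmod (\<phi> x - \<psi> x) \<le> \<epsilon>)))"

definition faithful_normal_tracial_state ::
    "'h::complex_hilbert_space operator set \<Rightarrow> ('h operator \<Rightarrow> complex) \<Rightarrow> bool" where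
  "faithful_normal_tracial_state M \<tau> \<longleftrightarrow>
     normal_functional M \<tau> \<and>
     (\<forall>x\<in>positive_cone M. \<tau> x \<in> \<real>\<^sub>\<ge>\<^sub>0) \<and>
     \<tau> id_blinfun = 1 \<and>
     (\<forall>x\<in>M. \<forall>y\<in>M. \<tau> (x o\<^sub>L y) = \<tau> (y o\<^sub>L x)) \<and>
     (\<forall>x\<in>positive_cone M. \<tau> x = 0 \<longrightarrow> x = 0)"

section \<open>Conditional expectations and the Effros--Marechal topology\<close>

definition vn_subalgebras ::
    "'h::complex_hilbert_space operator set \<Rightarrow> 'h operator set set" where
  "vn_subalgebras M = {N. von_neumann_algebra N \<and> N \<subseteq> M}"

definition trace_preserving_cond_exp ::
    "'h::complex_hilbert_space operator set \<Rightarrow> ('h operator \<Rightarrow> complex) \<Rightarrow> 'h operator set \<Rightarrow>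
     ('h operator \<Rightarrow> 'h operator) \<Rightarrow> bool" where
  "trace_preserving_cond_exp M \<tau> N E \<longleftrightarrow>
     E ` M \<subseteq> N \<and>
     (\<forall>x\<in>M. \<forall>y\<in>M. E (x + y) = E x + E y) \<and>
     (\<forall>c. \<forall>x\<in>M. E (op_scaleC c x) = op_scaleC c (E x)) \<and>
     (\<forall>x\<in>positive_cone M. positive_operator (E x)) \<and>
     (\<forall>n\<in>N. E n = n) \<and>
     (\<forall>a\<in>N. \<forall>x\<in>M. \<forall>b\<in>N. E (a o\<^sub>L x o\<^sub>L b) = a o\<^sub>L E x o\<^sub>L b) \<and>
     (\<forall>x\<in>M. \<tau> (E x) = \<tau> x)"

text \<open>
  Extensionality (a fixed value outside \<open>M\<close>) makes the conditional expectation unique as a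
  function on the whole type.
\<close>

definition cond_exp_onto ::
    "'h::complex_hilbert_space operator set \<Rightarrow> ('h operator \<Rightarrow> complex) \<Rightarrow> 'h operator set \<Rightarrow>
     'h operator \<Rightarrow> 'h operator" where
  "cond_exp_onto M \<tau> N = (THE E. E \<in> extensional M \<and> trace_preserving_cond_exp M \<tau> N E)"

text \<open>
  The values \<open>E\<^sub>N(x)\<close> lie in \<open>M\<close>, viewed inside \<open>L\<^sup>2(M,\<tau>)\<close>, so only the topology induced
  on \<open>M\<close> by the norm of \<open>L\<^sup>2(M,\<tau>)\<close> matters. The distance is set to \<open>0\<close> outside \<open>M\<close> because
  the locale \<open>Metric_space\<close> requires nonnegativity and symmetry on the whole type.
\<close>

definition L2_norm ::
    "('h::complex_hilbert_space operator \<Rightarrow> complex) \<Rightarrow> 'h operator \<Rightarrow> real" where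
  "L2_norm \<tau> x = sqrt (Re (\<tau> (op_adjoint x o\<^sub>L x)))"

definition L2_topology ::
    "'h::complex_hilbert_space operator set \<Rightarrow> ('h operator \<Rightarrow> complex) \<Rightarrow>
     'h operator topology" where
  "L2_topology M \<tau> = Metric_space.mtopology M
     (\<lambda>x y. if x \<in> M \<and> y \<in> M then L2_norm \<tau> (x - y) else 0)"

definition effros_marechal_topology ::
    "'h::complex_hilbert_space operator set \<Rightarrow> ('h operator \<Rightarrow> complex) \<Rightarrow>
     'h operator set topology" where
  "effros_marechal_topology M \<tau> = topology_generated_by
     {{N \<in> vn_subalgebras M. cond_exp_onto M \<tau> N x \<in> W} | x W.
        x \<in> M \<and> openin (L2_topology M \<tau>) W}"

section \<open>Trace-preserving actions and uniformly recurrent subalgebras\<close>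

definition star_automorphism ::
    "'h::complex_hilbert_space operator set \<Rightarrow> ('h operator \<Rightarrow> 'h operator) \<Rightarrow> bool" where
  "star_automorphism M \<theta> \<longleftrightarrow>
     bij_betw \<theta> M M \<and>
     (\<forall>x\<in>M. \<forall>y\<in>M. \<theta> (x + y) = \<theta> x + \<theta> y) \<and>
     (\<forall>c. \<forall>x\<in>M. \<theta> (op_scaleC c x) = op_scaleC c (\<theta> x)) \<and>
     (\<forall>x\<in>M. \<forall>y\<in>M. \<theta> (x o\<^sub>L y) = \<theta> x o\<^sub>L \<theta> y) \<and>
     (\<forall>x\<in>M. \<theta> (op_adjoint x) = op_adjoint (\<theta> x))"

definition trace_preserving_action ::
    "('g, 'm) monoid_scheme \<Rightarrow> 'h::complex_hilbert_space operator set \<Rightarrow>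
     ('h operator \<Rightarrow> complex) \<Rightarrow> ('g \<Rightarrow> 'h operator \<Rightarrow> 'h operator) \<Rightarrow> bool" where
  "trace_preserving_action \<Gamma> M \<tau> \<alpha> \<longleftrightarrow>
     (\<forall>g\<in>carrier \<Gamma>. star_automorphism M (\<alpha> g) \<and> (\<forall>x\<in>M. \<tau> (\<alpha> g x) = \<tau> x)) \<and>
     (\<forall>x\<in>M. \<alpha> \<one>\<^bsub>\<Gamma>\<^esub> x = x) \<and>
     (\<forall>g\<in>carrier \<Gamma>. \<forall>h\<in>carrier \<Gamma>. \<forall>x\<in>M. \<alpha> (g \<otimes>\<^bsub>\<Gamma>\<^esub> h) x = \<alpha> g (\<alpha> h x))"

definition closed_invariant ::
    "('g, 'm) monoid_scheme \<Rightarrow> 'h::complex_hilbert_space operator set \<Rightarrow>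
     ('h operator \<Rightarrow> complex) \<Rightarrow> ('g \<Rightarrow> 'h operator \<Rightarrow> 'h operator) \<Rightarrow>
     'h operator set set \<Rightarrow> bool" where
  "closed_invariant \<Gamma> M \<tau> \<alpha> V \<longleftrightarrow>
     closedin (effros_marechal_topology M \<tau>) V \<and> (\<forall>g\<in>carrier \<Gamma>. \<forall>N\<in>V. \<alpha> g ` N \<in> V)"

definition URA ::
    "('g, 'm) monoid_scheme \<Rightarrow> 'h::complex_hilbert_space operator set \<Rightarrow>
     ('h operator \<Rightarrow> complex) \<Rightarrow> ('g \<Rightarrow> 'h operator \<Rightarrow> 'h operator) \<Rightarrow>
     'h operator set set \<Rightarrow> bool" where
  "URA \<Gamma> M \<tau> \<alpha> U \<longleftrightarrow>
     U \<noteq> {} \<and> closed_invariant \<Gamma> M \<tau> \<alpha> U \<and>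
     (\<forall>V\<subseteq>U. V \<noteq> {} \<and> closed_invariant \<Gamma> M \<tau> \<alpha> V \<longrightarrow> V = U)"

section \<open>The Pimsner--Popa index\<close>

definition pp_constants ::
    "'h::complex_hilbert_space operator set \<Rightarrow> ('h operator \<Rightarrow> complex) \<Rightarrow> 'h operator set \<Rightarrow>
     real set" where
  "pp_constants M \<tau> N =
     {c. c > 0 \<and> (\<forall>x\<in>positive_cone M. operator_le (c *\<^sub>R x) (cond_exp_onto M \<tau> N x))}"

definition pp_lambda ::
    "'h::complex_hilbert_space operator set \<Rightarrow> ('h operator \<Rightarrow> complex) \<Rightarrow> 'h operator set \<Rightarrow>
     real" where
  "pp_lambda M \<tau> N = (if pp_constants M \<tau> N = {} then 0 else Sup (pp_constants M \<tau> N))"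

text \<open>In \<open>ennreal\<close>, the inverse of \<open>0\<close> is \<open>\<infinity>\<close>.\<close>

definition pimsner_popa_index ::
    "'h::complex_hilbert_space operator set \<Rightarrow> ('h operator \<Rightarrow> complex) \<Rightarrow> 'h operator set \<Rightarrow>
     ennreal" where
  "pimsner_popa_index M \<tau> N = inverse (ennreal (pp_lambda M \<tau> N))"

end

theory Submission
  imports Defs "HOL-Real_Asymp.Real_Asymp"
begin

text \<open>
  Fix \<open>c > 0\<close>. The set of all \<open>N\<close> such that \<open>c x \<le> E\<^sub>N(x)\<close> for every positive \<open>x \<in> M\<close> is closed in the
  Effros--Marechal topology, because \<open>N \<mapsto> E\<^sub>N(x)\<close> is continuous into the \<open>L\<^sup>2\<close>-norm and operator inequalities
  survive limits in \<open>L\<^sup>2\<close>-norm (\<open>closedin_index_bound\<close>). It is also invariant under trace-preserving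
  automorphisms \<open>\<theta>\<close>, because \<open>E\<^bsub>\<theta>(N)\<^esub> = \<theta> E\<^sub>N \<theta>\<^sup>-\<^sup>1\<close> and \<open>\<theta>\<close> preserves positivity (\<open>index_bound_invariant\<close>).
  By minimality, a uniformly recurrent family that meets this set is contained in it
  (\<open>URA_index_bound\<close>). So all its members admit the same constants \<open>c\<close>, and have the same index.

  All of this depends on \<open>E\<^sub>N\<close> being an honest function of \<open>N\<close>, that is, on the existence and uniqueness of
  the trace-preserving conditional expectation, which takes up most of the development. The value \<open>E\<^sub>N(x)\<close>
  is the element \<open>y \<in> N\<close> with \<open>\<tau>(y n) = \<tau>(x n)\<close> for all \<open>n \<in> N\<close>. It is unique by faithfulness. For
  \<open>0 \<le> x \<le> 1\<close> it is found as the point of \<open>{z \<in> N. 0 \<le> z \<le> 1}\<close> nearest to \<open>x\<close> in \<open>L\<^sup>2\<close>-norm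
  (\<open>unit_interval_projection\<close>). The nearest point exists because operator norm balls of \<open>N\<close> are complete in
  \<open>L\<^sup>2\<close>-norm (\<open>L2_complete\<close>), and it has the right pairings by a Radon--Nikodym argument that tests it
  against smoothed spectral projections (\<open>approximate_positive_part\<close>).

  The algebra acts on an arbitrary Hilbert space, not on \<open>L\<^sup>2(M, \<tau>)\<close>. The link between the two is a dense set
  of vectors \<open>v\<close> with \<open>\<parallel>y v\<parallel> \<le> C \<parallel>y\<parallel>\<^sub>2\<close> for all \<open>y \<in> M\<close> (\<open>tau_bounded_dense\<close>), which exists because \<open>\<tau>\<close> is normal
  and faithful. On these vectors convergence in \<open>L\<^sup>2\<close>-norm implies pointwise convergence; this gives both the
  completeness and the closedness of operator inequalities.
\<close>

section \<open>Minimizing sequences for positive semidefinite forms\<close>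

text \<open>
  The form lives on a subspace only, because the forms of interest are defined by a trace on an
  operator algebra and say nothing about operators outside it. It may be degenerate, and no
  completeness is assumed, so the projection theorem survives only as a statement about sequences.
\<close>

locale psd_form =
  fixes W :: "'v::real_vector set" and B :: "'v \<Rightarrow> 'v \<Rightarrow> real"
  assumes subspace_W: "subspace W"
    and sym: "x \<in> W \<Longrightarrow> y \<in> W \<Longrightarrow> B x y = B y x"
    and add_left: "x \<in> W \<Longrightarrow> y \<in> W \<Longrightarrow> z \<in> W \<Longrightarrow> B (x + y) z = B x z + B y z"
    and scale_left: "x \<in> W \<Longrightarrow> y \<in> W \<Longrightarrow> B (r *\<^sub>R x) y = r * B x y"
    and nonneg: "x \<in> W \<Longrightarrow> 0 \<le> B x x"
begin

lemma closed_ops: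
  shows "x \<in> W \<Longrightarrow> y \<in> W \<Longrightarrow> x + y \<in> W" "x \<in> W \<Longrightarrow> r *\<^sub>R x \<in> W"
    "x \<in> W \<Longrightarrow> y \<in> W \<Longrightarrow> x - y \<in> W" "0 \<in> W"
  using subspace_W by (auto simp: subspace_add subspace_scale subspace_diff subspace_0)

lemma add_right: "x \<in> W \<Longrightarrow> y \<in> W \<Longrightarrow> z \<in> W \<Longrightarrow> B z (x + y) = B z x + B z y"
  by (metis sym add_left closed_ops(1))

lemma scale_right: "x \<in> W \<Longrightarrow> y \<in> W \<Longrightarrow> B x (r *\<^sub>R y) = r * B x y"
  by (metis sym scale_left closed_ops(2))

lemma minus_left: "x \<in> W \<Longrightarrow> y \<in> W \<Longrightarrow> B (- x) y = - B x y"
  using scale_left[of x y "-1"] by simp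

lemma minus_right: "x \<in> W \<Longrightarrow> y \<in> W \<Longrightarrow> B x (- y) = - B x y"
  using scale_right[of x y "-1"] by simp

lemma diff_left: "x \<in> W \<Longrightarrow> y \<in> W \<Longrightarrow> z \<in> W \<Longrightarrow> B (x - y) z = B x z - B y z"
  using add_left[of x "(-1) *\<^sub>R y" z] scale_left[of y z "-1"] closed_ops(2)[of y "-1"] by simp

lemma diff_right: "x \<in> W \<Longrightarrow> y \<in> W \<Longrightarrow> z \<in> W \<Longrightarrow> B z (x - y) = B z x - B z y"
  by (metis sym diff_left closed_ops(3))

lemmas form_simps = add_left add_right scale_left scale_right diff_left diff_right closed_ops

lemma Cauchy_Schwarz:
  assumes x: "x \<in> W" and y: "y \<in> W"
  shows "(B x y)\<^sup>2 \<le> B x x * B y y"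
proof -
  have q: "0 \<le> B x x + 2 * t * B x y + t\<^sup>2 * B y y" for t
  proof -
    have "0 \<le> B (x + t *\<^sub>R y) (x + t *\<^sub>R y)"
      using x y by (intro nonneg closed_ops)
    also have "\<dots> = B x x + 2 * t * B x y + t\<^sup>2 * B y y"
      using x y by (simp add: form_simps sym[of y x] power2_eq_square algebra_simps)
    finally show ?thesis .
  qed
  show ?thesis
  proof (cases "B y y = 0")
    case True
    have "B x y = 0"
    proof (rule ccontr)
      assume n: "B x y \<noteq> 0"
      show False
        using q[of "- (B x x + 1) / (2 * B x y)"] True n by (simp add: field_simps)
    qed
    then show ?thesis using True by simp
  next
    case False
    with nonneg[OF y] have p: "B y y > 0" by simp
    have "0 \<le> (B x x + 2 * (- B x y / B y y) * B x y + (- B x y / B y y)\<^sup>2 * B y y) * B y y"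
      using q[of "- B x y / B y y"] p by (intro mult_nonneg_nonneg) auto
    also have "\<dots> = B x x * B y y - (B x y)\<^sup>2"
      using p by (simp add: field_simps power2_eq_square)
    finally show ?thesis by simp
  qed
qed

lemma Cauchy_Schwarz_abs:
  assumes "x \<in> W" "y \<in> W"
  shows "\<bar>B x y\<bar> \<le> sqrt (B x x) * sqrt (B y y)"
  using real_sqrt_le_mono[OF Cauchy_Schwarz[OF assms]] by (simp add: real_sqrt_mult)

lemma seminorm_triangle:
  assumes x: "x \<in> W" and y: "y \<in> W"
  shows "sqrt (B (x + y) (x + y)) \<le> sqrt (B x x) + sqrt (B y y)"
proof (rule real_le_lsqrt)
  have "B (x + y) (x + y) = B x x + 2 * B x y + B y y"
    using x y by (simp add: form_simps sym[of y x])
  also have "\<dots> \<le> B x x + 2 * (sqrt (B x x) * sqrt (B y y)) + B y y"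
    using Cauchy_Schwarz_abs[OF x y] by simp
  also have "\<dots> = (sqrt (B x x) + sqrt (B y y))\<^sup>2"
    using nonneg[OF x] nonneg[OF y] by (simp add: power2_sum)
  finally show "B (x + y) (x + y) \<le> (sqrt (B x x) + sqrt (B y y))\<^sup>2" .
qed (use x y nonneg in auto)

lemma form_diff_le:
  assumes x: "x \<in> W" and y: "y \<in> W"
  shows "B (x - y) (x - y) \<le> 2 * B x x + 2 * B y y"
proof -
  have "B (x - y) (x - y) + B (x + y) (x + y) = 2 * B x x + 2 * B y y"
    using x y by (simp add: form_simps sym[of y x])
  then show ?thesis using nonneg[of "x + y"] closed_ops x y by force
qed

text \<open>
  The parallelogram law makes any sequence that nearly minimizes the quadratic functional
  \<open>z \<mapsto> B z z - 2 * f z\<close> on a convex set a Cauchy sequence, and comparing its value at \<open>x j\<close> with the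
  values on the segment towards \<open>z\<close> gives the variational inequality up to an error. Keeping explicit
  errors replaces the minimizer, which need not exist. With \<open>f = B x\<close> this is approximation of \<open>x\<close> by
  the nearest point of \<open>C\<close>.
\<close>

lemma minimizing_sequence:
  assumes C: "C \<subseteq> W" "convex C" "C \<noteq> {}"
    and f_add: "\<And>x y. x \<in> W \<Longrightarrow> y \<in> W \<Longrightarrow> f (x + y) = f x + f y"
    and f_scale: "\<And>r x. x \<in> W \<Longrightarrow> f (r *\<^sub>R x) = r * f x"
    and below: "\<And>z. z \<in> C \<Longrightarrow> - K \<le> B z z - 2 * f z"
  obtains x :: "nat \<Rightarrow> 'v" where "\<And>j. x j \<in> C"
    "\<And>i j. B (x i - x j) (x i - x j) \<le> 2 / (real i + 1) + 2 / (real j + 1)"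
    "\<And>j z. z \<in> C \<Longrightarrow>
       f (z - x j) - B (x j) (z - x j) \<le> (1 + B (z - x j) (z - x j)) / (2 * sqrt (real j + 1))"
proof -
  define F where "F z = B z z - 2 * f z" for z
  define m where "m = Inf (F ` C)"
  have bdd: "bdd_below (F ` C)"
    using below by (intro bdd_belowI[of _ "- K"]) (auto simp: F_def)
  have m_le: "m \<le> F z" if "z \<in> C" for z
    unfolding m_def using bdd that by (intro cInf_lower) auto
  have "\<exists>z\<in>C. F z < m + 1 / (real j + 1)" for j
  proof -
    have "Inf (F ` C) < m + 1 / (real j + 1)" by (simp add: m_def)
    then show ?thesis using cInf_less_iff[of "F ` C"] bdd C(3) by auto
  qed
  then obtain x where x: "\<And>j. x j \<in> C" "\<And>j. F (x j) < m + 1 / (real j + 1)"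
    by metis
  have xW: "x j \<in> W" for j using x C by blast
  have f_diff: "f (a - b) = f a - f b" if "a \<in> W" "b \<in> W" for a b
    using f_add[of a "(-1) *\<^sub>R b"] f_scale[of b "-1"] that closed_ops(2)[of b "-1"] by simp
  show ?thesis
  proof (rule that)
    show "x j \<in> C" for j by (rule x)
    show "B (x i - x j) (x i - x j) \<le> 2 / (real i + 1) + 2 / (real j + 1)" for i j
    proof -
      let ?h = "(1/2) *\<^sub>R x i + (1/2) *\<^sub>R x j"
      have "?h \<in> C" using x(1)[of i] x(1)[of j] C(2) by (intro convexD) auto
      then have "m \<le> F ?h" by (rule m_le)
      moreover have "B (x i - x j) (x i - x j) = 2 * F (x i) + 2 * F (x j) - 4 * F ?h"
        unfolding F_def using xW[of i] xW[of j]
        by (simp add: form_simps f_add f_scale sym[of "x j" "x i"] field_simps)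
      ultimately show ?thesis using x(2)[of i] x(2)[of j] by simp
    qed
    show "f (z - x j) - B (x j) (z - x j) \<le> (1 + B (z - x j) (z - x j)) / (2 * sqrt (real j + 1))"
      if z: "z \<in> C" for j z
    proof -
      \<comment> \<open>The step length balances the defect \<open>1 / (j + 1)\<close> of \<open>x j\<close>, divided by \<open>t\<close>, against the
        quadratic term, which is of order \<open>t\<close>.\<close>
      define t where "t = 1 / sqrt (real j + 1)"
      have t: "0 < t" "t \<le> 1" "t * t = 1 / (real j + 1)" by (auto simp: t_def)
      have zW: "z \<in> W" using z C by blast
      let ?d = "z - x j"
      have dW: "?d \<in> W" using zW xW closed_ops by blast
      have "(1 - t) *\<^sub>R x j + t *\<^sub>R z \<in> C"
        using t x(1) z C(2) by (intro convexD) auto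
      moreover have "(1 - t) *\<^sub>R x j + t *\<^sub>R z = x j + t *\<^sub>R ?d" by (simp add: algebra_simps)
      ultimately have "m \<le> F (x j + t *\<^sub>R ?d)" using m_le by metis
      also have "\<dots> = F (x j) + 2 * t * (B (x j) ?d - f ?d) + t * t * B ?d ?d"
      proof -
        have "B ?d (x j) = B (x j) ?d" by (rule sym[OF dW xW])
        then show ?thesis
          unfolding F_def using xW[of j] dW
          by (simp only: add_left add_right scale_left scale_right closed_ops(1,2) f_add f_scale)
            (simp add: algebra_simps)
      qed
      finally have "2 * t * (f ?d - B (x j) ?d) \<le> t * t + t * t * B ?d ?d"
        using x(2)[of j] t(3) by (simp add: algebra_simps)
      then have "2 * t * (f ?d - B (x j) ?d) \<le> 2 * t * ((1 + B ?d ?d) * t / 2)"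
        by (simp add: algebra_simps)
      then have "f ?d - B (x j) ?d \<le> (1 + B ?d ?d) * t / 2"
        using t(1) by simp
      then show ?thesis by (simp add: t_def)
    qed
  qed
qed

text \<open>
  On a whole subspace the variational inequality holds in both directions, so the minimizing sequence
  represents the functional asymptotically. The error bound is uniform in \<open>w\<close> on bounded sets, which
  allows \<open>w\<close> to vary with \<open>j\<close> later on.
\<close>

lemma Riesz_sequence:
  assumes f_add: "\<And>x y. x \<in> W \<Longrightarrow> y \<in> W \<Longrightarrow> f (x + y) = f x + f y"
    and f_scale: "\<And>r x. x \<in> W \<Longrightarrow> f (r *\<^sub>R x) = r * f x"
    and f_bound: "\<And>x. x \<in> W \<Longrightarrow> \<bar>f x\<bar> \<le> K * sqrt (B x x)"
  obtains x :: "nat \<Rightarrow> 'v" and R where "\<And>j. x j \<in> W"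
    "\<And>i j. B (x i - x j) (x i - x j) \<le> 2 / (real i + 1) + 2 / (real j + 1)"
    "\<And>j. B (x j) (x j) \<le> R"
    "\<And>j w. w \<in> W \<Longrightarrow> \<bar>f w - B (x j) w\<bar> \<le> (1 + B w w) / (2 * sqrt (real j + 1))"
proof -
  have below: "- (K\<^sup>2) \<le> B z z - 2 * f z" if z: "z \<in> W" for z
  proof -
    have "0 \<le> (sqrt (B z z) - K)\<^sup>2" by simp
    also have "\<dots> = B z z - 2 * (K * sqrt (B z z)) + K\<^sup>2"
      using nonneg[OF z] by (simp add: power2_diff)
    finally show ?thesis using f_bound[OF z] by simp
  qed
  have cv: "convex W" "W \<noteq> {}" using subspace_imp_convex[OF subspace_W] closed_ops by auto
  obtain x :: "nat \<Rightarrow> 'v" where x: "\<And>j. x j \<in> W"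
    "\<And>i j. B (x i - x j) (x i - x j) \<le> 2 / (real i + 1) + 2 / (real j + 1)"
    "\<And>j z. z \<in> W \<Longrightarrow>
       f (z - x j) - B (x j) (z - x j) \<le> (1 + B (z - x j) (z - x j)) / (2 * sqrt (real j + 1))"
    by (rule minimizing_sequence[where C = W and f = f and K = "K\<^sup>2"]) (use cv f_add f_scale below in auto)
  show ?thesis
  proof (rule that[where R = "2 * 4 + 2 * B (x 0) (x 0)"])
    show "x j \<in> W" for j by (rule x)
    show "B (x i - x j) (x i - x j) \<le> 2 / (real i + 1) + 2 / (real j + 1)" for i j by (rule x)
    show "B (x j) (x j) \<le> 2 * 4 + 2 * B (x 0) (x 0)" for j
    proof -
      have d: "x j - x 0 \<in> W" "- x 0 \<in> W"
        using x(1) closed_ops(2)[of "x 0" "-1"] by (simp_all add: closed_ops)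
      have "B (x j) (x j) \<le> 2 * B (x j - x 0) (x j - x 0) + 2 * B (- x 0) (- x 0)"
        using form_diff_le[OF d] by simp
      moreover have "B (x j - x 0) (x j - x 0) \<le> 4"
        using x(2)[of j 0] divide_left_mono[of 1 "real j + 1" 2] by simp
      moreover have "B (- x 0) (- x 0) = B (x 0) (x 0)"
        using minus_left[OF x(1) d(2)] minus_right[OF x(1) x(1)] by simp
      ultimately show ?thesis by simp
    qed
    show "\<bar>f w - B (x j) w\<bar> \<le> (1 + B w w) / (2 * sqrt (real j + 1))" if w: "w \<in> W" for j w
    proof -
      have 1: "f w - B (x j) w \<le> (1 + B w w) / (2 * sqrt (real j + 1))"
        using x(3)[of "x j + w" j] w x(1)[of j] closed_ops(1) by simp
      have w': "- w \<in> W" using w closed_ops(2)[of w "-1"] by simp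
      have "f (- w) - B (x j) (- w) \<le> (1 + B (- w) (- w)) / (2 * sqrt (real j + 1))"
        using x(3)[of "x j + - w" j] closed_ops(1)[OF x(1)[of j] w'] by simp
      moreover have "f (- w) = - f w" using f_scale[OF w, of "-1"] by simp
      moreover have "B (- w) (- w) = B w w" "B (x j) (- w) = - B (x j) w"
        using minus_left[OF w w'] minus_right[OF w w] minus_right[OF x(1)[of j] w] by simp_all
      ultimately have "- f w + B (x j) w \<le> (1 + B w w) / (2 * sqrt (real j + 1))" by simp
      with 1 show ?thesis by (simp add: abs_le_iff)
    qed
  qed
qed

end

section \<open>Riesz representation and adjoints\<close>

lemma Cauchy_of_inverse_bound:
  fixes x :: "nat \<Rightarrow> 'a::real_normed_vector"
  assumes "\<And>i j. (norm (x i - x j))\<^sup>2 \<le> c * (2 / (real i + 1) + 2 / (real j + 1))"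
  shows "Cauchy x"
proof (rule metric_CauchyI)
  fix e :: real assume e: "0 < e"
  have "(\<lambda>n. \<bar>c\<bar> * (4 / (real n + 1))) \<longlonglongrightarrow> 0" by real_asymp
  then have "\<forall>\<^sub>F n in sequentially. \<bar>c\<bar> * (4 / (real n + 1)) < e\<^sup>2"
    using e by (intro order_tendstoD) auto
  then obtain J where J: "\<And>n. n \<ge> J \<Longrightarrow> \<bar>c\<bar> * (4 / (real n + 1)) < e\<^sup>2"
    by (auto simp: eventually_sequentially)
  show "\<exists>J. \<forall>i\<ge>J. \<forall>j\<ge>J. dist (x i) (x j) < e"
  proof (intro exI allI impI)
    fix i j assume ij: "J \<le> i" "J \<le> j"
    have "(norm (x i - x j))\<^sup>2 \<le> \<bar>c\<bar> * (2 / (real i + 1) + 2 / (real j + 1))"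
      by (rule order_trans[OF assms]) (intro mult_right_mono, auto)
    also have "\<dots> \<le> \<bar>c\<bar> * (4 / (real J + 1))"
    proof (rule mult_left_mono)
      have "2 / (real i + 1) \<le> 2 / (real J + 1)" "2 / (real j + 1) \<le> 2 / (real J + 1)"
        using ij by (auto intro!: divide_left_mono)
      then show "2 / (real i + 1) + 2 / (real j + 1) \<le> 4 / (real J + 1)" by simp
    qed simp
    also have "\<dots> < e\<^sup>2" by (rule J) simp
    finally show "dist (x i) (x j) < e"
      using e by (simp add: dist_norm power2_less_imp_less)
  qed
qed

text \<open>
  In a Hilbert space the Riesz sequence converges. The whole space as \<open>S\<close> yields adjoints, and
  general \<open>S\<close> yields orthogonal projections.
\<close>

lemma Riesz_subspace:
  fixes f :: "'h::complex_hilbert_space \<Rightarrow> real"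
  assumes S: "subspace S"
    and f_add: "\<And>x y. x \<in> S \<Longrightarrow> y \<in> S \<Longrightarrow> f (x + y) = f x + f y"
    and f_scale: "\<And>r x. x \<in> S \<Longrightarrow> f (r *\<^sub>R x) = r * f x"
    and f_bound: "\<And>x. x \<in> S \<Longrightarrow> \<bar>f x\<bar> \<le> K * norm x"
  obtains u where "u \<in> closure S" "\<And>v. v \<in> S \<Longrightarrow> f v = inner u v"
proof -
  interpret psd_form S inner
    by unfold_locales (auto simp: S inner_add_left intro: inner_commute)
  obtain x R where x: "\<And>j. x j \<in> S"
    "\<And>i j. inner (x i - x j) (x i - x j) \<le> 2 / (real i + 1) + 2 / (real j + 1)"
    "\<And>j. inner (x j) (x j) \<le> R"
    "\<And>j w. w \<in> S \<Longrightarrow> \<bar>f w - inner (x j) w\<bar> \<le> (1 + inner w w) / (2 * sqrt (real j + 1))"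
    by (rule Riesz_sequence[where f = f and K = K])
      (use f_add f_scale f_bound in \<open>auto simp: norm_eq_sqrt_inner\<close>)
  have "Cauchy x"
    using x(2) by (intro Cauchy_of_inverse_bound[where c = 1]) (simp add: power2_norm_eq_inner)
  then obtain u where u: "x \<longlonglongrightarrow> u"
    using Cauchy_convergent_iff[of x] by (auto simp: convergent_def)
  show ?thesis
  proof (rule that)
    show "u \<in> closure S" using x(1) u closure_sequential by blast
    show "f v = inner u v" if v: "v \<in> S" for v
    proof -
      have "(\<lambda>j. (1 + inner v v) / (2 * sqrt (real j + 1))) \<longlonglongrightarrow> 0" by real_asymp
      then have "(\<lambda>j. f v - inner (x j) v) \<longlonglongrightarrow> 0"
        by (rule Lim_null_comparison[rotated]) (use x(4)[OF v] in auto)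
      moreover have "(\<lambda>j. f v - inner (x j) v) \<longlonglongrightarrow> f v - inner u v"
        by (intro tendsto_intros u)
      ultimately show ?thesis using LIMSEQ_unique by fastforce
    qed
  qed
qed

notation op_adjoint (\<open>(_\<^sup>\<star>)\<close> [1000] 1000)

lemma blinfun_compose_assoc: "(a o\<^sub>L b) o\<^sub>L c = a o\<^sub>L (b o\<^sub>L c)"
  by (rule blinfun_eqI) simp

lemma blinfun_compose_id [simp]: "a o\<^sub>L id_blinfun = a" "id_blinfun o\<^sub>L a = a"
  by (auto intro: blinfun_eqI)

lemmas blinfun_compose_distribs =
  bounded_bilinear.add_left[OF bounded_bilinear_blinfun_compose]
  bounded_bilinear.add_right[OF bounded_bilinear_blinfun_compose]
  bounded_bilinear.diff_left[OF bounded_bilinear_blinfun_compose]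
  bounded_bilinear.diff_right[OF bounded_bilinear_blinfun_compose]
  bounded_bilinear.scaleR_left[OF bounded_bilinear_blinfun_compose]
  bounded_bilinear.scaleR_right[OF bounded_bilinear_blinfun_compose]

text \<open>
  The complex inner product is determined by the real one and the complex structure. Complex-linear
  operators therefore can be studied with the real inner product alone.
\<close>

lemma Im_cinner: "Im (cinner x y) = - inner (\<i> *\<^sub>C x) y"
  by (simp add: Re_cinner[symmetric] cinner_scaleC_left)

lemma inner_imaginary: "inner (\<i> *\<^sub>C x) y = - inner x (\<i> *\<^sub>C y)"
proof -
  have "Im (cinner x y) = - Im (cinner y x)"
    using cinner_commute[of x y] by simp
  then show ?thesis by (simp add: Im_cinner inner_commute)
qed

lemma scaleC_decompose: "c *\<^sub>C x = Re c *\<^sub>R x + Im c *\<^sub>R (\<i> *\<^sub>C x)"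
proof -
  have "c *\<^sub>C x = (complex_of_real (Re c) + complex_of_real (Im c) * \<i>) *\<^sub>C x"
    by (metis complex_eq mult.commute)
  then show ?thesis
    by (simp only: scaleC_add_left scaleC_scaleC[symmetric] scaleC_of_real)
qed

lemma tendsto_scaleC: "f \<longlonglongrightarrow> x \<Longrightarrow> (\<lambda>n. c *\<^sub>C f n) \<longlonglongrightarrow> c *\<^sub>C (x :: 'h::complex_hilbert_space)"
proof -
  have "bounded_linear (\<lambda>x::'h. c *\<^sub>C x)"
    by (rule bounded_linear_intro[where K = "cmod c"])
      (auto simp: scaleC_add_right norm_scaleC scaleC_of_real[symmetric] scaleC_scaleC mult.commute)
  then show "f \<longlonglongrightarrow> x \<Longrightarrow> (\<lambda>n. c *\<^sub>C f n) \<longlonglongrightarrow> c *\<^sub>C x"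
    by (rule bounded_linear.tendsto)
qed

lemma scaleC_minus: "c *\<^sub>C (- x) = - (c *\<^sub>C x)" "c *\<^sub>C (x - y) = c *\<^sub>C x - c *\<^sub>C y"
proof -
  show 1: "c *\<^sub>C (- x) = - (c *\<^sub>C x)" for x
    by (metis scaleC_of_real scaleC_scaleC mult.commute scaleR_minus1_left)
  show "c *\<^sub>C (x - y) = c *\<^sub>C x - c *\<^sub>C y"
    using scaleC_add_right[of c x "- y"] 1[of y] by simp
qed

lemma adjoint_exists:
  fixes T :: "'h::complex_hilbert_space operator"
  shows "\<exists>S :: 'h operator. \<forall>\<xi> \<eta>. inner (T \<xi>) \<eta> = inner \<xi> (S \<eta>)"
proof -
  have "\<exists>u. \<forall>\<xi>. inner (T \<xi>) \<eta> = inner \<xi> u" for \<eta>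
  proof -
    obtain u where "\<And>\<xi>. \<xi> \<in> UNIV \<Longrightarrow> inner (T \<xi>) \<eta> = inner u \<xi>"
    proof (rule Riesz_subspace[where S = UNIV and f = "\<lambda>\<xi>. inner (T \<xi>) \<eta>" and K = "norm T * norm \<eta>"])
      show "\<bar>inner (T x) \<eta>\<bar> \<le> norm T * norm \<eta> * norm x" for x
      proof -
        have "\<bar>inner (T x) \<eta>\<bar> \<le> norm (T x) * norm \<eta>" by (rule Cauchy_Schwarz_ineq2)
        also have "\<dots> \<le> (norm T * norm x) * norm \<eta>" by (intro mult_right_mono norm_blinfun) auto
        finally show ?thesis by (simp add: mult_ac)
      qed
    qed (auto simp: blinfun.add_right blinfun.scaleR_right inner_add_left)
    then show ?thesis by (auto simp: inner_commute)
  qed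
  then obtain s where s: "\<And>\<xi> \<eta>. inner (T \<xi>) \<eta> = inner \<xi> (s \<eta>)" by metis
  have "bounded_linear s"
  proof (rule bounded_linear_intro[where K = "norm T"])
    show "s (x + y) = s x + s y" for x y
      by (rule vector_eq_ldot[THEN iffD1]) (simp add: inner_add_right s[symmetric])
    show "s (r *\<^sub>R x) = r *\<^sub>R s x" for r x
      by (rule vector_eq_ldot[THEN iffD1]) (simp add: s[symmetric])
    show "norm (s x) \<le> norm x * norm T" for x
    proof (cases "s x = 0")
      case False
      have "norm (s x) * norm (s x) = inner (T (s x)) x"
        by (simp add: s power2_norm_eq_inner[symmetric] power2_eq_square)
      also have "\<dots> \<le> norm (T (s x)) * norm x" by (rule norm_cauchy_schwarz)
      also have "\<dots> \<le> (norm T * norm (s x)) * norm x" by (intro mult_right_mono norm_blinfun) auto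
      finally show ?thesis using False by (simp add: mult_ac)
    qed simp
  qed
  then have "inner (T \<xi>) \<eta> = inner \<xi> (Blinfun s \<eta>)" for \<xi> \<eta>
    by (simp add: bounded_linear_Blinfun_apply s)
  then show ?thesis by (intro exI allI)
qed

lemma bounded_operatorsD: "T \<in> bounded_operators \<Longrightarrow> T (c *\<^sub>C \<xi>) = c *\<^sub>C T \<xi>"
  by (simp add: bounded_operators_def)

lemma cinner_adjoint_iff:
  assumes T: "T \<in> bounded_operators"
  shows "(\<forall>\<xi> \<eta>. cinner (T \<xi>) \<eta> = cinner \<xi> (S \<eta>)) \<longleftrightarrow> (\<forall>\<xi> \<eta>. inner (T \<xi>) \<eta> = inner \<xi> (S \<eta>))"
  (is "?L \<longleftrightarrow> ?R")
proof
  assume ?L then show ?R by (metis Re_cinner)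
next
  assume R: ?R
  show ?L
  proof (intro allI complex_eqI)
    fix \<xi> \<eta>
    show "Re (cinner (T \<xi>) \<eta>) = Re (cinner \<xi> (S \<eta>))" using R by (simp add: Re_cinner)
    show "Im (cinner (T \<xi>) \<eta>) = Im (cinner \<xi> (S \<eta>))"
      using R by (simp add: Im_cinner bounded_operatorsD[OF T, symmetric])
  qed
qed

lemma op_adjoint_eqI:
  assumes T: "T \<in> bounded_operators" and S: "\<And>\<xi> \<eta>. inner (T \<xi>) \<eta> = inner \<xi> (blinfun_apply S \<eta>)"
  shows "T\<^sup>\<star> = S"
  unfolding op_adjoint_def
proof (rule the_equality)
  show "\<forall>\<xi> \<eta>. cinner (T \<xi>) \<eta> = cinner \<xi> (S \<eta>)"
    by (rule cinner_adjoint_iff[OF T, THEN iffD2]) (intro allI S)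
  fix S' :: "'a operator" assume "\<forall>\<xi> \<eta>. cinner (T \<xi>) \<eta> = cinner \<xi> (S' \<eta>)"
  then have S': "\<forall>\<xi> \<eta>. inner (T \<xi>) \<eta> = inner \<xi> (S' \<eta>)" by (rule cinner_adjoint_iff[OF T, THEN iffD1])
  have "inner \<xi> (S' \<eta>) = inner \<xi> (S \<eta>)" for \<xi> \<eta>
    by (rule trans[OF S'[rule_format, symmetric] S])
  then have "\<forall>\<xi>. inner \<xi> (S' \<eta>) = inner \<xi> (S \<eta>)" for \<eta> by (rule allI)
  then show "S' = S" by (rule blinfun_eqI[OF vector_eq_ldot[THEN iffD1]])
qed

lemma inner_adjoint:
  assumes T: "T \<in> bounded_operators"
  shows "inner (T \<xi>) \<eta> = inner \<xi> (T\<^sup>\<star> \<eta>)" "inner (T\<^sup>\<star> \<eta>) \<xi> = inner \<eta> (T \<xi>)"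
proof -
  obtain S where S: "\<forall>\<xi> \<eta>. inner (T \<xi>) \<eta> = inner \<xi> (blinfun_apply S \<eta>)"
    using adjoint_exists ..
  have "T\<^sup>\<star> = S" by (rule op_adjoint_eqI[OF T S[rule_format]])
  show 1: "inner (T \<xi>) \<eta> = inner \<xi> (T\<^sup>\<star> \<eta>)" for \<xi> \<eta>
    unfolding \<open>T\<^sup>\<star> = S\<close> by (rule S[rule_format])
  show "inner (T\<^sup>\<star> \<eta>) \<xi> = inner \<eta> (T \<xi>)"
    using 1[of \<xi> \<eta>] inner_commute[of "T\<^sup>\<star> \<eta>" \<xi>] inner_commute[of \<eta> "T \<xi>"] by argo
qed

lemma adjoint_bounded_operators:
  assumes T: "T \<in> bounded_operators"
  shows "T\<^sup>\<star> \<in> bounded_operators"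
proof -
  have "T\<^sup>\<star> (\<i> *\<^sub>C \<eta>) = \<i> *\<^sub>C T\<^sup>\<star> \<eta>" for \<eta>
  proof (rule vector_eq_rdot[THEN iffD1], intro allI)
    fix \<xi>
    show "inner (T\<^sup>\<star> (\<i> *\<^sub>C \<eta>)) \<xi> = inner (\<i> *\<^sub>C T\<^sup>\<star> \<eta>) \<xi>"
      using T by (simp add: inner_adjoint inner_imaginary bounded_operatorsD)
  qed
  then have "T\<^sup>\<star> (c *\<^sub>C \<eta>) = c *\<^sub>C T\<^sup>\<star> \<eta>" for c \<eta>
    unfolding scaleC_decompose[of c] by (simp add: blinfun.add_right blinfun.scaleR_right)
  then show ?thesis by (simp add: bounded_operators_def)
qed

lemma op_scaleC_apply [simp]: "op_scaleC c T \<xi> = c *\<^sub>C T \<xi>"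
  by transfer simp

lemma bounded_operators_closed:
  fixes S T :: "'h::complex_hilbert_space operator"
  shows "S \<in> bounded_operators \<Longrightarrow> T \<in> bounded_operators \<Longrightarrow> S + T \<in> bounded_operators"
    "S \<in> bounded_operators \<Longrightarrow> T \<in> bounded_operators \<Longrightarrow> S - T \<in> bounded_operators"
    "S \<in> bounded_operators \<Longrightarrow> T \<in> bounded_operators \<Longrightarrow> S o\<^sub>L T \<in> bounded_operators"
    "T \<in> bounded_operators \<Longrightarrow> r *\<^sub>R T \<in> bounded_operators"
    "T \<in> bounded_operators \<Longrightarrow> op_scaleC c T \<in> bounded_operators"
    "(id_blinfun :: 'h operator) \<in> bounded_operators" "(0 :: 'h operator) \<in> bounded_operators"
proof -
  have r: "c *\<^sub>C (r *\<^sub>R x) = r *\<^sub>R (c *\<^sub>C (x::'h))" for c r x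
    unfolding scaleC_of_real[symmetric] scaleC_scaleC by (simp only: mult.commute)
  have z: "c *\<^sub>C (0::'h) = 0" for c using r[of c 0 0] by simp
  have cc: "c *\<^sub>C d *\<^sub>C x = d *\<^sub>C c *\<^sub>C (x::'h)" for c d x
    unfolding scaleC_scaleC by (simp only: mult.commute)
  show "S \<in> bounded_operators \<Longrightarrow> T \<in> bounded_operators \<Longrightarrow> S + T \<in> bounded_operators"
    "S \<in> bounded_operators \<Longrightarrow> T \<in> bounded_operators \<Longrightarrow> S - T \<in> bounded_operators"
    "S \<in> bounded_operators \<Longrightarrow> T \<in> bounded_operators \<Longrightarrow> S o\<^sub>L T \<in> bounded_operators"
    "T \<in> bounded_operators \<Longrightarrow> r *\<^sub>R T \<in> bounded_operators"
    "(id_blinfun :: 'h operator) \<in> bounded_operators" "(0 :: 'h operator) \<in> bounded_operators"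
    by (simp_all add: bounded_operators_def blinfun.add_left blinfun.diff_left blinfun.scaleR_left
        scaleC_add_right scaleC_minus r z)
  show "T \<in> bounded_operators \<Longrightarrow> op_scaleC c T \<in> bounded_operators"
    unfolding bounded_operators_def mem_Collect_eq op_scaleC_apply by (metis cc)
qed

lemma adjoint_simps:
  assumes S: "S \<in> bounded_operators" and T: "T \<in> bounded_operators"
  shows "(S + T)\<^sup>\<star> = S\<^sup>\<star> + T\<^sup>\<star>" "(S - T)\<^sup>\<star> = S\<^sup>\<star> - T\<^sup>\<star>"
    "(S o\<^sub>L T)\<^sup>\<star> = T\<^sup>\<star> o\<^sub>L S\<^sup>\<star>" "(r *\<^sub>R T)\<^sup>\<star> = r *\<^sub>R T\<^sup>\<star>" "T\<^sup>\<star>\<^sup>\<star> = T"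
    "(op_scaleC c T)\<^sup>\<star> = op_scaleC (cnj c) (T\<^sup>\<star>)"
proof -
  show "(S + T)\<^sup>\<star> = S\<^sup>\<star> + T\<^sup>\<star>" "(S - T)\<^sup>\<star> = S\<^sup>\<star> - T\<^sup>\<star>"
    "(S o\<^sub>L T)\<^sup>\<star> = T\<^sup>\<star> o\<^sub>L S\<^sup>\<star>" "(r *\<^sub>R T)\<^sup>\<star> = r *\<^sub>R T\<^sup>\<star>" "T\<^sup>\<star>\<^sup>\<star> = T"
    using S T by (auto intro!: op_adjoint_eqI bounded_operators_closed adjoint_bounded_operators
        simp: blinfun.add_left blinfun.diff_left blinfun.scaleR_left inner_add_left inner_add_right
        inner_diff_left inner_diff_right inner_adjoint)
  show "(op_scaleC c T)\<^sup>\<star> = op_scaleC (cnj c) (T\<^sup>\<star>)"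
  proof (rule op_adjoint_eqI)
    show "op_scaleC c T \<in> bounded_operators" using T by (rule bounded_operators_closed)
    show "inner (op_scaleC c T \<xi>) \<eta> = inner \<xi> (op_scaleC (cnj c) (T\<^sup>\<star>) \<eta>)" for \<xi> \<eta>
      unfolding op_scaleC_apply scaleC_decompose[of c] scaleC_decompose[of "cnj c"]
      by (simp add: inner_add_left inner_diff_right inner_imaginary inner_adjoint(1)[OF T]
          bounded_operatorsD[OF adjoint_bounded_operators[OF T]])
  qed
qed

lemma adjoint_id [simp]: "(id_blinfun :: 'h::complex_hilbert_space operator)\<^sup>\<star> = id_blinfun"
  by (rule op_adjoint_eqI) (auto simp: bounded_operators_closed)

section \<open>Positive operators\<close>

text \<open>
  Nonnegativity of a complex quadratic form forces self-adjointness by polarization, so positivity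
  can be tested with the real inner product.
\<close>

lemma positive_operator_iff:
  "positive_operator T \<longleftrightarrow> T \<in> bounded_operators \<and> T\<^sup>\<star> = T \<and> (\<forall>\<xi>. 0 \<le> inner (T \<xi>) \<xi>)"
proof (cases "T \<in> bounded_operators")
  case T: True
  have nn: "z \<in> \<real>\<^sub>\<ge>\<^sub>0 \<longleftrightarrow> Im z = 0 \<and> 0 \<le> Re z" for z
    by (auto simp: complex_nonneg_Reals_iff)
  have "(\<forall>\<xi>. Im (cinner (T \<xi>) \<xi>) = 0) \<longleftrightarrow> T\<^sup>\<star> = T"
  proof
    assume sa: "T\<^sup>\<star> = T"
    have "inner (\<i> *\<^sub>C T \<xi>) \<xi> = - inner (\<i> *\<^sub>C T \<xi>) \<xi>" for \<xi>
    proof -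
      have "inner (\<i> *\<^sub>C T \<xi>) \<xi> = - inner (T \<xi>) (\<i> *\<^sub>C \<xi>)" by (rule inner_imaginary)
      also have "inner (T \<xi>) (\<i> *\<^sub>C \<xi>) = inner \<xi> (T (\<i> *\<^sub>C \<xi>))"
        using inner_adjoint(1)[OF T] sa by simp
      finally show ?thesis by (simp add: bounded_operatorsD[OF T] inner_commute)
    qed
    then show "\<forall>\<xi>. Im (cinner (T \<xi>) \<xi>) = 0" by (simp add: Im_cinner) 
  next
    assume im: "\<forall>\<xi>. Im (cinner (T \<xi>) \<xi>) = 0"
    then have z: "inner (\<i> *\<^sub>C T \<xi>) \<xi> = 0" for \<xi> by (simp add: Im_cinner)
    have pol: "inner (\<i> *\<^sub>C T \<xi>) \<eta> + inner (\<i> *\<^sub>C T \<eta>) \<xi> = 0" for \<xi> \<eta>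
      using z[of "\<xi> + \<eta>"] z[of \<xi>] z[of \<eta>]
      by (simp add: blinfun.add_right scaleC_add_right inner_add_left inner_add_right)
    show "T\<^sup>\<star> = T"
    proof (rule op_adjoint_eqI[OF T])
      fix \<xi> \<eta>
      have "\<i> *\<^sub>C \<i> *\<^sub>C T \<eta> = - T \<eta>"
        using scaleC_scaleC[of \<i> \<i> "T \<eta>"] scaleC_of_real[of "-1" "T \<eta>"] by simp
      moreover have "inner (\<i> *\<^sub>C T \<xi>) (\<i> *\<^sub>C \<eta>) = inner (T \<xi>) \<eta>"
        using inner_imaginary[of "T \<xi>" "\<i> *\<^sub>C \<eta>"] scaleC_scaleC[of \<i> \<i> \<eta>] scaleC_of_real[of "-1" \<eta>] by simp
      ultimately show "inner (T \<xi>) \<eta> = inner \<xi> (T \<eta>)"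
        using pol[of \<xi> "\<i> *\<^sub>C \<eta>"] by (simp add: bounded_operatorsD[OF T] inner_commute)
    qed
  qed
  then show ?thesis using T by (auto simp: positive_operator_def nn Re_cinner)
qed (simp add: positive_operator_def)

lemma positive_conj:
  assumes a: "positive_operator a" and T: "T \<in> bounded_operators"
  shows "positive_operator (T\<^sup>\<star> o\<^sub>L a o\<^sub>L T)"
proof -
  have a': "a \<in> bounded_operators" "a\<^sup>\<star> = a" "\<And>\<xi>. 0 \<le> inner (a \<xi>) \<xi>"
    using a by (auto simp: positive_operator_iff)
  have T': "T\<^sup>\<star> \<in> bounded_operators" "T\<^sup>\<star> o\<^sub>L a \<in> bounded_operators"
    using T a'(1) by (auto intro: adjoint_bounded_operators bounded_operators_closed)
  have "(T\<^sup>\<star> o\<^sub>L a o\<^sub>L T)\<^sup>\<star> = T\<^sup>\<star> o\<^sub>L (a o\<^sub>L T)"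
    by (simp only: adjoint_simps(3)[OF T'(2) T] adjoint_simps(3)[OF T'(1) a'(1)] adjoint_simps(5)[OF T T] a'(2))
  moreover have "0 \<le> inner ((T\<^sup>\<star> o\<^sub>L a o\<^sub>L T) \<xi>) \<xi>" for \<xi>
    using a'(3)[of "T \<xi>"] by (simp add: inner_adjoint(2)[OF T])
  ultimately show ?thesis
    unfolding positive_operator_iff
    using bounded_operators_closed(3)[OF T'(2) T] by (simp only: blinfun_compose_assoc simp_thms)
qed

lemma positive_id: "positive_operator (id_blinfun :: 'h::complex_hilbert_space operator)"
  by (simp add: positive_operator_iff bounded_operators_closed)

lemma adjoint_comp_positive:
  assumes T: "T \<in> bounded_operators"
  shows "positive_operator (T\<^sup>\<star> o\<^sub>L T)"
proof -
  show ?thesis using positive_conj[OF positive_id T] by simp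
qed

text \<open>
  The Cauchy--Schwarz inequality for the form \<open>\<langle>P \<xi>, \<eta>\<rangle>\<close>, at the pair \<open>\<xi>\<close>, \<open>P \<xi>\<close>, bounds \<open>\<parallel>P \<xi>\<parallel>\<^sup>4\<close> by
  \<open>r\<^sup>2 \<parallel>\<xi>\<parallel>\<^sup>2 \<parallel>P \<xi>\<parallel>\<^sup>2\<close>.
\<close>

lemma norm_le_of_positive:
  assumes P: "positive_operator P" and r: "\<And>\<xi>. inner (P \<xi>) \<xi> \<le> r * (norm \<xi>)\<^sup>2" and r0: "0 \<le> r"
  shows "norm P \<le> r"
proof (rule norm_blinfun_bound[OF r0])
  fix \<xi>
  have P': "P \<in> bounded_operators" "P\<^sup>\<star> = P" "\<And>\<xi>. 0 \<le> inner (P \<xi>) \<xi>"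
    using P by (auto simp: positive_operator_iff)
  have "inner (P \<xi>) \<eta> = inner (P \<eta>) \<xi>" for \<xi> \<eta>
    by (metis inner_adjoint(1)[OF P'(1)] P'(2) inner_commute)
  then interpret psd_form UNIV "\<lambda>\<xi> \<eta>. inner (P \<xi>) \<eta>"
    by unfold_locales (use P'(3) in \<open>simp_all add: blinfun.add_right blinfun.scaleR_right inner_add_left\<close>)
  show "norm (P \<xi>) \<le> r * norm \<xi>"
  proof (cases "P \<xi> = 0")
    case False
    have "(norm (P \<xi>))\<^sup>2 * (norm (P \<xi>))\<^sup>2 = (inner (P \<xi>) (P \<xi>))\<^sup>2"
      unfolding power2_norm_eq_inner by (simp only: power2_eq_square)
    also have "\<dots> \<le> inner (P \<xi>) \<xi> * inner (P (P \<xi>)) (P \<xi>)" by (rule Cauchy_Schwarz) auto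
    also have "\<dots> \<le> (r * (norm \<xi>)\<^sup>2) * (r * (norm (P \<xi>))\<^sup>2)"
      by (intro mult_mono r P') (use r0 in auto)
    finally have "(norm (P \<xi>))\<^sup>2 \<le> (r * norm \<xi>)\<^sup>2"
      using False by (simp add: power2_eq_square mult_ac)
    then show ?thesis using r0 by (simp add: power2_le_iff_abs_le)
  qed (use r0 in auto)
qed

section \<open>Von Neumann algebras and strong limits\<close>

lemma commutant_adjoint:
  assumes N: "N \<subseteq> bounded_operators" "\<And>x. x \<in> N \<Longrightarrow> x\<^sup>\<star> \<in> N" and t: "t \<in> commutant N"
  shows "t\<^sup>\<star> \<in> commutant N"
proof -
  have tB: "t \<in> bounded_operators" using t by (simp add: commutant_def)
  have "t\<^sup>\<star> o\<^sub>L s = s o\<^sub>L t\<^sup>\<star>" if s: "s \<in> N" for s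
  proof -
    have sB: "s \<in> bounded_operators" "s\<^sup>\<star> \<in> bounded_operators" using N s by auto
    have "t o\<^sub>L s\<^sup>\<star> = s\<^sup>\<star> o\<^sub>L t" using t N(2)[OF s] by (simp add: commutant_def)
    then have "(t o\<^sub>L s\<^sup>\<star>)\<^sup>\<star> = (s\<^sup>\<star> o\<^sub>L t)\<^sup>\<star>" by simp
    then show ?thesis
      by (simp add: adjoint_simps(3)[OF tB sB(2)] adjoint_simps(3)[OF sB(2) tB] adjoint_simps(5)[OF sB(1) sB(1)])
  qed
  then show ?thesis using adjoint_bounded_operators[OF tB] by (simp add: commutant_def)
qed

lemma commutant_closed:
  shows "a \<in> commutant S \<Longrightarrow> b \<in> commutant S \<Longrightarrow> a + b \<in> commutant S"
    "a \<in> commutant S \<Longrightarrow> b \<in> commutant S \<Longrightarrow> a - b \<in> commutant S"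
    "a \<in> commutant S \<Longrightarrow> b \<in> commutant S \<Longrightarrow> a o\<^sub>L b \<in> commutant S"
    "a \<in> commutant S \<Longrightarrow> r *\<^sub>R a \<in> commutant S"
    "S \<subseteq> bounded_operators \<Longrightarrow> a \<in> commutant S \<Longrightarrow> op_scaleC c a \<in> commutant S"
    "id_blinfun \<in> commutant S"
proof -
  show "a \<in> commutant S \<Longrightarrow> b \<in> commutant S \<Longrightarrow> a o\<^sub>L b \<in> commutant S"
  proof -
    assume a: "a \<in> commutant S" and b: "b \<in> commutant S"
    have "(a o\<^sub>L b) o\<^sub>L s = s o\<^sub>L (a o\<^sub>L b)" if "s \<in> S" for s
    proof -
      have "(a o\<^sub>L b) o\<^sub>L s = a o\<^sub>L (s o\<^sub>L b)"
        using b that by (simp add: commutant_def blinfun_compose_assoc)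
      also have "\<dots> = (s o\<^sub>L a) o\<^sub>L b"
        using a that by (simp add: commutant_def blinfun_compose_assoc[symmetric])
      finally show ?thesis by (simp add: blinfun_compose_assoc)
    qed
    then show ?thesis using a b by (simp add: commutant_def bounded_operators_closed)
  qed
  show "op_scaleC c a \<in> commutant S" if S: "S \<subseteq> bounded_operators" and a: "a \<in> commutant S"
  proof -
    have "op_scaleC c a o\<^sub>L s = s o\<^sub>L op_scaleC c a" if s: "s \<in> S" for s
    proof (rule blinfun_eqI)
      fix \<xi>
      have "a (s \<xi>) = s (a \<xi>)"
        using a s by (metis (mono_tags, lifting) commutant_def mem_Collect_eq blinfun_apply_blinfun_compose)
      then show "(op_scaleC c a o\<^sub>L s) \<xi> = (s o\<^sub>L op_scaleC c a) \<xi>"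
        using S s by (auto simp: bounded_operatorsD)
    qed
    then show ?thesis using a by (simp add: commutant_def bounded_operators_closed)
  qed
qed (simp_all add: commutant_def bounded_operators_closed blinfun_compose_distribs)

lemma commutant_apply:
  assumes "a \<in> commutant S" "s \<in> S"
  shows "a (s \<xi>) = s (a \<xi>)"
proof -
  have "a o\<^sub>L s = s o\<^sub>L a" using assms by (simp add: commutant_def)
  then show ?thesis by (metis blinfun_apply_blinfun_compose)
qed

locale von_neumann =
  fixes N :: "'h::complex_hilbert_space operator set"
  assumes vN: "von_neumann_algebra N"
begin

lemma bicommutant: "commutant (commutant N) = N"
  and bounded: "x \<in> N \<Longrightarrow> x \<in> bounded_operators"
  and adjoint: "x \<in> N \<Longrightarrow> x\<^sup>\<star> \<in> N"
  using vN by (auto simp: von_neumann_algebra_def)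

lemma commutant_bounded: "commutant N \<subseteq> bounded_operators"
  by (auto simp: commutant_def)

lemma closed:
  shows "x \<in> N \<Longrightarrow> y \<in> N \<Longrightarrow> x + y \<in> N" "x \<in> N \<Longrightarrow> y \<in> N \<Longrightarrow> x - y \<in> N"
    "x \<in> N \<Longrightarrow> y \<in> N \<Longrightarrow> x o\<^sub>L y \<in> N" "x \<in> N \<Longrightarrow> r *\<^sub>R x \<in> N"
    "x \<in> N \<Longrightarrow> op_scaleC c x \<in> N" "id_blinfun \<in> N" "0 \<in> N"
proof -
  note c = commutant_closed[where S = "commutant N", unfolded bicommutant]
  show "x \<in> N \<Longrightarrow> y \<in> N \<Longrightarrow> x + y \<in> N" by (rule c(1))
  show "x \<in> N \<Longrightarrow> y \<in> N \<Longrightarrow> x - y \<in> N" by (rule c(2))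
  show "x \<in> N \<Longrightarrow> y \<in> N \<Longrightarrow> x o\<^sub>L y \<in> N" by (rule c(3))
  show "x \<in> N \<Longrightarrow> r *\<^sub>R x \<in> N" by (rule c(4))
  show "x \<in> N \<Longrightarrow> op_scaleC c x \<in> N" by (rule c(5)[OF commutant_bounded])
  show 1: "id_blinfun \<in> N" by (rule c(6))
  show "0 \<in> N" using c(2)[OF 1 1] by simp
qed

lemma subspace: "subspace N"
  by (simp add: subspace_def closed)

lemma commutant_star: "t \<in> commutant N \<Longrightarrow> t\<^sup>\<star> \<in> commutant N"
  by (rule commutant_adjoint) (auto intro: bounded adjoint)

lemma memI:
  assumes "T \<in> bounded_operators" "\<And>t. t \<in> commutant N \<Longrightarrow> T o\<^sub>L t = t o\<^sub>L T"
  shows "T \<in> N"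
proof -
  have "T \<in> commutant (commutant N)" using assms by (simp add: commutant_def[of "commutant N"])
  then show ?thesis by (simp add: bicommutant)
qed

lemma strong_limit:
  fixes T :: "'h operator"
  assumes y: "\<And>n. y n \<in> N" and lim: "\<And>v. (\<lambda>n. y n v) \<longlonglongrightarrow> T v"
  shows "T \<in> N"
proof (rule memI)
  have "T (c *\<^sub>C v) = c *\<^sub>C T v" for c v
  proof (rule LIMSEQ_unique)
    show "(\<lambda>n. y n (c *\<^sub>C v)) \<longlonglongrightarrow> T (c *\<^sub>C v)" by (rule lim)
    show "(\<lambda>n. y n (c *\<^sub>C v)) \<longlonglongrightarrow> c *\<^sub>C T v"
      using tendsto_scaleC[OF lim] by (simp add: bounded_operatorsD[OF bounded[OF y]])
  qed
  then show "T \<in> bounded_operators" by (simp add: bounded_operators_def)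
  show "T o\<^sub>L t = t o\<^sub>L T" if t: "t \<in> commutant N" for t
  proof (rule blinfun_eqI)
    fix v
    have "(\<lambda>n. y n (t v)) \<longlonglongrightarrow> T (t v)" by (rule lim)
    moreover have "(\<lambda>n. t (y n v)) \<longlonglongrightarrow> t (T v)" by (intro tendsto_intros lim)
    moreover have "t (y n v) = y n (t v)" for n by (rule commutant_apply[OF t y])
    ultimately have "(\<lambda>n. y n (t v)) \<longlonglongrightarrow> t (T v)" by simp
    then show "(T o\<^sub>L t) v = (t o\<^sub>L T) v"
      using LIMSEQ_unique[OF lim[of "t v"]] by simp
  qed
qed

end

lemma strong_limit_of_dense:
  fixes y :: "nat \<Rightarrow> 'h::complex_hilbert_space operator"
  assumes bd: "\<And>n. norm (y n) \<le> R" and dense: "closure D = UNIV"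
    and Cau: "\<And>v. v \<in> D \<Longrightarrow> Cauchy (\<lambda>n. y n v)"
  obtains T :: "'h operator" where "\<And>v. (\<lambda>n. y n v) \<longlonglongrightarrow> T v"
proof -
  have R: "0 \<le> R" using bd[of 0] norm_ge_zero order_trans by blast
  have y_bd: "norm (y n v) \<le> R * norm v" for n v
    by (rule order_trans[OF norm_blinfun]) (intro mult_right_mono bd norm_ge_zero)
  have all: "Cauchy (\<lambda>n. y n v)" for v
  proof (rule metric_CauchyI)
    fix e :: real assume e: "0 < e"
    define d where "d = e / (4 * (R + 1))"
    have d: "0 < d" using e R by (simp add: d_def)
    have "v \<in> closure D" using dense by simp
    then obtain u where u: "u \<in> D" "dist u v < d" using d by (auto simp: closure_approachable)
    obtain J where J: "\<And>m n. m \<ge> J \<Longrightarrow> n \<ge> J \<Longrightarrow> dist (y m u) (y n u) < e / 2"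
      using Cau[OF u(1)] e unfolding Cauchy_def by (meson half_gt_zero)
    have uv: "dist (y n v) (y n u) \<le> e / 4" for n
    proof -
      have "dist (y n v) (y n u) = norm (y n (v - u))" by (simp add: dist_norm blinfun.diff_right)
      also have "\<dots> \<le> R * norm (v - u)" by (rule y_bd)
      also have "\<dots> \<le> (R + 1) * d"
        using u(2) R by (intro mult_mono) (auto simp: dist_norm norm_minus_commute)
      also have "\<dots> = e / 4" using R by (simp add: d_def field_simps)
      finally show ?thesis .
    qed
    show "\<exists>J. \<forall>m\<ge>J. \<forall>n\<ge>J. dist (y m v) (y n v) < e"
    proof (intro exI allI impI)
      fix m n assume "J \<le> m" "J \<le> n"
      then have "dist (y m u) (y n u) < e / 2" by (rule J)
      moreover have "dist (y m v) (y n v) \<le> dist (y m v) (y m u) + dist (y m u) (y n u) + dist (y n v) (y n u)"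
        by (metis (no_types) dist_commute dist_triangle order_trans add_right_mono)
      ultimately show "dist (y m v) (y n v) < e" using uv[of m] uv[of n] by linarith
    qed
  qed
  then have "\<exists>l. (\<lambda>n. y n v) \<longlonglongrightarrow> l" for v
    using Cauchy_convergent_iff[of "\<lambda>n. y n v"] by (auto simp: convergent_def)
  then obtain T where T: "\<And>v. (\<lambda>n. y n v) \<longlonglongrightarrow> T v" by metis
  have "bounded_linear T"
  proof (rule bounded_linear_intro[where K = R])
    show "T (u + v) = T u + T v" for u v
      by (rule LIMSEQ_unique[OF T]) (simp add: blinfun.add_right tendsto_add T)
    show "T (r *\<^sub>R v) = r *\<^sub>R T v" for r v
      by (rule LIMSEQ_unique[OF T]) (simp add: blinfun.scaleR_right tendsto_scaleR T)
    show "norm (T v) \<le> norm v * R" for v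
      by (rule LIMSEQ_le_const2[OF tendsto_norm[OF T]]) (use y_bd in \<open>auto simp: mult.commute\<close>)
  qed
  then show ?thesis using that[of "Blinfun T"] T by (simp add: bounded_linear_Blinfun_apply)
qed

lemma orthogonal_closure:
  fixes S :: "'h::real_inner set"
  assumes "\<And>v. v \<in> S \<Longrightarrow> inner w v = 0" "u \<in> closure S"
  shows "inner w u = 0"
proof -
  obtain f where f: "\<And>n. f n \<in> S" "f \<longlonglongrightarrow> u" using assms(2) closure_sequential by blast
  have "(\<lambda>n. inner w (f n)) \<longlonglongrightarrow> inner w u" by (intro tendsto_intros f)
  moreover have "inner w (f n) = 0" for n using f(1) by (rule assms(1))
  ultimately have "(\<lambda>n. 0) \<longlonglongrightarrow> inner w u" by simp
  then show ?thesis by (rule LIMSEQ_unique[OF _ tendsto_const])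
qed

lemma LIMSEQ_in_closure:
  fixes f :: "nat \<Rightarrow> 'v::real_normed_vector"
  assumes "\<And>n. f n \<in> S" "f \<longlonglongrightarrow> x"
  shows "x \<in> closure S"
  unfolding closure_sequential using assms by (intro exI[of _ f]) simp

lemma subspace_of_closure:
  fixes S :: "'v::real_normed_vector set"
  assumes S: "subspace S"
  shows "subspace (closure S)"
proof (rule subspaceI)
  show "0 \<in> closure S" using subspace_0[OF S] closure_subset by blast
  fix x y r assume "x \<in> closure S" "y \<in> closure S"
  then obtain f g where f: "\<And>n. f n \<in> S" "f \<longlonglongrightarrow> x" and g: "\<And>n. g n \<in> S" "g \<longlonglongrightarrow> y"
    unfolding closure_sequential by blast
  have S: "f n + g n \<in> S" "r *\<^sub>R f n \<in> S" for n
    using f(1) g(1) S by (auto intro: subspace_add subspace_scale)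
  show "x + y \<in> closure S" by (rule LIMSEQ_in_closure[OF S(1) tendsto_add[OF f(2) g(2)]])
  show "r *\<^sub>R x \<in> closure S"
    by (rule LIMSEQ_in_closure[OF S(2) tendsto_scaleR[OF tendsto_const f(2)]])
qed

text \<open>
  The operator is the orthogonal projection onto the complement of \<open>S\<close>. An operator that preserves
  \<open>S\<close> together with its adjoint also preserves the complement, hence commutes with the projection.
\<close>

lemma annihilating_projection:
  fixes S :: "'h::complex_hilbert_space set"
  assumes S: "subspace S" and SC: "\<And>c v. v \<in> S \<Longrightarrow> c *\<^sub>C v \<in> S" and ne: "closure S \<noteq> UNIV"
  obtains Q :: "'h operator" where "Q \<in> bounded_operators" "Q \<noteq> 0" "\<And>v. v \<in> S \<Longrightarrow> Q v = 0"
    "\<And>t. t \<in> bounded_operators \<Longrightarrow> t ` S \<subseteq> S \<Longrightarrow> (t\<^sup>\<star>) ` S \<subseteq> S \<Longrightarrow> Q o\<^sub>L t = t o\<^sub>L Q"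
proof -
  have clS: "subspace (closure S)" using S by (rule subspace_of_closure)
  let ?R = "\<lambda>\<xi> w. \<xi> - w \<in> closure S \<and> (\<forall>v\<in>S. inner w v = 0)"
  have ex: "\<exists>w. ?R \<xi> w" for \<xi>
  proof -
    obtain u where u: "u \<in> closure S" "\<And>v. v \<in> S \<Longrightarrow> inner \<xi> v = inner u v"
      by (rule Riesz_subspace[OF S, where f = "inner \<xi>" and K = "norm \<xi>"])
        (auto simp: inner_add_right Cauchy_Schwarz_ineq2)
    have "?R \<xi> (\<xi> - u)" using u by (simp add: inner_diff_left)
    then show ?thesis by blast
  qed
  have uniq: "w = w'" if "?R \<xi> w" "?R \<xi> w'" for \<xi> w w'
  proof -
    have "(\<xi> - w') - (\<xi> - w) \<in> closure S" using that clS subspace_diff by blast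
    then have "w - w' \<in> closure S" by simp
    moreover have "inner (w - w') v = 0" if "v \<in> S" for v
      using that \<open>?R \<xi> w\<close> \<open>?R \<xi> w'\<close> by (simp add: inner_diff_left)
    ultimately have "inner (w - w') (w - w') = 0" using orthogonal_closure[of S "w - w'"] by blast
    then show ?thesis by simp
  qed
  obtain q where q: "\<And>\<xi>. ?R \<xi> (q \<xi>)" using ex by metis
  have "bounded_linear q"
  proof (rule bounded_linear_intro[where K = 1])
    show "q (x + y) = q x + q y" for x y
    proof (rule uniq[OF q])
      have "(x - q x) + (y - q y) \<in> closure S" using q clS subspace_add by blast
      then show "?R (x + y) (q x + q y)" using q by (simp add: inner_add_left algebra_simps)
    qed
    show "q (r *\<^sub>R x) = r *\<^sub>R q x" for r x
    proof (rule uniq[OF q])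
      have "r *\<^sub>R (x - q x) \<in> closure S" using q clS subspace_scale by blast
      then show "?R (r *\<^sub>R x) (r *\<^sub>R q x)" using q by (simp add: algebra_simps)
    qed
    show "norm (q x) \<le> norm x * 1" for x
    proof -
      have "inner (q x) (x - q x) = 0" using q by (auto intro: orthogonal_closure[of S "q x"])
      then have "norm (q x) * norm (q x) = inner (q x) x"
        by (simp add: inner_diff_right norm_eq_sqrt_inner)
      also have "\<dots> \<le> norm (q x) * norm x" by (rule norm_cauchy_schwarz)
      finally show ?thesis by (cases "q x = 0") auto
    qed
  qed
  then have Q: "Blinfun q \<xi> = q \<xi>" for \<xi> by (simp add: bounded_linear_Blinfun_apply)
  have cl_im: "t u \<in> closure S" if t: "t ` S \<subseteq> S" and u: "u \<in> closure S" for t :: "'h operator" and u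
  proof -
    obtain f where f: "\<And>n. f n \<in> S" "f \<longlonglongrightarrow> u" using u closure_sequential by blast
    have "(\<lambda>n. t (f n)) \<longlonglongrightarrow> t u" by (intro tendsto_intros f)
    moreover have "t (f n) \<in> S" for n using f(1)[of n] t by blast
    ultimately show ?thesis by (rule LIMSEQ_in_closure[rotated])
  qed
  have comm: "q (t \<xi>) = t (q \<xi>)"
    if t: "t \<in> bounded_operators" "t ` S \<subseteq> S" "(t\<^sup>\<star>) ` S \<subseteq> S" for t \<xi>
  proof (rule uniq[OF q])
    have "t (\<xi> - q \<xi>) \<in> closure S" using cl_im[OF t(2)] q by blast
    moreover have "inner (t (q \<xi>)) v = 0" if "v \<in> S" for v
      using q[of \<xi>] t(3) that inner_adjoint(1)[OF t(1), of "q \<xi>" v] by auto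
    ultimately show "?R (t \<xi>) (t (q \<xi>))" by (simp add: blinfun.diff_right)
  qed
  show ?thesis
  proof (rule that[of "Blinfun q"])
    have "q (c *\<^sub>C \<xi>) = c *\<^sub>C q \<xi>" for c \<xi>
    proof -
      let ?t = "op_scaleC c (id_blinfun :: 'h operator)"
      have "?t \<in> bounded_operators" by (intro bounded_operators_closed)
      moreover have "?t\<^sup>\<star> = op_scaleC (cnj c) id_blinfun"
        using adjoint_simps(6)[of id_blinfun id_blinfun c] by (simp add: bounded_operators_closed)
      ultimately show ?thesis using comm[of ?t \<xi>] SC by auto
    qed
    then show "Blinfun q \<in> bounded_operators" by (simp add: bounded_operators_def Q)
    show "Blinfun q v = 0" if "v \<in> S" for v
    proof -
      have "?R v 0" using that closure_subset[of S] by auto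
      then have "q v = 0" by (rule uniq[OF q])
      then show ?thesis by (simp only: Q)
    qed
    show "Blinfun q \<noteq> 0"
    proof
      assume "Blinfun q = 0"
      then have "q \<xi> = 0" for \<xi> using Q[of \<xi>] by simp
      then have "\<xi> \<in> closure S" for \<xi> using q[of \<xi>] by simp
      then show False using ne by auto
    qed
    show "Blinfun q o\<^sub>L t = t o\<^sub>L Blinfun q"
      if "t \<in> bounded_operators" "t ` S \<subseteq> S" "(t\<^sup>\<star>) ` S \<subseteq> S" for t
      using comm[OF that] by (intro blinfun_eqI) (simp add: Q)
  qed
qed

instance complex_hilbert_space \<subseteq> banach ..

section \<open>Square roots and inverses\<close>

text \<open>
  Writing the root of \<open>1 - b\<close> as \<open>1 - y\<close>, the equation becomes the fixed point equation
  \<open>y = (b + y\<^sup>2) / 2\<close>, whose right-hand side is a contraction of the ball of radius \<open>\<parallel>b\<parallel> < 1\<close>.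
\<close>

lemma sqrt_of_contraction:
  fixes A :: "'h::complex_hilbert_space operator set"
  assumes A: "subspace A" "closed A" "\<And>x y. x \<in> A \<Longrightarrow> y \<in> A \<Longrightarrow> x o\<^sub>L y \<in> A"
    and b: "b \<in> A" "norm b < 1"
  obtains y where "y \<in> A" "norm y \<le> norm b"
    "(id_blinfun - y) o\<^sub>L (id_blinfun - y) = id_blinfun - b"
proof -
  let ?S = "A \<inter> cball 0 (norm b)" and ?f = "\<lambda>y. (1/2) *\<^sub>R (b + (y o\<^sub>L y))"
  have "\<exists>!y\<in>?S. ?f y = y"
  proof (rule Banach_fix)
    show "complete ?S" using A(2) by (simp add: complete_eq_closed closed_Int)
    show "?S \<noteq> {}" using subspace_0[OF A(1)] by auto
    show "0 \<le> norm b" "norm b < 1" using b by auto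
    show "?f ` ?S \<subseteq> ?S"
    proof (rule image_subsetI, rule IntI)
      fix y assume y: "y \<in> ?S"
      show "?f y \<in> A" using y A b by (auto intro!: subspace_scale subspace_add)
      have "norm (y o\<^sub>L y) \<le> norm y * norm y" by (rule norm_blinfun_compose)
      also have "\<dots> \<le> 1 * norm b" using y b(2) by (intro mult_mono) auto
      finally show "?f y \<in> cball 0 (norm b)"
        using norm_triangle_ineq[of b "y o\<^sub>L y"] by simp
    qed
    show "dist (?f x) (?f y) \<le> norm b * dist x y" if "x \<in> ?S" "y \<in> ?S" for x y
    proof -
      have "?f x - ?f y = (1/2) *\<^sub>R (((x - y) o\<^sub>L x) + (y o\<^sub>L (x - y)))"
        by (simp add: blinfun_compose_distribs scaleR_right_diff_distrib[symmetric] del: scaleR_right_diff_distrib)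
      then have "dist (?f x) (?f y) = (1/2) * norm (((x - y) o\<^sub>L x) + (y o\<^sub>L (x - y)))"
        by (simp add: dist_norm)
      also have "\<dots> \<le> (1/2) * (norm (x - y) * norm x + norm y * norm (x - y))"
        by (intro mult_left_mono order_trans[OF norm_triangle_ineq] add_mono norm_blinfun_compose) auto
      also have "\<dots> \<le> (1/2) * (norm (x - y) * norm b + norm b * norm (x - y))"
        using that by (intro mult_left_mono add_mono mult_right_mono) auto
      finally show ?thesis by (simp add: dist_norm mult.commute)
    qed
  qed
  then obtain y where y: "y \<in> ?S" "?f y = y" by blast
  have "y + y = 2 *\<^sub>R ?f y" by (simp only: y(2) scaleR_2)
  then have yy: "y + y = b + (y o\<^sub>L y)" by simp
  have "(id_blinfun - y) o\<^sub>L (id_blinfun - y) = id_blinfun - (y + y) + (y o\<^sub>L y)"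
    by (simp add: blinfun_compose_distribs)
  then have "(id_blinfun - y) o\<^sub>L (id_blinfun - y) = id_blinfun - b"
    by (simp add: yy)
  then show ?thesis using that y(1) by auto
qed

text \<open>
  The inverse of \<open>1 - b\<close> is the fixed point of \<open>w \<mapsto> 1 + b w\<close>.
\<close>

lemma inverse_of_contraction:
  fixes A :: "'h::complex_hilbert_space operator set"
  assumes A: "subspace A" "closed A" "\<And>x y. x \<in> A \<Longrightarrow> y \<in> A \<Longrightarrow> x o\<^sub>L y \<in> A" "id_blinfun \<in> A"
    and b: "b \<in> A" "norm b < 1"
  obtains w where "w \<in> A" "(id_blinfun - b) o\<^sub>L w = id_blinfun"
proof -
  let ?f = "\<lambda>w. id_blinfun + (b o\<^sub>L w)"
  have "\<exists>!w\<in>A. ?f w = w"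
  proof (rule Banach_fix)
    show "complete A" using A(2) by (simp add: complete_eq_closed)
    show "A \<noteq> {}" using A(4) by auto
    show "0 \<le> norm b" "norm b < 1" using b by auto
    show "?f ` A \<subseteq> A" using A b by (auto intro!: subspace_add)
    show "dist (?f x) (?f y) \<le> norm b * dist x y" for x y
    proof -
      have "?f x - ?f y = b o\<^sub>L (x - y)" by (simp add: blinfun_compose_distribs)
      then show ?thesis using norm_blinfun_compose[of b "x - y"] by (simp only: dist_norm)
    qed
  qed
  then obtain w where "w \<in> A" "?f w = w" by blast
  moreover from this have "(id_blinfun - b) o\<^sub>L w = id_blinfun"
    by (simp add: blinfun_compose_distribs diff_eq_eq)
  ultimately show ?thesis using that by blast
qed

text \<open>
  For self-adjoint \<open>a\<close> this is the self-adjoint part of the von Neumann algebra generated by \<open>a\<close>. It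
  is a norm closed real algebra whose elements commute with each other, so the two fixed point
  arguments above apply inside it and their solutions are automatically self-adjoint, commute with \<open>a\<close>,
  and belong to every von Neumann algebra containing \<open>a\<close>.
\<close>

definition sa_bicommutant :: "'h::complex_hilbert_space operator \<Rightarrow> 'h operator set" where
  "sa_bicommutant a = {x \<in> bounded_operators. x\<^sup>\<star> = x \<and>
     (\<forall>t\<in>bounded_operators. a o\<^sub>L t = t o\<^sub>L a \<longrightarrow> x o\<^sub>L t = t o\<^sub>L x)}"

lemma sa_bicommutantD:
  assumes "x \<in> sa_bicommutant a"
  shows "x \<in> bounded_operators" "x\<^sup>\<star> = x"
    "\<And>t. t \<in> bounded_operators \<Longrightarrow> a o\<^sub>L t = t o\<^sub>L a \<Longrightarrow> x o\<^sub>L t = t o\<^sub>L x"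
  using assms by (auto simp: sa_bicommutant_def)

lemma self_adjoint_inner:
  assumes "x \<in> bounded_operators" "x\<^sup>\<star> = x"
  shows "inner (x \<xi>) \<eta> = inner \<xi> (x \<eta>)"
  using inner_adjoint(1)[OF assms(1), of \<xi> \<eta>] unfolding assms(2) .

lemma sa_bicommutant_self: "a \<in> bounded_operators \<Longrightarrow> a\<^sup>\<star> = a \<Longrightarrow> a \<in> sa_bicommutant a"
  by (simp add: sa_bicommutant_def)

lemma sa_bicommutant_id: "id_blinfun \<in> sa_bicommutant a"
  by (simp add: sa_bicommutant_def bounded_operators_closed)

lemma sa_bicommutant_subspace: "subspace (sa_bicommutant a)"
proof (rule subspaceI)
  have "(0 :: 'a operator)\<^sup>\<star> = 0"
    by (rule op_adjoint_eqI) (simp_all add: bounded_operators_closed)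
  then show "0 \<in> sa_bicommutant a" by (simp add: sa_bicommutant_def bounded_operators_closed)
  fix x y r assume x: "x \<in> sa_bicommutant a" and y: "y \<in> sa_bicommutant a"
  note X = sa_bicommutantD[OF x] and Y = sa_bicommutantD[OF y]
  show "x + y \<in> sa_bicommutant a"
    using X Y unfolding sa_bicommutant_def
    by (simp add: bounded_operators_closed adjoint_simps(1) blinfun_compose_distribs)
  show "r *\<^sub>R x \<in> sa_bicommutant a"
    using X unfolding sa_bicommutant_def
    by (simp add: bounded_operators_closed adjoint_simps(4) blinfun_compose_distribs)
qed

lemma sa_bicommutant_commute:
  assumes a: "a \<in> bounded_operators" and x: "x \<in> sa_bicommutant a" and y: "y \<in> sa_bicommutant a"
  shows "x o\<^sub>L y = y o\<^sub>L x"
proof -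
  have "y o\<^sub>L a = a o\<^sub>L y" using sa_bicommutantD(3)[OF y a] by simp
  then show ?thesis using sa_bicommutantD(3)[OF x sa_bicommutantD(1)[OF y]] by simp
qed

lemma sa_bicommutant_compose:
  assumes a: "a \<in> bounded_operators" and x: "x \<in> sa_bicommutant a" and y: "y \<in> sa_bicommutant a"
  shows "x o\<^sub>L y \<in> sa_bicommutant a"
proof -
  note X = sa_bicommutantD[OF x] and Y = sa_bicommutantD[OF y]
  have "(x o\<^sub>L y)\<^sup>\<star> = x o\<^sub>L y"
    by (simp only: adjoint_simps(3)[OF X(1) Y(1)] X(2) Y(2) sa_bicommutant_commute[OF a y x])
  moreover have "(x o\<^sub>L y) o\<^sub>L t = t o\<^sub>L (x o\<^sub>L y)" if t: "t \<in> bounded_operators" "a o\<^sub>L t = t o\<^sub>L a" for t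
    by (metis X(3)[OF t] Y(3)[OF t] blinfun_compose_assoc)
  ultimately show ?thesis
    using bounded_operators_closed(3)[OF X(1) Y(1)] by (simp add: sa_bicommutant_def)
qed

lemma sa_bicommutant_closed: "closed (sa_bicommutant a)"
  unfolding closed_sequential_limits
proof (intro allI impI, elim conjE)
  fix f l assume f: "\<forall>n. f n \<in> sa_bicommutant a" and l: "f \<longlonglongrightarrow> l"
  have lim: "(\<lambda>n. f n v) \<longlonglongrightarrow> l v" for v by (intro tendsto_intros l)
  note F = sa_bicommutantD[OF f[rule_format]]
  have "l (c *\<^sub>C v) = c *\<^sub>C l v" for c v
  proof (rule LIMSEQ_unique[OF lim])
    show "(\<lambda>n. f n (c *\<^sub>C v)) \<longlonglongrightarrow> c *\<^sub>C l v"
      using tendsto_scaleC[OF lim] by (simp add: bounded_operatorsD[OF F(1)])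
  qed
  then have lB: "l \<in> bounded_operators" by (simp add: bounded_operators_def)
  have "l\<^sup>\<star> = l"
  proof (rule op_adjoint_eqI[OF lB])
    fix \<xi> \<eta>
    have "(\<lambda>n. inner (f n \<xi>) \<eta>) \<longlonglongrightarrow> inner (l \<xi>) \<eta>" by (intro tendsto_intros lim)
    moreover have "(\<lambda>n. inner \<xi> (f n \<eta>)) \<longlonglongrightarrow> inner \<xi> (l \<eta>)" by (intro tendsto_intros lim)
    moreover have "inner (f n \<xi>) \<eta> = inner \<xi> (f n \<eta>)" for n by (rule self_adjoint_inner[OF F(1,2)])
    ultimately have "(\<lambda>n. inner (f n \<xi>) \<eta>) \<longlonglongrightarrow> inner \<xi> (l \<eta>)" by simp
    then show "inner (l \<xi>) \<eta> = inner \<xi> (l \<eta>)"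
      using LIMSEQ_unique \<open>(\<lambda>n. inner (f n \<xi>) \<eta>) \<longlonglongrightarrow> inner (l \<xi>) \<eta>\<close> by metis
  qed
  moreover have "l o\<^sub>L t = t o\<^sub>L l" if t: "t \<in> bounded_operators" "a o\<^sub>L t = t o\<^sub>L a" for t
  proof (rule LIMSEQ_unique)
    show "(\<lambda>n. f n o\<^sub>L t) \<longlonglongrightarrow> (l o\<^sub>L t)" by (intro tendsto_intros l)
    have "(\<lambda>n. t o\<^sub>L f n) \<longlonglongrightarrow> (t o\<^sub>L l)" by (intro tendsto_intros l)
    then show "(\<lambda>n. f n o\<^sub>L t) \<longlonglongrightarrow> (t o\<^sub>L l)" by (simp add: F(3)[OF t])
  qed
  ultimately show "l \<in> sa_bicommutant a" using lB by (simp add: sa_bicommutant_def)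
qed

lemma (in von_neumann) sa_bicommutant_subset:
  assumes a: "a \<in> N"
  shows "sa_bicommutant a \<subseteq> N"
proof
  fix x assume x: "x \<in> sa_bicommutant a"
  show "x \<in> N"
  proof (rule memI)
    show "x \<in> bounded_operators" using x by (rule sa_bicommutantD)
    fix t assume t: "t \<in> commutant N"
    then have "t \<in> bounded_operators" "a o\<^sub>L t = t o\<^sub>L a" using a by (auto simp: commutant_def)
    then show "x o\<^sub>L t = t o\<^sub>L x" by (rule sa_bicommutantD(3)[OF x])
  qed
qed

lemma inner_le_norm: "inner (T \<xi>) \<xi> \<le> norm T * (norm \<xi>)\<^sup>2" for T :: "'h::real_inner \<Rightarrow>\<^sub>L 'h"
proof -
  have "inner (T \<xi>) \<xi> \<le> norm (T \<xi>) * norm \<xi>" by (rule norm_cauchy_schwarz)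
  also have "\<dots> \<le> (norm T * norm \<xi>) * norm \<xi>" by (intro mult_right_mono norm_blinfun) simp
  finally show ?thesis by (simp add: power2_eq_square mult.assoc)
qed

text \<open>
  The shift by \<open>\<delta>\<close> makes \<open>a\<close> invertible, so that after rescaling \<open>a + \<delta>\<close> has the form \<open>1 - b\<close> with
  \<open>\<parallel>b\<parallel> < 1\<close>. This is enough functional calculus here: statements about \<open>a\<close> itself follow by \<open>\<delta> \<rightarrow> 0\<close>.
\<close>

lemma positive_sqrt:
  fixes a :: "'h::complex_hilbert_space operator"
  assumes a: "positive_operator a" and \<delta>: "0 < \<delta>"
  obtains s w where "s \<in> sa_bicommutant a" "w \<in> sa_bicommutant a" "positive_operator s"
    "s o\<^sub>L s = a + \<delta> *\<^sub>R id_blinfun" "s o\<^sub>L w = id_blinfun"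
proof -
  \<comment> \<open>After division by \<open>K\<close> the operator \<open>a + \<delta>\<close> lies between \<open>\<delta> / K\<close> and \<open>1\<close>.\<close>
  define K where "K = norm a + \<delta>"
  have K: "0 < K" using \<delta> by (simp add: K_def add_nonneg_pos)
  have a': "a \<in> bounded_operators" "a\<^sup>\<star> = a" "\<And>\<xi>. 0 \<le> inner (a \<xi>) \<xi>"
    using a by (auto simp: positive_operator_iff)
  let ?A = "sa_bicommutant a"
  note sub = sa_bicommutant_subspace[of a]
  note A = sub sa_bicommutant_closed[of a] sa_bicommutant_compose[OF a'(1)]
  define b where "b = id_blinfun - (1/K) *\<^sub>R (a + \<delta> *\<^sub>R id_blinfun)"
  have bA: "b \<in> ?A"
    unfolding b_def using a'
    by (intro subspace_diff[OF sub] subspace_scale[OF sub] subspace_add[OF sub]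
        sa_bicommutant_id sa_bicommutant_self)
  have b_form: "inner (b \<xi>) \<xi> = (1 - \<delta> / K) * (norm \<xi>)\<^sup>2 - inner (a \<xi>) \<xi> / K" for \<xi>
    using K by (simp add: b_def blinfun.diff_left blinfun.scaleR_left blinfun.add_left inner_diff_left
        inner_add_left power2_norm_eq_inner[symmetric] field_simps)
  have "positive_operator b"
    unfolding positive_operator_iff
  proof (intro conjI allI)
    fix \<xi>
    have "inner (a \<xi>) \<xi> / K \<le> norm a * (norm \<xi>)\<^sup>2 / K"
      using K inner_le_norm by (intro divide_right_mono) auto
    also have "\<dots> = (1 - \<delta> / K) * (norm \<xi>)\<^sup>2" using K by (simp add: K_def field_simps)
    finally show "0 \<le> inner (b \<xi>) \<xi>" by (simp add: b_form)
  qed (use sa_bicommutantD[OF bA] in auto)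
  then have "norm b \<le> 1 - \<delta> / K"
  proof (rule norm_le_of_positive)
    show "inner (b \<xi>) \<xi> \<le> (1 - \<delta> / K) * (norm \<xi>)\<^sup>2" for \<xi>
      using a'(3)[of \<xi>] K by (simp add: b_form)
    show "0 \<le> 1 - \<delta> / K" using K by (simp add: K_def)
  qed
  also have "\<dots> < 1" using K \<delta> by simp
  finally have b1: "norm b < 1" .
  obtain y where y: "y \<in> ?A" "norm y \<le> norm b"
    "(id_blinfun - y) o\<^sub>L (id_blinfun - y) = id_blinfun - b"
    by (rule sqrt_of_contraction[OF A bA b1])
  have y1: "norm y < 1" using y(2) b1 by simp
  obtain w where w: "w \<in> ?A" "(id_blinfun - y) o\<^sub>L w = id_blinfun"
    by (rule inverse_of_contraction[OF A sa_bicommutant_id y(1) y1])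
  let ?s = "sqrt K *\<^sub>R (id_blinfun - y)"
  show ?thesis
  proof (rule that)
    show s: "?s \<in> ?A" using y(1) by (intro subspace_scale[OF sub] subspace_diff[OF sub] sa_bicommutant_id)
    show "(1 / sqrt K) *\<^sub>R w \<in> ?A" using w(1) by (rule subspace_scale[OF sub])
    show "?s o\<^sub>L (1 / sqrt K) *\<^sub>R w = id_blinfun"
      using K by (simp add: bounded_bilinear.scaleR_left[OF bounded_bilinear_blinfun_compose]
          bounded_bilinear.scaleR_right[OF bounded_bilinear_blinfun_compose] w(2))
    have "?s o\<^sub>L ?s = K *\<^sub>R ((id_blinfun - y) o\<^sub>L (id_blinfun - y))"
      using K by (simp add: bounded_bilinear.scaleR_left[OF bounded_bilinear_blinfun_compose]
          bounded_bilinear.scaleR_right[OF bounded_bilinear_blinfun_compose])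
    then show "?s o\<^sub>L ?s = a + \<delta> *\<^sub>R id_blinfun" using K by (simp add: y(3) b_def)
    have "0 \<le> inner (?s \<xi>) \<xi>" for \<xi>
    proof -
      have "inner (y \<xi>) \<xi> \<le> norm y * (norm \<xi>)\<^sup>2" by (rule inner_le_norm)
      also have "\<dots> \<le> 1 * (norm \<xi>)\<^sup>2" using y1 by (intro mult_right_mono) auto
      finally show ?thesis
        using K by (simp add: blinfun.scaleR_left blinfun.diff_left inner_diff_left power2_norm_eq_inner)
    qed
    then show "positive_operator ?s"
      using sa_bicommutantD[OF s] by (simp add: positive_operator_iff)
  qed
qed

lemma nonneg_of_perturbation:
  fixes x c :: real
  assumes "\<And>\<delta>. 0 < \<delta> \<Longrightarrow> 0 \<le> x + \<delta> * c"
  shows "0 \<le> x"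
proof -
  have "(\<lambda>n. x + inverse (real (Suc n)) * c) \<longlonglongrightarrow> x + 0 * c"
    by (intro tendsto_intros LIMSEQ_inverse_real_of_nat)
  then have "0 \<le> x + 0 * c"
    by (rule LIMSEQ_le_const) (use assms in \<open>auto simp del: of_nat_Suc\<close>)
  then show ?thesis by simp
qed

text \<open>
  If \<open>s\<^sup>2 = a + \<delta>\<close> with \<open>s\<close> commuting with \<open>b\<close>, then \<open>(a + \<delta>) b = s b s\<close> is positive.
\<close>

lemma positive_compose:
  assumes a: "positive_operator a" and b: "positive_operator b" and ab: "a o\<^sub>L b = b o\<^sub>L a"
  shows "positive_operator (a o\<^sub>L b)"
  unfolding positive_operator_iff
proof (intro conjI allI)
  have a': "a \<in> bounded_operators" "a\<^sup>\<star> = a" and b': "b \<in> bounded_operators" "b\<^sup>\<star> = b" "\<And>\<xi>. 0 \<le> inner (b \<xi>) \<xi>"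
    using a b by (auto simp: positive_operator_iff)
  show "a o\<^sub>L b \<in> bounded_operators" by (rule bounded_operators_closed(3)[OF a'(1) b'(1)])
  show "(a o\<^sub>L b)\<^sup>\<star> = a o\<^sub>L b" by (metis adjoint_simps(3)[OF a'(1) b'(1)] a'(2) b'(2) ab)
  fix \<xi>
  show "0 \<le> inner ((a o\<^sub>L b) \<xi>) \<xi>"
  proof (rule nonneg_of_perturbation[where c = "inner (b \<xi>) \<xi>"])
    fix \<delta> :: real assume \<delta>: "0 < \<delta>"
    obtain s w where s: "s \<in> sa_bicommutant a" "s o\<^sub>L s = a + \<delta> *\<^sub>R id_blinfun"
      using positive_sqrt[OF a \<delta>] by metis
    have sb: "s (b v) = b (s v)" for v
      using sa_bicommutantD(3)[OF s(1) b'(1) ab] by (metis blinfun_apply_blinfun_compose)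
    have ss: "s (s v) = a v + \<delta> *\<^sub>R v" for v
      using arg_cong[OF s(2), of "\<lambda>T. blinfun_apply T v"] by (simp add: blinfun.add_left blinfun.scaleR_left)
    have "0 \<le> inner (b (s \<xi>)) (s \<xi>)" by (rule b'(3))
    also have "inner (b (s \<xi>)) (s \<xi>) = inner (s (b \<xi>)) (s \<xi>)" by (simp only: sb)
    also have "\<dots> = inner (s (s (b \<xi>))) \<xi>"
      using self_adjoint_inner[OF sa_bicommutantD(1,2)[OF s(1)], of "s (b \<xi>)" \<xi>] by simp
    also have "\<dots> = inner ((a o\<^sub>L b) \<xi>) \<xi> + \<delta> * inner (b \<xi>) \<xi>" by (simp add: ss inner_add_left)
    finally show "0 \<le> inner ((a o\<^sub>L b) \<xi>) \<xi> + \<delta> * inner (b \<xi>) \<xi>" .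
  qed
qed

text \<open>
  With \<open>s = \<surd>(d\<^sup>2 + \<delta>\<^sup>2)\<close>, a smoothed modulus of \<open>d\<close>, the operator \<open>p = (s + d) / 2\<close> is a smoothed positive
  part of \<open>d\<close>, and \<open>z = (1 + d s\<^sup>-\<^sup>1) / 2\<close> a smoothed spectral projection of \<open>d\<close> for \<open>(0, \<infinity>)\<close>. They
  satisfy \<open>d z = p\<close> up to the error \<open>(\<delta> / 2) v\<close>, where \<open>v = \<delta> s\<^sup>-\<^sup>1 \<le> 1\<close>.
\<close>

lemma approximate_positive_part:
  fixes d :: "'h::complex_hilbert_space operator"
  assumes d: "d \<in> bounded_operators" "d\<^sup>\<star> = d" and \<delta>: "0 < \<delta>"
  obtains z p v where "z \<in> sa_bicommutant d" "p \<in> sa_bicommutant d" "v \<in> sa_bicommutant d"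
    "positive_operator z" "positive_operator (id_blinfun - z)"
    "positive_operator p" "positive_operator (p - d)" "positive_operator (id_blinfun - v)"
    "d o\<^sub>L z = p - (\<delta> / 2) *\<^sub>R v"
proof -
  let ?A = "sa_bicommutant d"
  have dd: "positive_operator (d o\<^sub>L d)" using adjoint_comp_positive[OF d(1)] by (simp only: d(2))
  obtain s w where sw: "s \<in> sa_bicommutant (d o\<^sub>L d)" "w \<in> sa_bicommutant (d o\<^sub>L d)" "positive_operator s"
    "s o\<^sub>L s = (d o\<^sub>L d) + \<delta>\<^sup>2 *\<^sub>R id_blinfun" "s o\<^sub>L w = id_blinfun"
    using positive_sqrt[OF dd, of "\<delta>\<^sup>2"] \<delta> by (metis zero_less_power)
  have mono: "x \<in> ?A" if x: "x \<in> sa_bicommutant (d o\<^sub>L d)" for x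
  proof -
    have "x o\<^sub>L t = t o\<^sub>L x" if t: "t \<in> bounded_operators" "d o\<^sub>L t = t o\<^sub>L d" for t
      by (rule sa_bicommutantD(3)[OF x t(1)]) (metis t(2) blinfun_compose_assoc)
    then show ?thesis using sa_bicommutantD(1,2)[OF x] by (simp add: sa_bicommutant_def)
  qed
  note sub = sa_bicommutant_subspace[of d]
  have dA: "d \<in> ?A" using d by (rule sa_bicommutant_self)
  have sA: "s \<in> ?A" and wA: "w \<in> ?A" using sw mono by auto
  have comm: "x (y \<xi>) = y (x \<xi>)" if "x \<in> ?A" "y \<in> ?A" for x y \<xi>
    using sa_bicommutant_commute[OF d(1) that] by (metis blinfun_apply_blinfun_compose)
  have ss: "s (s \<xi>) = d (d \<xi>) + \<delta>\<^sup>2 *\<^sub>R \<xi>" for \<xi>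
    using arg_cong[OF sw(4), of "\<lambda>T. blinfun_apply T \<xi>"] by (simp add: blinfun.add_left blinfun.scaleR_left)
  have sw1: "s (w \<xi>) = \<xi>" for \<xi>
    using arg_cong[OF sw(5), of "\<lambda>T. blinfun_apply T \<xi>"] by simp
  have ddw: "d (d (w \<xi>)) = s \<xi> - \<delta>\<^sup>2 *\<^sub>R w \<xi>" for \<xi>
    using ss[of "w \<xi>"] by (simp add: sw1)
  \<comment> \<open>Here \<open>w = s\<^sup>-\<^sup>1\<close>, and \<open>u\<close> is a smoothed sign of \<open>d\<close>. Since \<open>u\<^sup>2 + v\<^sup>2 = 1\<close>, both are contractions.\<close>
  define u where "u = d o\<^sub>L w"
  define v where "v = \<delta> *\<^sub>R w"
  have uA: "u \<in> ?A" unfolding u_def by (rule sa_bicommutant_compose[OF d(1) dA wA])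
  have vA: "v \<in> ?A" unfolding v_def using wA by (rule subspace_scale[OF sub])
  have uv: "(norm (u \<xi>))\<^sup>2 + (norm (v \<xi>))\<^sup>2 = (norm \<xi>)\<^sup>2" for \<xi>
  proof -
    have "u (u \<xi>) = d (d (w (w \<xi>)))" by (simp add: u_def comm[OF wA dA])
    also have "\<dots> = \<xi> - \<delta>\<^sup>2 *\<^sub>R w (w \<xi>)" by (simp add: ddw sw1)
    finally have "u (u \<xi>) + v (v \<xi>) = \<xi>"
      by (simp add: v_def blinfun.scaleR_left blinfun.scaleR_right power2_eq_square)
    then have "inner (u (u \<xi>)) \<xi> + inner (v (v \<xi>)) \<xi> = inner \<xi> \<xi>" by (metis inner_add_left)
    then show ?thesis
      using self_adjoint_inner[OF sa_bicommutantD(1,2)[OF uA], of "u \<xi>" \<xi>]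
        self_adjoint_inner[OF sa_bicommutantD(1,2)[OF vA], of "v \<xi>" \<xi>]
      by (simp add: power2_norm_eq_inner)
  qed
  have contr: "\<bar>inner (x \<xi>) \<xi>\<bar> \<le> inner \<xi> \<xi>" if "(norm (x \<xi>))\<^sup>2 \<le> (norm \<xi>)\<^sup>2" for x :: "'h operator" and \<xi>
  proof -
    have "\<bar>inner (x \<xi>) \<xi>\<bar> \<le> norm (x \<xi>) * norm \<xi>" by (rule Cauchy_Schwarz_ineq2)
    also have "\<dots> \<le> norm \<xi> * norm \<xi>" using that by (intro mult_right_mono) (auto simp: power2_le_iff_abs_le)
    finally show ?thesis by (simp add: power2_norm_eq_inner[symmetric] power2_eq_square)
  qed
  have ub: "\<bar>inner (u \<xi>) \<xi>\<bar> \<le> inner \<xi> \<xi>" and vb: "\<bar>inner (v \<xi>) \<xi>\<bar> \<le> inner \<xi> \<xi>" for \<xi>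
    using contr[of u \<xi>] contr[of v \<xi>] uv[of \<xi>] zero_le_power2[of "norm (u \<xi>)"] zero_le_power2[of "norm (v \<xi>)"]
    by linarith+
  have posI: "positive_operator x" if "x \<in> ?A" "\<And>\<xi>. 0 \<le> inner (x \<xi>) \<xi>" for x
    using that sa_bicommutantD[OF that(1)] by (simp add: positive_operator_iff)
  have iA: "id_blinfun \<in> ?A" by (rule sa_bicommutant_id)
  have up: "positive_operator (id_blinfun + u)" "positive_operator (id_blinfun - u)"
    "positive_operator (id_blinfun - v)"
    using ub vb
    by (auto intro!: posI subspace_add[OF sub] subspace_diff[OF sub] iA uA vA
        simp: blinfun.add_left blinfun.diff_left inner_add_left inner_diff_left abs_le_iff)
      (metis add.commute neg_le_iff_le add.inverse_inverse diff_ge_0_iff_ge diff_minus_eq_add)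
  have half: "positive_operator ((1/2) *\<^sub>R x)" if "positive_operator x" "x \<in> ?A" for x
    using that by (intro posI subspace_scale[OF sub]) (auto simp: blinfun.scaleR_left positive_operator_iff)
  have ud: "d (u \<xi>) = s \<xi> - \<delta>\<^sup>2 *\<^sub>R w \<xi>" for \<xi> by (simp add: u_def ddw)
  have su: "s (u \<xi>) = d \<xi>" for \<xi> by (simp add: u_def comm[OF sA dA] sw1)
  have prod: "positive_operator (s o\<^sub>L x)" "s o\<^sub>L x \<in> ?A" if "positive_operator x" "x \<in> ?A" for x
    using that by (auto intro!: positive_compose sw(3) sa_bicommutant_commute[OF d(1)] sA sa_bicommutant_compose[OF d(1)])
  have pA: "id_blinfun + u \<in> ?A" "id_blinfun - u \<in> ?A"
    by (intro subspace_add[OF sub] subspace_diff[OF sub] iA uA)+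
  define z where "z = (1/2) *\<^sub>R (id_blinfun + u)"
  define p where "p = (1/2) *\<^sub>R (s o\<^sub>L (id_blinfun + u))"
  have half_sum: "\<xi> = (1/2) *\<^sub>R \<xi> + (1/2) *\<^sub>R \<xi>" for \<xi> :: 'h
    by (simp flip: scaleR_add_left)
  have z': "id_blinfun - z = (1/2) *\<^sub>R (id_blinfun - u)"
    by (rule blinfun_eqI) (simp add: z_def blinfun.diff_left blinfun.add_left blinfun.scaleR_left
        scaleR_right_distrib scaleR_right_diff_distrib algebra_simps half_sum[symmetric])
  have p': "p - d = (1/2) *\<^sub>R (s o\<^sub>L (id_blinfun - u))"
    by (rule blinfun_eqI) (simp add: p_def blinfun.diff_left blinfun.add_left blinfun.scaleR_left
        blinfun.add_right blinfun.diff_right su algebra_simps half_sum[symmetric])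
  show ?thesis
  proof (rule that)
    show "z \<in> ?A" unfolding z_def using pA(1) by (rule subspace_scale[OF sub])
    show "p \<in> ?A" unfolding p_def by (rule subspace_scale[OF sub prod(2)[OF up(1) pA(1)]])
    show "v \<in> ?A" by (rule vA)
    show "positive_operator z" unfolding z_def by (rule half[OF up(1) pA(1)])
    show "positive_operator (id_blinfun - z)" unfolding z' by (rule half[OF up(2) pA(2)])
    show "positive_operator p" unfolding p_def by (rule half[OF prod[OF up(1) pA(1)]])
    show "positive_operator (p - d)" unfolding p' by (rule half[OF prod[OF up(2) pA(2)]])
    show "positive_operator (id_blinfun - v)" by (rule up(3))
    show "d o\<^sub>L z = p - (\<delta> / 2) *\<^sub>R v"
      by (rule blinfun_eqI) (simp add: z_def p_def v_def blinfun.diff_left blinfun.add_left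
          blinfun.scaleR_left blinfun.add_right blinfun.scaleR_right su
          scaleR_right_distrib scaleR_right_diff_distrib power2_eq_square ud ddw)
  qed
qed

section \<open>Normal functionals are dominated by vectors\<close>

lemma cmod_cinner_le: "cmod (cinner x y) \<le> norm x * norm y"
proof -
  define z where "z = cinner x y"
  define c where "c = cnj (sgn z)"
  have "c * z = complex_of_real (cmod z)"
  proof (cases "z = 0")
    case False
    have "c * z = z * cnj z / complex_of_real (cmod z)" by (simp add: c_def sgn_eq)
    also have "\<dots> = complex_of_real (cmod z)"
      unfolding complex_norm_square[symmetric] using False by (simp add: power2_eq_square)
    finally show ?thesis .
  qed simp
  then have "cmod z = Re (cinner (c *\<^sub>C x) y)" by (simp add: cinner_scaleC_left z_def)
  also have "\<dots> \<le> norm (c *\<^sub>C x) * norm y" unfolding Re_cinner by (rule norm_cauchy_schwarz)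
  also have "\<dots> \<le> norm x * norm y"
    by (intro mult_right_mono) (auto simp: norm_scaleC c_def norm_sgn)
  finally show ?thesis by (simp add: z_def)
qed

lemma cinner_adjoint_comp:
  assumes x: "x \<in> bounded_operators"
  shows "cinner ((x\<^sup>\<star> o\<^sub>L x) \<xi>) \<eta> = cinner (x \<xi>) (x \<eta>)"
proof -
  have "\<forall>\<xi> \<eta>. cinner (x\<^sup>\<star> \<xi>) \<eta> = cinner \<xi> (x \<eta>)"
    using cinner_adjoint_iff[OF adjoint_bounded_operators[OF x]] inner_adjoint(2)[OF x] by blast
  then show ?thesis by simp
qed

lemma summable_sq_apply:
  fixes T :: "'h::real_normed_vector \<Rightarrow>\<^sub>L 'h"
  assumes "summable (\<lambda>k. (norm (\<zeta> k))\<^sup>2)"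
  shows "summable (\<lambda>k. (norm (T (\<zeta> k)))\<^sup>2)"
    "(\<Sum>k. (norm (T (\<zeta> k)))\<^sup>2) \<le> (norm T)\<^sup>2 * (\<Sum>k. (norm (\<zeta> k))\<^sup>2)"
proof -
  have le: "(norm (T (\<zeta> k)))\<^sup>2 \<le> (norm T)\<^sup>2 * (norm (\<zeta> k))\<^sup>2" for k
    using power_mono[OF norm_blinfun[of T "\<zeta> k"], of 2] by (simp add: power_mult_distrib)
  have s: "summable (\<lambda>k. (norm T)\<^sup>2 * (norm (\<zeta> k))\<^sup>2)" using assms by (rule summable_mult)
  show 1: "summable (\<lambda>k. (norm (T (\<zeta> k)))\<^sup>2)"
    by (rule summable_comparison_test'[OF s]) (use le in auto)
  show "(\<Sum>k. (norm (T (\<zeta> k)))\<^sup>2) \<le> (norm T)\<^sup>2 * (\<Sum>k. (norm (\<zeta> k))\<^sup>2)"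
    using suminf_le[OF le 1 s] suminf_mult[OF assms] by simp
qed

text \<open>
  The two sequences are interleaved, so that finitely many square-summable sequences can be treated as
  one.
\<close>

lemma merge_sequences:
  fixes \<xi> \<eta> :: "nat \<Rightarrow> 'h"
  obtains \<zeta> :: "nat \<Rightarrow> 'h" where
    "\<And>f :: 'h \<Rightarrow> real. summable (\<lambda>k. f (\<xi> k)) \<Longrightarrow> summable (\<lambda>k. f (\<eta> k)) \<Longrightarrow>
       (\<lambda>k. f (\<zeta> k)) sums ((\<Sum>k. f (\<xi> k)) + (\<Sum>k. f (\<eta> k)))"
proof (rule that)
  fix f :: "'h \<Rightarrow> real"
  let ?z = "\<lambda>n. if even n then \<eta> (n div 2) else \<xi> ((n - 1) div 2)"
  assume "summable (\<lambda>k. f (\<xi> k))" "summable (\<lambda>k. f (\<eta> k))"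
  then have "(\<lambda>n. if even n then f (\<eta> (n div 2)) else f (\<xi> ((n - 1) div 2)))
      sums ((\<Sum>k. f (\<xi> k)) + (\<Sum>k. f (\<eta> k)))"
    by (intro sums_if summable_sums)
  then show "(\<lambda>k. f (?z k)) sums ((\<Sum>k. f (\<xi> k)) + (\<Sum>k. f (\<eta> k)))"
    by (simp add: if_distrib cong: if_cong)
qed

text \<open>
  An ultraweak neighbourhood of \<open>0\<close> only restricts finitely many functionals \<open>T \<mapsto> \<Sum>k. \<langle>T \<xi>\<^sub>k, \<eta>\<^sub>k\<rangle>\<close>. At
  \<open>T = x\<^sup>\<star> x\<close> the terms are \<open>\<langle>x \<xi>\<^sub>k, x \<eta>\<^sub>k\<rangle>\<close>, which are controlled by \<open>\<parallel>x \<xi>\<^sub>k\<parallel>\<^sup>2 + \<parallel>x \<eta>\<^sub>k\<parallel>\<^sup>2\<close>.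
\<close>

lemma ultraweak_neighbourhood:
  fixes U :: "'h::complex_hilbert_space operator set"
  assumes "openin ultraweak_topology U" "0 \<in> U"
  shows "\<exists>\<zeta>. summable (\<lambda>k::nat. (norm (\<zeta> k))\<^sup>2) \<and>
    (\<forall>x\<in>bounded_operators. (\<Sum>k. (norm (blinfun_apply x (\<zeta> k)))\<^sup>2) < 1 \<longrightarrow> (x\<^sup>\<star> o\<^sub>L x) \<in> U)"
proof -
  let ?G = "{{T \<in> bounded_operators. (\<Sum>k. cinner (blinfun_apply T (\<xi> k)) (\<eta> k)) \<in> W} | \<xi> \<eta> W.
        summable (\<lambda>k::nat. (norm (\<xi> k :: 'h))\<^sup>2) \<and> summable (\<lambda>k. (norm (\<eta> k))\<^sup>2) \<and> open W}"
  have "generate_topology_on ?G U"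
    using assms(1) by (simp add: ultraweak_topology_def openin_topology_generated_by_iff)
  then show ?thesis using assms(2)
  proof (induction rule: generate_topology_on.induct)
    case (Int a b)
    obtain \<xi> where \<xi>: "summable (\<lambda>k. (norm (\<xi> k))\<^sup>2) \<and>
        (\<forall>x\<in>bounded_operators. (\<Sum>k. (norm (blinfun_apply x (\<xi> k)))\<^sup>2) < 1 \<longrightarrow> (x\<^sup>\<star> o\<^sub>L x) \<in> a)"
      using Int.IH(1)[OF IntD1[OF Int.prems]] ..
    obtain \<eta> where \<eta>: "summable (\<lambda>k. (norm (\<eta> k))\<^sup>2) \<and>
        (\<forall>x\<in>bounded_operators. (\<Sum>k. (norm (blinfun_apply x (\<eta> k)))\<^sup>2) < 1 \<longrightarrow> (x\<^sup>\<star> o\<^sub>L x) \<in> b)"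
      using Int.IH(2)[OF IntD2[OF Int.prems]] ..
    note \<xi> = \<xi>[THEN conjunct1] \<xi>[THEN conjunct2, rule_format]
    note \<eta> = \<eta>[THEN conjunct1] \<eta>[THEN conjunct2, rule_format]
    obtain \<zeta> where \<zeta>: "\<And>f :: 'h \<Rightarrow> real. summable (\<lambda>k. f (\<xi> k)) \<Longrightarrow> summable (\<lambda>k. f (\<eta> k)) \<Longrightarrow>
       (\<lambda>k. f (\<zeta> k)) sums ((\<Sum>k. f (\<xi> k)) + (\<Sum>k. f (\<eta> k)))"
      using merge_sequences[of \<xi> \<eta>] by metis
    show ?case
    proof (intro exI[of _ \<zeta>] conjI ballI impI)
      show "summable (\<lambda>k. (norm (\<zeta> k))\<^sup>2)" using \<zeta>[of "\<lambda>v. (norm v)\<^sup>2"] \<xi> \<eta> by (auto dest: sums_summable)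
      fix x :: "'h operator" assume x: "x \<in> bounded_operators" "(\<Sum>k. (norm (x (\<zeta> k)))\<^sup>2) < 1"
      have "(\<lambda>k. (norm (x (\<zeta> k)))\<^sup>2) sums ((\<Sum>k. (norm (x (\<xi> k)))\<^sup>2) + (\<Sum>k. (norm (x (\<eta> k)))\<^sup>2))"
        by (rule \<zeta>[of "\<lambda>v. (norm (x v))\<^sup>2"]) (intro summable_sq_apply \<xi> \<eta>)+
      then have "(\<Sum>k. (norm (x (\<xi> k)))\<^sup>2) + (\<Sum>k. (norm (x (\<eta> k)))\<^sup>2) < 1"
        using x(2) by (simp add: sums_iff)
      moreover have "0 \<le> (\<Sum>k. (norm (x (\<xi> k)))\<^sup>2)" "0 \<le> (\<Sum>k. (norm (x (\<eta> k)))\<^sup>2)"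
        by (intro suminf_nonneg summable_sq_apply \<xi> \<eta>; simp)+
      ultimately show "(x\<^sup>\<star> o\<^sub>L x) \<in> a \<inter> b" using \<xi>(2)[OF x(1)] \<eta>(2)[OF x(1)] by auto
    qed
  next
    case (UN K)
    then obtain k where k: "k \<in> K" "0 \<in> k" by blast
    show ?case using UN(2)[OF k] k(1) by blast
  next
    case (Basis s)
    then obtain \<xi> \<eta> W where s: "s = {T \<in> bounded_operators. (\<Sum>k. cinner (blinfun_apply T (\<xi> k)) (\<eta> k)) \<in> W}"
      and \<xi>: "summable (\<lambda>k::nat. (norm (\<xi> k :: 'h))\<^sup>2)" and \<eta>: "summable (\<lambda>k. (norm (\<eta> k))\<^sup>2)" and W: "open W"
      by blast
    have c0: "cinner 0 y = 0" for y :: 'h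
      using cinner_add_left[of 0 0 y] by simp
    have "0 \<in> W" using Basis(2) by (simp add: s c0)
    then obtain e where e: "0 < e" "\<And>z. cmod z < e \<Longrightarrow> z \<in> W"
      using W by (auto simp: open_dist dist_norm)
    \<comment> \<open>The factor turns the bound \<open>< 1\<close> on the merged sum into \<open>< 2 * e\<close> on the unscaled sums.\<close>
    define c where "c = 1 / sqrt (2 * e)"
    have c: "c\<^sup>2 = 1 / (2 * e)" using e(1) by (simp add: c_def power_divide)
    obtain \<zeta> where \<zeta>: "\<And>f :: 'h \<Rightarrow> real. summable (\<lambda>k. f (c *\<^sub>R \<xi> k)) \<Longrightarrow> summable (\<lambda>k. f (c *\<^sub>R \<eta> k)) \<Longrightarrow>
       (\<lambda>k. f (\<zeta> k)) sums ((\<Sum>k. f (c *\<^sub>R \<xi> k)) + (\<Sum>k. f (c *\<^sub>R \<eta> k)))"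
      using merge_sequences[of "\<lambda>k. c *\<^sub>R \<xi> k" "\<lambda>k. c *\<^sub>R \<eta> k"] by metis
    have c\<xi>: "summable (\<lambda>k. (norm (c *\<^sub>R \<xi> k))\<^sup>2)" "summable (\<lambda>k. (norm (c *\<^sub>R \<eta> k))\<^sup>2)"
      using \<xi> \<eta> by (auto simp: power_mult_distrib intro: summable_mult)
    show ?case
    proof (intro exI[of _ \<zeta>] conjI ballI impI)
      show "summable (\<lambda>k. (norm (\<zeta> k))\<^sup>2)" using \<zeta>[of "\<lambda>v. (norm v)\<^sup>2"] c\<xi> by (auto dest: sums_summable)
      fix x :: "'h operator" assume x: "x \<in> bounded_operators" "(\<Sum>k. (norm (x (\<zeta> k)))\<^sup>2) < 1"
      note sx = summable_sq_apply(1)[OF \<xi>, of x] summable_sq_apply(1)[OF \<eta>, of x]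
      have "(\<lambda>k. (norm (x (\<zeta> k)))\<^sup>2) sums
          ((\<Sum>k. (norm (x (c *\<^sub>R \<xi> k)))\<^sup>2) + (\<Sum>k. (norm (x (c *\<^sub>R \<eta> k)))\<^sup>2))"
        by (rule \<zeta>[of "\<lambda>v. (norm (x v))\<^sup>2"]) (intro summable_sq_apply c\<xi>)+
      then have "(\<Sum>k. (norm (x (c *\<^sub>R \<xi> k)))\<^sup>2) + (\<Sum>k. (norm (x (c *\<^sub>R \<eta> k)))\<^sup>2) < 1"
        using x(2) by (simp add: sums_iff)
      moreover have "(\<Sum>k. (norm (x (c *\<^sub>R \<xi> k)))\<^sup>2) = c\<^sup>2 * (\<Sum>k. (norm (x (\<xi> k)))\<^sup>2)"
        "(\<Sum>k. (norm (x (c *\<^sub>R \<eta> k)))\<^sup>2) = c\<^sup>2 * (\<Sum>k. (norm (x (\<eta> k)))\<^sup>2)"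
        using sx by (simp_all add: blinfun.scaleR_right power_mult_distrib suminf_mult)
      ultimately have lt: "(\<Sum>k. (norm (x (\<xi> k)))\<^sup>2) + (\<Sum>k. (norm (x (\<eta> k)))\<^sup>2) < 2 * e"
        using e(1) by (simp add: c field_simps)
      have term_le: "norm (cinner ((x\<^sup>\<star> o\<^sub>L x) (\<xi> k)) (\<eta> k)) \<le> ((norm (x (\<xi> k)))\<^sup>2 + (norm (x (\<eta> k)))\<^sup>2) / 2" for k
      proof -
        have "norm (cinner ((x\<^sup>\<star> o\<^sub>L x) (\<xi> k)) (\<eta> k)) \<le> norm (x (\<xi> k)) * norm (x (\<eta> k))"
          unfolding cinner_adjoint_comp[OF x(1)] by (rule cmod_cinner_le)
        also have "\<dots> \<le> ((norm (x (\<xi> k)))\<^sup>2 + (norm (x (\<eta> k)))\<^sup>2) / 2"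
          using sum_squares_bound[of "norm (x (\<xi> k))" "norm (x (\<eta> k))"] by simp
        finally show ?thesis .
      qed
      have "norm (\<Sum>k. cinner ((x\<^sup>\<star> o\<^sub>L x) (\<xi> k)) (\<eta> k))
          \<le> (\<Sum>k. ((norm (x (\<xi> k)))\<^sup>2 + (norm (x (\<eta> k)))\<^sup>2) / 2)"
        using sx by (intro norm_suminf_le[OF term_le] summable_divide summable_add)
      also have "\<dots> = ((\<Sum>k. (norm (x (\<xi> k)))\<^sup>2) + (\<Sum>k. (norm (x (\<eta> k)))\<^sup>2)) / 2"
        using sx by (simp add: suminf_divide suminf_add summable_add)
      also have "\<dots> < e" using lt by simp
      finally show "(x\<^sup>\<star> o\<^sub>L x) \<in> s"
        unfolding s using x(1) adjoint_bounded_operators[OF x(1)]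
        by (auto intro!: e(2) bounded_operators_closed(3))
    qed
  qed auto
qed

section \<open>Tracial von Neumann algebras\<close>

locale tracial = von_neumann M for M :: "'h::complex_hilbert_space operator set" +
  fixes \<tau> :: "'h operator \<Rightarrow> complex"
  assumes state: "faithful_normal_tracial_state M \<tau>"
begin

lemma tau_add: "x \<in> M \<Longrightarrow> y \<in> M \<Longrightarrow> \<tau> (x + y) = \<tau> x + \<tau> y"
  and tau_scaleC: "x \<in> M \<Longrightarrow> \<tau> (op_scaleC c x) = c * \<tau> x"
  and tau_id: "\<tau> id_blinfun = 1"
  and tau_comm: "x \<in> M \<Longrightarrow> y \<in> M \<Longrightarrow> \<tau> (x o\<^sub>L y) = \<tau> (y o\<^sub>L x)"
  using state
  by (auto simp: faithful_normal_tracial_state_def normal_functional_def linear_functional_on_def)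

lemma tau_positive: "x \<in> M \<Longrightarrow> positive_operator x \<Longrightarrow> \<tau> x \<in> \<real>\<^sub>\<ge>\<^sub>0"
  and tau_faithful: "x \<in> M \<Longrightarrow> positive_operator x \<Longrightarrow> \<tau> x = 0 \<Longrightarrow> x = 0"
  using state by (auto simp: faithful_normal_tracial_state_def positive_cone_def)

lemma op_scaleC_of_real: "op_scaleC (complex_of_real r) x = r *\<^sub>R x"
  by (rule blinfun_eqI) (simp add: scaleC_of_real blinfun.scaleR_left)

lemma tau_scaleR: "x \<in> M \<Longrightarrow> \<tau> (r *\<^sub>R x) = complex_of_real r * \<tau> x"
  using tau_scaleC[of x "complex_of_real r"] by (simp add: op_scaleC_of_real)

lemma tau_diff: "x \<in> M \<Longrightarrow> y \<in> M \<Longrightarrow> \<tau> (x - y) = \<tau> x - \<tau> y"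
  using tau_add[of x "(-1) *\<^sub>R y"] tau_scaleR[of y "-1"] closed(4)[of y "-1"] by simp

lemma Re_tau_positive: "x \<in> M \<Longrightarrow> positive_operator x \<Longrightarrow> 0 \<le> Re (\<tau> x)"
  using tau_positive by (simp add: complex_nonneg_Reals_iff)

lemma tau_self_adjoint_real:
  assumes x: "x \<in> M" "x\<^sup>\<star> = x"
  shows "Im (\<tau> x) = 0"
proof -
  let ?y = "x + norm x *\<^sub>R id_blinfun"
  have yM: "?y \<in> M" using x by (intro closed)
  have "positive_operator ?y"
    unfolding positive_operator_iff
  proof (intro conjI allI)
    show "?y \<in> bounded_operators" using yM by (rule bounded)
    show "?y\<^sup>\<star> = ?y"
      using x by (simp add: adjoint_simps(1)[OF bounded bounded] adjoint_simps(4)[OF bounded[OF closed(6)] bounded[OF closed(6)]] closed bounded)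
    fix \<xi>
    have "- inner (x \<xi>) \<xi> \<le> norm (x \<xi>) * norm \<xi>" using Cauchy_Schwarz_ineq2[of "x \<xi>" \<xi>] by simp
    also have "\<dots> \<le> (norm x * norm \<xi>) * norm \<xi>" by (intro mult_right_mono norm_blinfun) simp
    finally show "0 \<le> inner (?y \<xi>) \<xi>"
      by (simp add: blinfun.add_left blinfun.scaleR_left inner_add_left power2_norm_eq_inner[symmetric] power2_eq_square mult.assoc)
  qed
  then have "Im (\<tau> ?y) = 0" using tau_positive[OF yM] by (simp add: complex_nonneg_Reals_iff)
  moreover have "\<tau> ?y = \<tau> x + complex_of_real (norm x)"
    using x by (simp add: tau_add closed tau_scaleR tau_id)
  ultimately show ?thesis by simp
qed

lemma Re_tau_adjoint:
  assumes x: "x \<in> M"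
  shows "Re (\<tau> (x\<^sup>\<star>)) = Re (\<tau> x)"
proof -
  let ?b = "op_scaleC (- \<i>) (x - x\<^sup>\<star>)"
  have d: "x - x\<^sup>\<star> \<in> M" "x\<^sup>\<star> \<in> M" by (intro closed adjoint x)+
  have bM: "?b \<in> M" by (rule closed(5)[OF d(1)])
  have "?b\<^sup>\<star> = op_scaleC \<i> (x\<^sup>\<star> - x)"
    using adjoint_simps(6)[OF bounded[OF d(1)] bounded[OF d(1)], of "- \<i>"]
      adjoint_simps(2)[OF bounded[OF x] bounded[OF d(2)]] adjoint_simps(5)[OF bounded[OF x] bounded[OF x]] by simp
  also have "\<dots> = ?b"
  proof (rule blinfun_eqI)
    fix v
    have "\<i> *\<^sub>C w = (- \<i>) *\<^sub>C (- w)" for w :: 'h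
      using scaleC_scaleC[of "- \<i>" "-1" w] scaleC_of_real[of "-1" w] by simp
    then show "op_scaleC \<i> (x\<^sup>\<star> - x) v = ?b v" by (simp add: blinfun.diff_left)
  qed
  finally have "Im (\<tau> ?b) = 0" by (rule tau_self_adjoint_real[OF bM])
  moreover have "\<tau> ?b = - \<i> * (\<tau> x - \<tau> (x\<^sup>\<star>))"
    using tau_scaleC[OF d(1)] tau_diff[OF x d(2)] by simp
  ultimately show ?thesis by simp
qed

text \<open>
  The real part of the inner product of \<open>L\<^sup>2(M, \<tau>)\<close>, restricted to \<open>M\<close>.
\<close>

definition ip :: "'h operator \<Rightarrow> 'h operator \<Rightarrow> real" where
  "ip x y = Re (\<tau> (x\<^sup>\<star> o\<^sub>L y))"

lemma L2_norm_eq: "L2_norm \<tau> x = sqrt (ip x x)"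
  by (simp add: L2_norm_def ip_def)

sublocale L2: psd_form M ip
proof
  show "subspace M" by (rule subspace)
  fix x y assume x: "x \<in> M" and y: "y \<in> M"
  note xB = bounded[OF x] and yB = bounded[OF y] and xa = adjoint[OF x] and ya = adjoint[OF y]
  show "ip x y = ip y x"
  proof -
    have "(x\<^sup>\<star> o\<^sub>L y)\<^sup>\<star> = y\<^sup>\<star> o\<^sub>L x"
      using adjoint_simps(3)[OF bounded[OF xa] yB] adjoint_simps(5)[OF xB xB] by simp
    then show ?thesis using Re_tau_adjoint[OF closed(3)[OF xa y]] by (simp add: ip_def)
  qed
  show "ip (r *\<^sub>R x) y = r * ip x y" for r
    using x y xa by (simp add: ip_def adjoint_simps(4)[OF xB xB] blinfun_compose_distribs tau_scaleR closed)
  show "0 \<le> ip x x"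
    unfolding ip_def by (intro Re_tau_positive closed xa x adjoint_comp_positive xB)
  show "ip (x + y) z = ip x z + ip y z" if z: "z \<in> M" for z
    using z xa ya by (simp add: ip_def adjoint_simps(1)[OF xB yB] blinfun_compose_distribs tau_add closed)
qed

text \<open>
  Faithfulness of the trace makes the form definite.
\<close>

lemma ip_eq_0:
  assumes x: "x \<in> M" "ip x x \<le> 0"
  shows "x = 0"
proof -
  have p: "positive_operator (x\<^sup>\<star> o\<^sub>L x)" "(x\<^sup>\<star> o\<^sub>L x) \<in> M"
    using x by (auto intro: adjoint_comp_positive bounded closed adjoint)
  have "Re (\<tau> (x\<^sup>\<star> o\<^sub>L x)) = 0" "Im (\<tau> (x\<^sup>\<star> o\<^sub>L x)) = 0"
    using tau_positive[OF p(2,1)] x(2) by (auto simp: ip_def complex_nonneg_Reals_iff)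
  then have "x\<^sup>\<star> o\<^sub>L x = 0" using tau_faithful[OF p(2,1)] by (simp add: complex_eq_iff)
  then have "inner (x\<^sup>\<star> (x \<xi>)) \<xi> = 0" for \<xi>
    by (metis blinfun_apply_blinfun_compose inner_zero_left zero_blinfun.rep_eq)
  then have "x \<xi> = 0" for \<xi> using inner_adjoint(2)[OF bounded[OF x(1)], of "x \<xi>" \<xi>] by simp
  then show ?thesis by (intro blinfun_eqI) simp
qed

text \<open>
  By continuity at \<open>0\<close>, the normal trace satisfies \<open>\<parallel>x\<parallel>\<^sub>2\<^sup>2 \<le> \<Sum>k. \<parallel>x \<zeta>\<^sub>k\<parallel>\<^sup>2\<close> for some square-summable \<open>\<zeta>\<close>.
  This one-sided estimate is the only form in which normality enters.
\<close>

lemma dominating_vectors: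
  obtains \<zeta> :: "nat \<Rightarrow> 'h" where "summable (\<lambda>k. (norm (\<zeta> k))\<^sup>2)"
    "\<And>x. x \<in> M \<Longrightarrow> ip x x \<le> (\<Sum>k. (norm (x (\<zeta> k)))\<^sup>2)"
proof -
  have "continuous_map (subtopology ultraweak_topology M) euclidean \<tau>"
    using state by (simp add: faithful_normal_tracial_state_def normal_functional_def)
  then have "openin (subtopology ultraweak_topology M)
      {x \<in> topspace (subtopology ultraweak_topology M). \<tau> x \<in> ball 0 1}"
    by (rule openin_continuous_map_preimage) simp
  then obtain U where U: "openin ultraweak_topology U"
    "{x \<in> topspace (subtopology ultraweak_topology M). \<tau> x \<in> ball 0 1} = U \<inter> M"
    by (auto simp: openin_subtopology)
  have top: "topspace ultraweak_topology = (bounded_operators :: 'h operator set)"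
  proof
    have "{T \<in> bounded_operators. (\<Sum>k. cinner (blinfun_apply T ((\<lambda>_. 0) k)) ((\<lambda>_. 0) k)) \<in> UNIV}
        \<subseteq> topspace (ultraweak_topology :: 'h operator topology)"
      unfolding ultraweak_topology_def
      by (rule openin_subset, rule topology_generated_by_Basis) (auto intro!: exI[of _ "\<lambda>_. 0"] exI[of _ UNIV])
    then show "bounded_operators \<subseteq> topspace (ultraweak_topology :: 'h operator topology)" by simp
    show "topspace (ultraweak_topology :: 'h operator topology) \<subseteq> bounded_operators"
      unfolding ultraweak_topology_def by auto
  qed
  have "\<tau> 0 = 0" using tau_diff[of 0 0] closed(7) by simp
  then have "0 \<in> U \<inter> M"
    unfolding U(2)[symmetric] using closed(7) bounded[OF closed(7)] by (simp add: top)
  then have "0 \<in> U" by (rule IntD1)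
  then have "\<exists>\<zeta>. summable (\<lambda>k::nat. (norm (\<zeta> k))\<^sup>2) \<and>
        (\<forall>x\<in>bounded_operators. (\<Sum>k. (norm (blinfun_apply x (\<zeta> k)))\<^sup>2) < 1 \<longrightarrow> (x\<^sup>\<star> o\<^sub>L x) \<in> U)"
    by (rule ultraweak_neighbourhood[OF U(1)])
  then obtain \<zeta> where \<zeta>: "summable (\<lambda>k::nat. (norm (\<zeta> k))\<^sup>2) \<and>
        (\<forall>x\<in>bounded_operators. (\<Sum>k. (norm (blinfun_apply x (\<zeta> k)))\<^sup>2) < 1 \<longrightarrow> (x\<^sup>\<star> o\<^sub>L x) \<in> U)" ..
  note \<zeta> = \<zeta>[THEN conjunct1] \<zeta>[THEN conjunct2, rule_format]
  have small: "ip x x < 1" if x: "x \<in> M" "(\<Sum>k. (norm (x (\<zeta> k)))\<^sup>2) < 1" for x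
  proof -
    have "(x\<^sup>\<star> o\<^sub>L x) \<in> U \<inter> M" using \<zeta>(2)[OF bounded[OF x(1)] x(2)] closed(3)[OF adjoint[OF x(1)] x(1)] by blast
    then have "cmod (\<tau> (x\<^sup>\<star> o\<^sub>L x)) < 1" unfolding U(2)[symmetric] by simp
    then show ?thesis unfolding ip_def using complex_Re_le_cmod order_le_less_trans by blast
  qed
  have "ip x x \<le> (\<Sum>k. (norm (x (\<zeta> k)))\<^sup>2)" if x: "x \<in> M" for x
  proof (rule dense_ge)
    fix r assume r: "(\<Sum>k. (norm (x (\<zeta> k)))\<^sup>2) < r"
    have "0 \<le> (\<Sum>k. (norm (x (\<zeta> k)))\<^sup>2)" by (intro suminf_nonneg summable_sq_apply \<zeta>) simp
    then have r0: "0 < r" using r by simp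
    let ?c = "1 / sqrt r"
    have c: "?c\<^sup>2 = 1 / r" using r0 by (simp add: power_divide)
    have "(\<Sum>k. (norm ((?c *\<^sub>R x) (\<zeta> k)))\<^sup>2) = ?c\<^sup>2 * (\<Sum>k. (norm (x (\<zeta> k)))\<^sup>2)"
      using summable_sq_apply(1)[OF \<zeta>(1), of x]
      by (simp only: blinfun.scaleR_left norm_scaleR power_mult_distrib power2_abs suminf_mult)
    also have "\<dots> < 1" using r r0 by (simp add: c)
    finally have "ip (?c *\<^sub>R x) (?c *\<^sub>R x) < 1" using x by (intro small closed)
    moreover have "ip (?c *\<^sub>R x) (?c *\<^sub>R x) = ?c\<^sup>2 * ip x x"
      using x by (simp only: L2.scale_left L2.scale_right closed(4) power2_eq_square mult.assoc)
    ultimately show "ip x x \<le> r" using r0 by (simp add: c)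
  qed
  then show ?thesis using that \<zeta>(1) by blast
qed

end

section \<open>Bounded vectors and completeness\<close>

lemma summable_inner:
  fixes a b :: "nat \<Rightarrow> 'h::real_inner"
  assumes "summable (\<lambda>k. (norm (a k))\<^sup>2)" "summable (\<lambda>k. (norm (b k))\<^sup>2)"
  shows "summable (\<lambda>k. inner (a k) (b k))"
proof (rule summable_comparison_test')
  show "summable (\<lambda>k. (norm (a k))\<^sup>2 + (norm (b k))\<^sup>2)" using assms by (rule summable_add)
  show "norm (inner (a k) (b k)) \<le> (norm (a k))\<^sup>2 + (norm (b k))\<^sup>2" for k
  proof -
    have "\<bar>inner (a k) (b k)\<bar> \<le> norm (a k) * norm (b k)" by (rule Cauchy_Schwarz_ineq2)
    moreover have "2 * norm (a k) * norm (b k) \<le> (norm (a k))\<^sup>2 + (norm (b k))\<^sup>2"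
      by (rule sum_squares_bound)
    moreover have "0 \<le> norm (a k) * norm (b k)" by simp
    ultimately show ?thesis unfolding real_norm_def by linarith
  qed
qed

lemma quadratic_bound:
  fixes s a e :: real
  assumes "s\<^sup>2 \<le> a * s + e" "0 \<le> a" "0 \<le> e"
  shows "s \<le> a + sqrt e"
proof (rule ccontr)
  assume "\<not> s \<le> a + sqrt e"
  then have s: "a + sqrt e < s" by simp
  have "0 \<le> sqrt e" using assms(3) by simp
  then have "0 < s" using s assms(2) by linarith
  then have "(a + sqrt e) * s < s * s" using s by (intro mult_strict_right_mono)
  moreover have "sqrt e * sqrt e \<le> sqrt e * s" using s assms(2) \<open>0 \<le> sqrt e\<close> by (intro mult_left_mono) auto
  ultimately show False using assms by (simp add: power2_eq_square algebra_simps)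
qed

context tracial
begin

text \<open>
  These are the vectors \<open>v\<close> for which \<open>y \<mapsto> y v\<close> extends to a bounded operator on \<open>L\<^sup>2(M, \<tau>)\<close>. They
  transport convergence in \<open>L\<^sup>2\<close>-norm to convergence of vectors in the given Hilbert space.
\<close>

definition tau_bounded :: "'h \<Rightarrow> bool" where
  "tau_bounded v \<longleftrightarrow> (\<exists>C. \<forall>y\<in>M. norm (blinfun_apply y v) \<le> C * L2_norm \<tau> y)"

lemma tau_boundedE:
  assumes "tau_bounded v"
  obtains C where "0 \<le> C" "\<And>y. y \<in> M \<Longrightarrow> norm (blinfun_apply y v) \<le> C * L2_norm \<tau> y"
proof -
  obtain C where C: "\<And>y. y \<in> M \<Longrightarrow> norm (blinfun_apply y v) \<le> C * L2_norm \<tau> y"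
    using assms by (auto simp: tau_bounded_def)
  have "norm (blinfun_apply y v) \<le> \<bar>C\<bar> * L2_norm \<tau> y" if "y \<in> M" for y
  proof -
    have "C * L2_norm \<tau> y \<le> \<bar>C\<bar> * L2_norm \<tau> y"
      using L2.nonneg[OF that] by (intro mult_right_mono) (auto simp: L2_norm_eq)
    then show ?thesis using C[OF that] by simp
  qed
  then show ?thesis using that[of "\<bar>C\<bar>"] by simp
qed

text \<open>
  On the vectors \<open>\<zeta>\<close> dominating the trace, \<open>G x y = \<Sum>k. \<langle>x \<zeta>\<^sub>k, y \<zeta>\<^sub>k\<rangle>\<close> is a form for which \<open>\<tau>\<close> is bounded.
  Let \<open>x\<^sub>j\<close> be its Riesz sequence and \<open>\<theta>\<^sub>k = lim x\<^sub>j \<zeta>\<^sub>k\<close>, so that formally \<open>\<tau>(w) = \<Sum>k. \<langle>\<theta>\<^sub>k, w \<zeta>\<^sub>k\<rangle>\<close>. The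
  estimate \<open>\<parallel>w \<theta>\<parallel>\<^sup>2 = \<tau>(w\<^sup>\<star> w x) \<le> \<parallel>w\<parallel>\<^sub>2 \<parallel>w x\<parallel>\<^sub>2 \<le> \<parallel>w\<parallel>\<^sub>2 \<parallel>w \<theta>\<parallel>\<close>, carried out along the sequence, shows that each
  \<open>\<theta>\<^sub>k\<close> is bounded. If \<open>y\<close> kills all \<open>\<theta>\<^sub>k\<close>, then \<open>\<tau>(y\<^sup>\<star> y) = \<Sum>k. \<langle>y \<theta>\<^sub>k, y \<zeta>\<^sub>k\<rangle> = 0\<close>, so \<open>y = 0\<close>.
\<close>

lemma tau_bounded_separating:
  assumes y: "y \<in> M" and y0: "\<And>v. tau_bounded v \<Longrightarrow> y v = 0"
  shows "y = 0"
proof -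
  obtain \<zeta> :: "nat \<Rightarrow> 'h" where \<zeta>: "summable (\<lambda>k. (norm (\<zeta> k))\<^sup>2)"
    and dom: "\<And>x. x \<in> M \<Longrightarrow> ip x x \<le> (\<Sum>k. (norm (blinfun_apply x (\<zeta> k)))\<^sup>2)"
    by (rule dominating_vectors) blast
  define G where "G x y = (\<Sum>k. inner (blinfun_apply x (\<zeta> k)) (blinfun_apply y (\<zeta> k)))" for x y :: "'h operator"
  note sq = summable_sq_apply(1)[OF \<zeta>]
  have sm: "summable (\<lambda>k. inner (blinfun_apply x (\<zeta> k)) (blinfun_apply y (\<zeta> k)))" for x y :: "'h operator"
    by (intro summable_inner sq)
  have GG: "G x x = (\<Sum>k. (norm (x (\<zeta> k)))\<^sup>2)" for x
    by (simp add: G_def power2_norm_eq_inner)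
  interpret G: psd_form M G
  proof
    show "subspace M" by (rule subspace)
    fix x y z r
    show "G x y = G y x" by (simp add: G_def inner_commute)
    show "G (x + y) z = G x z + G y z"
      by (simp add: G_def blinfun.add_left inner_add_left suminf_add[OF sm sm])
    show "G (r *\<^sub>R x) y = r * G x y"
      by (simp add: G_def blinfun.scaleR_left suminf_mult[OF sm])
    show "0 \<le> G x x" unfolding GG by (intro suminf_nonneg sq) simp
  qed
  have term_le: "(norm (x (\<zeta> k)))\<^sup>2 \<le> G x x" for x :: "'h operator" and k
  proof -
    have "(\<Sum>k\<in>{k}. (norm (x (\<zeta> k)))\<^sup>2) \<le> (\<Sum>k. (norm (x (\<zeta> k)))\<^sup>2)"
      by (rule sum_le_suminf[OF sq]) auto
    then show ?thesis by (simp add: GG)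
  qed
  have G_comp: "G (x o\<^sub>L z) (x o\<^sub>L z) \<le> (norm x)\<^sup>2 * G z z" for x z :: "'h operator"
  proof -
    have "summable (\<lambda>k. (norm (z (\<zeta> k)))\<^sup>2)" by (rule sq)
    then show ?thesis
      using summable_sq_apply(2)[of "\<lambda>k. z (\<zeta> k)" x] unfolding GG by simp
  qed
  have G_adj: "G x (w\<^sup>\<star> o\<^sub>L z) = G (w o\<^sub>L x) z" if "w \<in> M" for w x z
    unfolding G_def by (simp add: inner_adjoint(1)[OF bounded[OF that]])
  define f where "f x = Re (\<tau> x)" for x
  have f_id: "f x = ip id_blinfun x" for x by (simp add: f_def ip_def)
  have f_bound: "\<bar>f x\<bar> \<le> 1 * sqrt (G x x)" if x: "x \<in> M" for x
  proof -
    have "\<bar>f x\<bar> \<le> sqrt (ip id_blinfun id_blinfun) * sqrt (ip x x)"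
      unfolding f_id by (rule L2.Cauchy_Schwarz_abs[OF closed(6) x])
    also have "ip id_blinfun id_blinfun = 1" by (simp add: ip_def tau_id)
    finally show ?thesis using dom[OF x] order_trans by (simp add: GG) fastforce
  qed
  obtain x R where x: "\<And>j. x j \<in> M"
    and xC: "\<And>i j. G (x i - x j) (x i - x j) \<le> 2 / (real i + 1) + 2 / (real j + 1)"
    and xR: "\<And>j. G (x j) (x j) \<le> R"
    and xf: "\<And>j w. w \<in> M \<Longrightarrow> \<bar>f w - G (x j) w\<bar> \<le> (1 + G w w) / (2 * sqrt (real j + 1))"
    by (rule G.Riesz_sequence[where f = f and K = 1])
      (use f_bound in \<open>auto simp: f_def tau_add tau_scaleR\<close>)
  have "Cauchy (\<lambda>j. x j (\<zeta> k))" for k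
  proof (rule Cauchy_of_inverse_bound[where c = 1])
    fix i j
    have "(norm (x i (\<zeta> k) - x j (\<zeta> k)))\<^sup>2 \<le> G (x i - x j) (x i - x j)"
      using term_le[of "x i - x j" k] by (simp add: blinfun.diff_left)
    then show "(norm (x i (\<zeta> k) - x j (\<zeta> k)))\<^sup>2 \<le> 1 * (2 / (real i + 1) + 2 / (real j + 1))"
      using xC[of i j] by simp
  qed
  then have "\<exists>l. (\<lambda>j. x j (\<zeta> k)) \<longlonglongrightarrow> l" for k
    using Cauchy_convergent_iff[of "\<lambda>j. x j (\<zeta> k)"] by (auto simp: convergent_def)
  then obtain \<theta> where \<theta>: "\<And>k. (\<lambda>j. x j (\<zeta> k)) \<longlonglongrightarrow> \<theta> k" by metis
  have bd: "norm (w (\<theta> k)) \<le> 1 * L2_norm \<tau> w" if w: "w \<in> M" for w k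
  proof -
    define c where "c = (norm (w\<^sup>\<star> o\<^sub>L w))\<^sup>2"
    define e where "e j = (1 + c * R) / (2 * sqrt (real j + 1))" for j :: nat
    have R0: "0 \<le> R" using order_trans[OF G.nonneg[OF x] xR] by blast
    have e0: "0 \<le> e j" for j using R0 by (simp add: e_def c_def)
    have wx: "w o\<^sub>L x j \<in> M" for j by (rule closed(3)[OF w x])
    have est: "norm (w (x j (\<zeta> k))) \<le> L2_norm \<tau> w + sqrt (e j)" for j
    proof -
      let ?v = "(w\<^sup>\<star> o\<^sub>L w) o\<^sub>L x j"
      have v: "?v = w\<^sup>\<star> o\<^sub>L (w o\<^sub>L x j)" by (rule blinfun_compose_assoc)
      have vM: "?v \<in> M" by (intro closed adjoint w x)
      have Gv: "G ?v ?v \<le> c * R"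
        using order_trans[OF G_comp mult_left_mono[OF xR]] by (simp add: c_def)
      have "G (x j) ?v = G (w o\<^sub>L x j) (w o\<^sub>L x j)" unfolding v by (rule G_adj[OF w])
      moreover have "f ?v \<le> L2_norm \<tau> w * sqrt (G (w o\<^sub>L x j) (w o\<^sub>L x j))"
      proof -
        have "f ?v = ip w (w o\<^sub>L x j)" by (simp add: f_def ip_def v)
        also have "\<dots> \<le> sqrt (ip w w) * sqrt (ip (w o\<^sub>L x j) (w o\<^sub>L x j))"
          using L2.Cauchy_Schwarz_abs[OF w wx] by (simp add: abs_le_iff)
        also have "\<dots> \<le> sqrt (ip w w) * sqrt (G (w o\<^sub>L x j) (w o\<^sub>L x j))"
          using dom[OF wx] L2.nonneg[OF w] unfolding GG by (intro mult_left_mono real_sqrt_le_mono) auto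
        finally show ?thesis by (simp add: L2_norm_eq)
      qed
      moreover have "\<bar>f ?v - G (x j) ?v\<bar> \<le> e j"
      proof -
        have "(1 + G ?v ?v) / (2 * sqrt (real j + 1)) \<le> e j"
          unfolding e_def using Gv by (intro divide_right_mono) auto
        then show ?thesis using xf[OF vM, of j] by linarith
      qed
      ultimately have "G (w o\<^sub>L x j) (w o\<^sub>L x j) \<le> L2_norm \<tau> w * sqrt (G (w o\<^sub>L x j) (w o\<^sub>L x j)) + e j"
        by linarith
      then have "(sqrt (G (w o\<^sub>L x j) (w o\<^sub>L x j)))\<^sup>2 \<le> L2_norm \<tau> w * sqrt (G (w o\<^sub>L x j) (w o\<^sub>L x j)) + e j"
        using G.nonneg[OF wx] by simp
      then have "sqrt (G (w o\<^sub>L x j) (w o\<^sub>L x j)) \<le> L2_norm \<tau> w + sqrt (e j)"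
        by (rule quadratic_bound) (use L2.nonneg[OF w] e0 in \<open>auto simp: L2_norm_eq\<close>)
      moreover have "norm (w (x j (\<zeta> k))) \<le> sqrt (G (w o\<^sub>L x j) (w o\<^sub>L x j))"
        using term_le[of "w o\<^sub>L x j" k] by (intro real_le_rsqrt) simp
      ultimately show ?thesis by linarith
    qed
    have "(\<lambda>j. norm (w (x j (\<zeta> k)))) \<longlonglongrightarrow> norm (w (\<theta> k))" by (intro tendsto_intros \<theta>)
    moreover have "(\<lambda>j. L2_norm \<tau> w + sqrt (e j)) \<longlonglongrightarrow> L2_norm \<tau> w + sqrt 0"
    proof (intro tendsto_intros)
      show "e \<longlonglongrightarrow> 0" unfolding e_def by real_asymp
    qed
    ultimately show ?thesis using est by (auto intro: LIMSEQ_le)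
  qed
  have "tau_bounded (\<theta> k)" for k
    unfolding tau_bounded_def using bd by (intro exI[of _ 1] ballI)
  then have y\<theta>: "y (\<theta> k) = 0" for k by (rule y0)
  have yx: "y o\<^sub>L x j \<in> M" for j by (rule closed(3)[OF y x])
  \<comment> \<open>The sequence \<open>y x\<^sub>j\<close> is \<open>G\<close>-Cauchy and tends to \<open>0\<close> on each \<open>\<zeta> k\<close>, so it tends to \<open>0\<close> for \<open>G\<close>.
    The bound passes to the limit in each finite partial sum.\<close>
  have Gyx: "G (y o\<^sub>L x j) (y o\<^sub>L x j) \<le> (norm y)\<^sup>2 * (2 / (real j + 1))" for j
    unfolding GG
  proof (rule suminf_le_const[OF sq])
    fix n
    have "(\<Sum>k<n. (norm (((y o\<^sub>L x i) - (y o\<^sub>L x j)) (\<zeta> k)))\<^sup>2) \<le> (norm y)\<^sup>2 * (2 / (real i + 1) + 2 / (real j + 1))" for i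
    proof -
      have "(\<Sum>k<n. (norm (((y o\<^sub>L x i) - (y o\<^sub>L x j)) (\<zeta> k)))\<^sup>2) \<le> G ((y o\<^sub>L x i) - (y o\<^sub>L x j)) ((y o\<^sub>L x i) - (y o\<^sub>L x j))"
        unfolding GG by (intro sum_le_suminf sq) auto
      also have "G ((y o\<^sub>L x i) - (y o\<^sub>L x j)) ((y o\<^sub>L x i) - (y o\<^sub>L x j)) \<le> (norm y)\<^sup>2 * G (x i - x j) (x i - x j)"
        using G_comp[of y "x i - x j"] by (simp add: blinfun_compose_distribs)
      also have "\<dots> \<le> (norm y)\<^sup>2 * (2 / (real i + 1) + 2 / (real j + 1))"
        by (intro mult_left_mono xC) simp
      finally show ?thesis .
    qed
    moreover have "(\<lambda>i. \<Sum>k<n. (norm (((y o\<^sub>L x i) - (y o\<^sub>L x j)) (\<zeta> k)))\<^sup>2)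
        \<longlonglongrightarrow> (\<Sum>k<n. (norm (y (\<theta> k) - y (x j (\<zeta> k))))\<^sup>2)"
      unfolding blinfun.diff_left blinfun_apply_blinfun_compose by (intro tendsto_intros \<theta>)
    moreover have "(\<lambda>i. (norm y)\<^sup>2 * (2 / (real i + 1) + 2 / (real j + 1)))
        \<longlonglongrightarrow> (norm y)\<^sup>2 * (0 + 2 / (real j + 1))"
      by (intro tendsto_intros) real_asymp
    ultimately have "(\<Sum>k<n. (norm (y (\<theta> k) - y (x j (\<zeta> k))))\<^sup>2) \<le> (norm y)\<^sup>2 * (0 + 2 / (real j + 1))"
      by (auto intro: LIMSEQ_le)
    then show "(\<Sum>k<n. (norm ((y o\<^sub>L x j) (\<zeta> k)))\<^sup>2) \<le> (norm y)\<^sup>2 * (2 / (real j + 1))"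
      by (simp add: y\<theta>)
  qed
  let ?w = "y\<^sup>\<star> o\<^sub>L y"
  have wM: "?w \<in> M" by (intro closed adjoint y)
  have le: "ip y y \<le> sqrt ((norm y)\<^sup>2 * (2 / (real j + 1))) * sqrt (G y y) + (1 + G ?w ?w) / (2 * sqrt (real j + 1))" for j
  proof -
    have "ip y y = f ?w" by (simp add: ip_def f_def)
    also have "\<dots> \<le> G (x j) ?w + (1 + G ?w ?w) / (2 * sqrt (real j + 1))"
      using xf[OF wM, of j] by linarith
    also have "G (x j) ?w = G (y o\<^sub>L x j) y" by (rule G_adj[OF y])
    also have "\<dots> \<le> sqrt (G (y o\<^sub>L x j) (y o\<^sub>L x j)) * sqrt (G y y)"
      using G.Cauchy_Schwarz_abs[OF yx y] by (simp add: abs_le_iff)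
    also have "\<dots> \<le> sqrt ((norm y)\<^sup>2 * (2 / (real j + 1))) * sqrt (G y y)"
      using G.nonneg[OF y] by (intro mult_right_mono real_sqrt_le_mono Gyx) auto
    finally show ?thesis by simp
  qed
  have "(\<lambda>j. sqrt ((norm y)\<^sup>2 * (2 / (real j + 1))) * sqrt (G y y) + (1 + G ?w ?w) / (2 * sqrt (real j + 1)))
      \<longlonglongrightarrow> sqrt ((norm y)\<^sup>2 * 0) * sqrt (G y y) + 0"
    by (intro tendsto_intros) real_asymp+
  then have "ip y y \<le> sqrt ((norm y)\<^sup>2 * 0) * sqrt (G y y) + 0"
    by (rule LIMSEQ_le_const) (use le in auto)
  then show ?thesis using ip_eq_0[OF y] by simp
qed

text \<open>
  The bounded vectors form a subspace invariant under the commutant of \<open>M\<close>, so the projection onto its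
  orthogonal complement belongs to \<open>M\<close>; it annihilates all bounded vectors.
\<close>

lemma tau_bounded_dense: "closure {v. tau_bounded v} = UNIV"
proof (rule ccontr)
  let ?L = "{v. tau_bounded v}"
  assume ne: "closure ?L \<noteq> UNIV"
  have sub: "subspace ?L"
  proof (rule subspaceI)
    show "0 \<in> ?L" by (auto simp: tau_bounded_def intro!: exI[of _ 0])
    fix u v r assume u: "u \<in> ?L" and v: "v \<in> ?L"
    obtain C where C: "0 \<le> C" "\<And>y. y \<in> M \<Longrightarrow> norm (blinfun_apply y u) \<le> C * L2_norm \<tau> y"
      using u by (auto elim: tau_boundedE)
    obtain C' where C': "0 \<le> C'" "\<And>y. y \<in> M \<Longrightarrow> norm (blinfun_apply y v) \<le> C' * L2_norm \<tau> y"
      using v by (auto elim: tau_boundedE)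
    have "norm (y (u + v)) \<le> (C + C') * L2_norm \<tau> y" if "y \<in> M" for y
      using norm_triangle_ineq[of "y u" "y v"] C(2)[OF that] C'(2)[OF that]
      by (simp add: blinfun.add_right distrib_right)
    then show "u + v \<in> ?L" by (auto simp: tau_bounded_def)
    have "norm (y (r *\<^sub>R u)) \<le> (\<bar>r\<bar> * C) * L2_norm \<tau> y" if "y \<in> M" for y
      using mult_left_mono[OF C(2)[OF that], of "\<bar>r\<bar>"] by (simp add: blinfun.scaleR_right mult.assoc)
    then show "r *\<^sub>R u \<in> ?L" by (auto simp: tau_bounded_def)
  qed
  have commutant: "t v \<in> ?L" if t: "t \<in> commutant M" and v: "v \<in> ?L" for t v
  proof -
    obtain C where C: "0 \<le> C" "\<And>y. y \<in> M \<Longrightarrow> norm (blinfun_apply y v) \<le> C * L2_norm \<tau> y"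
      using v by (auto elim: tau_boundedE)
    have "norm (y (t v)) \<le> (norm t * C) * L2_norm \<tau> y" if y: "y \<in> M" for y
    proof -
      have "norm (y (t v)) = norm (t (y v))" by (simp only: commutant_apply[OF t y])
      also have "\<dots> \<le> norm t * norm (y v)" by (rule norm_blinfun)
      also have "\<dots> \<le> norm t * (C * L2_norm \<tau> y)" by (intro mult_left_mono C(2) y) simp
      finally show ?thesis by (simp add: mult.assoc)
    qed
    then show ?thesis by (auto simp: tau_bounded_def)
  qed
  have scaleC: "c *\<^sub>C v \<in> ?L" if v: "v \<in> ?L" for c v
  proof -
    have "op_scaleC c id_blinfun \<in> commutant M"
      by (intro commutant_closed subsetI bounded)
    then show ?thesis using commutant[OF _ v] by fastforce
  qed
  obtain Q :: "'h operator" where Q: "Q \<in> bounded_operators" "Q \<noteq> 0" "\<And>v. v \<in> ?L \<Longrightarrow> blinfun_apply Q v = 0"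
    and Qt: "\<And>t. t \<in> bounded_operators \<Longrightarrow> t ` ?L \<subseteq> ?L \<Longrightarrow> (t\<^sup>\<star>) ` ?L \<subseteq> ?L \<Longrightarrow> Q o\<^sub>L t = t o\<^sub>L Q"
    by (rule annihilating_projection[OF sub scaleC ne], assumption) (rule that)
  have "Q \<in> M"
  proof (rule memI[OF Q(1)])
    fix t assume t: "t \<in> commutant M"
    show "Q o\<^sub>L t = t o\<^sub>L Q"
    proof (rule Qt)
      show "t \<in> bounded_operators" using t by (simp add: commutant_def)
      show "t ` ?L \<subseteq> ?L" using commutant[OF t] by (rule image_subsetI)
      show "(t\<^sup>\<star>) ` ?L \<subseteq> ?L" using commutant[OF commutant_star[OF t]] by (rule image_subsetI)
    qed
  qed
  then have "Q = 0" by (rule tau_bounded_separating) (rule Q(3), simp)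
  with Q(2) show False by contradiction
qed

text \<open>
  Operator norm balls of a von Neumann algebra are complete in \<open>L\<^sup>2\<close>-norm: on bounded vectors the
  sequence converges because it is Cauchy in \<open>L\<^sup>2\<close>-norm, and density and boundedness give a strong limit.
  Convergence to it in \<open>L\<^sup>2\<close>-norm follows by dominated convergence on the vectors dominating the trace.
\<close>

lemma L2_complete:
  assumes N: "von_neumann_algebra N" "N \<subseteq> M"
    and y: "\<And>n. y n \<in> N" and bd: "\<And>n. norm (y n) \<le> R"
    and Cau: "\<And>i j. ip (y i - y j) (y i - y j) \<le> 2 / (real i + 1) + 2 / (real j + 1)"
  obtains T where "T \<in> N" "\<And>v. (\<lambda>n. y n v) \<longlonglongrightarrow> blinfun_apply T v"
    "(\<lambda>n. ip (y n - T) (y n - T)) \<longlonglongrightarrow> 0"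
proof -
  interpret N: von_neumann N by unfold_locales (rule N)
  have yM: "y n \<in> M" for n using y N by blast
  have Cau': "Cauchy (\<lambda>n. y n v)" if v: "v \<in> {v. tau_bounded v}" for v
  proof -
    obtain C where C: "0 \<le> C" "\<And>y. y \<in> M \<Longrightarrow> norm (blinfun_apply y v) \<le> C * L2_norm \<tau> y"
      using v by (auto elim: tau_boundedE)
    show ?thesis
    proof (rule Cauchy_of_inverse_bound[where c = "C\<^sup>2"])
      fix i j
      have d: "y i - y j \<in> M" by (intro closed yM)
      have "(norm (y i v - y j v))\<^sup>2 \<le> (C * L2_norm \<tau> (y i - y j))\<^sup>2"
        using C(2)[OF d] by (intro power_mono) (auto simp: blinfun.diff_left)
      also have "\<dots> = C\<^sup>2 * ip (y i - y j) (y i - y j)"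
        using L2.nonneg[OF d] by (simp add: L2_norm_eq power_mult_distrib)
      also have "\<dots> \<le> C\<^sup>2 * (2 / (real i + 1) + 2 / (real j + 1))"
        by (intro mult_left_mono Cau) simp
      finally show "(norm (y i v - y j v))\<^sup>2 \<le> C\<^sup>2 * (2 / (real i + 1) + 2 / (real j + 1))" .
    qed
  qed
  obtain T :: "'h operator" where T: "\<And>v. (\<lambda>n. y n v) \<longlonglongrightarrow> T v"
    by (rule strong_limit_of_dense[OF bd tau_bounded_dense Cau'], assumption) (rule that)
  have TN: "T \<in> N" using y T by (rule N.strong_limit)
  obtain \<zeta> :: "nat \<Rightarrow> 'h" where \<zeta>: "summable (\<lambda>k. (norm (\<zeta> k))\<^sup>2)"
    and dom: "\<And>x. x \<in> M \<Longrightarrow> ip x x \<le> (\<Sum>k. (norm (blinfun_apply x (\<zeta> k)))\<^sup>2)"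
    by (rule dominating_vectors) blast
  have dM: "y n - T \<in> M" for n using y TN N by (intro closed) auto
  have "(\<lambda>n. \<Sum>k. (norm ((y n - T) (\<zeta> k)))\<^sup>2) \<longlonglongrightarrow> (\<Sum>k::nat. 0)"
  proof (rule tannerys_theorem[where M = "\<lambda>k. (R + norm T)\<^sup>2 * (norm (\<zeta> k))\<^sup>2", THEN conjunct2, THEN conjunct2])
    show "(\<lambda>n. (norm ((y n - T) (\<zeta> k)))\<^sup>2) \<longlonglongrightarrow> 0" for k
    proof -
      have "(\<lambda>n. (norm (y n (\<zeta> k) - T (\<zeta> k)))\<^sup>2) \<longlonglongrightarrow> (norm (T (\<zeta> k) - T (\<zeta> k)))\<^sup>2"
        by (intro tendsto_intros T)
      then show ?thesis by (simp add: blinfun.diff_left)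
    qed
    have "(norm ((y n - T) (\<zeta> k)))\<^sup>2 \<le> (R + norm T)\<^sup>2 * (norm (\<zeta> k))\<^sup>2" for n k
    proof -
      have "norm (y n - T) \<le> R + norm T" using norm_triangle_ineq4[of "y n" T] bd[of n] by linarith
      then have "norm ((y n - T) (\<zeta> k)) \<le> (R + norm T) * norm (\<zeta> k)"
        by (intro order_trans[OF norm_blinfun] mult_right_mono) auto
      then have "(norm ((y n - T) (\<zeta> k)))\<^sup>2 \<le> ((R + norm T) * norm (\<zeta> k))\<^sup>2"
        by (intro power_mono) auto
      then show ?thesis by (simp add: power_mult_distrib)
    qed
    then show "\<forall>\<^sub>F (k, n) in sequentially \<times>\<^sub>F sequentially.
        norm ((norm ((y n - T) (\<zeta> k)))\<^sup>2) \<le> (R + norm T)\<^sup>2 * (norm (\<zeta> k))\<^sup>2"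
      by (intro always_eventually) auto
    show "summable (\<lambda>k. (R + norm T)\<^sup>2 * (norm (\<zeta> k))\<^sup>2)" by (intro summable_mult \<zeta>)
  qed simp
  then have "(\<lambda>n. \<Sum>k. (norm ((y n - T) (\<zeta> k)))\<^sup>2) \<longlonglongrightarrow> 0" by simp
  then have "(\<lambda>n. ip (y n - T) (y n - T)) \<longlonglongrightarrow> 0"
    by (rule tendsto_sandwich[OF _ _ tendsto_const, rotated 2])
      (auto intro!: always_eventually L2.nonneg dM dom)
  then show ?thesis using that TN T by blast
qed

end

section \<open>Existence of the trace-preserving conditional expectation\<close>

lemma positive_strong_limit:
  assumes T: "T \<in> bounded_operators" and y: "\<And>n. positive_operator (y n)"
    and lim: "\<And>v. (\<lambda>n::nat. blinfun_apply (y n) v) \<longlonglongrightarrow> blinfun_apply T v"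
  shows "positive_operator T"
  unfolding positive_operator_def
proof (intro conjI allI T)
  fix \<xi>
  note y' = y[unfolded positive_operator_iff]
  have "inner (T \<xi>) \<eta> = inner \<xi> (T \<eta>)" for \<xi> \<eta>
  proof (rule LIMSEQ_unique)
    show "(\<lambda>n. inner (y n \<xi>) \<eta>) \<longlonglongrightarrow> inner (T \<xi>) \<eta>" by (intro tendsto_intros lim)
    have "(\<lambda>n. inner \<xi> (y n \<eta>)) \<longlonglongrightarrow> inner \<xi> (T \<eta>)" by (intro tendsto_intros lim)
    moreover have "inner (y n \<xi>) \<eta> = inner \<xi> (y n \<eta>)" for n
      using y' by (intro self_adjoint_inner) auto
    ultimately show "(\<lambda>n. inner (y n \<xi>) \<eta>) \<longlonglongrightarrow> inner \<xi> (T \<eta>)" by simp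
  qed
  then have "T\<^sup>\<star> = T" by (rule op_adjoint_eqI[OF T])
  moreover have "0 \<le> inner (T \<xi>) \<xi>" for \<xi>
  proof (rule LIMSEQ_le_const)
    show "(\<lambda>n. inner (y n \<xi>) \<xi>) \<longlonglongrightarrow> inner (T \<xi>) \<xi>" by (intro tendsto_intros lim)
    show "\<exists>N. \<forall>n\<ge>N. 0 \<le> inner (y n \<xi>) \<xi>" using y' by auto
  qed
  ultimately have "positive_operator T" using T by (simp add: positive_operator_iff)
  then show "cinner (T \<xi>) \<xi> \<in> \<real>\<^sub>\<ge>\<^sub>0" by (simp add: positive_operator_def)
qed

lemma positive_closed:
  assumes "positive_operator a"
  shows "0 \<le> r \<Longrightarrow> positive_operator (r *\<^sub>R a)"
    "positive_operator b \<Longrightarrow> positive_operator (a + b)"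
proof -
  have a: "a \<in> bounded_operators" "a\<^sup>\<star> = a" "\<And>\<xi>. 0 \<le> inner (a \<xi>) \<xi>"
    using assms by (auto simp: positive_operator_iff)
  show "positive_operator (r *\<^sub>R a)" if "0 \<le> r"
    using a that by (simp add: positive_operator_iff bounded_operators_closed adjoint_simps(4)[OF a(1) a(1)]
        blinfun.scaleR_left)
  show "positive_operator (a + b)" if "positive_operator b"
  proof -
    have b: "b \<in> bounded_operators" "b\<^sup>\<star> = b" "\<And>\<xi>. 0 \<le> inner (b \<xi>) \<xi>"
      using that by (auto simp: positive_operator_iff)
    show ?thesis
      using a b by (simp add: positive_operator_iff bounded_operators_closed adjoint_simps(1)[OF a(1) b(1)]
          blinfun.add_left inner_add_left)
  qed
qed

lemma norm_shift_positive:
  assumes x: "x \<in> bounded_operators" "x\<^sup>\<star> = x"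
  shows "positive_operator (norm x *\<^sub>R id_blinfun - x)" "positive_operator (x + norm x *\<^sub>R id_blinfun)"
proof -
  have i: "id_blinfun \<in> bounded_operators" "norm x *\<^sub>R id_blinfun \<in> bounded_operators"
    "(norm x *\<^sub>R id_blinfun)\<^sup>\<star> = norm x *\<^sub>R id_blinfun"
    using adjoint_simps(4)[of id_blinfun id_blinfun] by (auto simp: bounded_operators_closed)
  have "\<bar>inner (x \<xi>) \<xi>\<bar> \<le> norm x * (norm \<xi>)\<^sup>2" for \<xi>
  proof -
    have "\<bar>inner (x \<xi>) \<xi>\<bar> \<le> norm (x \<xi>) * norm \<xi>" by (rule Cauchy_Schwarz_ineq2)
    also have "\<dots> \<le> (norm x * norm \<xi>) * norm \<xi>" by (intro mult_right_mono norm_blinfun) simp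
    finally show ?thesis by (simp add: power2_eq_square mult.assoc)
  qed
  then have *: "inner (x \<xi>) \<xi> \<le> norm x * inner \<xi> \<xi>" "- inner (x \<xi>) \<xi> \<le> norm x * inner \<xi> \<xi>" for \<xi>
    by (auto simp: power2_norm_eq_inner abs_le_iff)
  then have **: "0 \<le> inner (x \<xi>) \<xi> + norm x * inner \<xi> \<xi>" for \<xi>
    by (metis add.commute diff_ge_0_iff_ge diff_minus_eq_add)
  show "positive_operator (norm x *\<^sub>R id_blinfun - x)"
    using * x i(2,3) by (simp add: positive_operator_iff bounded_operators_closed adjoint_simps(2)[OF i(2) x(1)]
        blinfun.diff_left blinfun.scaleR_left inner_diff_left)
  show "positive_operator (x + norm x *\<^sub>R id_blinfun)"
    using x i(2,3) **
    by (simp add: positive_operator_iff bounded_operators_closed adjoint_simps(1)[OF x(1) i(2)]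
        blinfun.add_left blinfun.scaleR_left inner_add_left)
qed

lemma inverse_sqrt_null: "(\<lambda>j. a / sqrt (real j + 1)) \<longlonglongrightarrow> 0"
proof -
  have "(\<lambda>j. 1 / sqrt (real j + 1)) \<longlonglongrightarrow> 0" by real_asymp
  from tendsto_mult[OF tendsto_const[of a] this] show ?thesis by simp
qed

context tracial
begin

lemma tau_product_nonneg:
  assumes a: "a \<in> M" "positive_operator a" and b: "b \<in> M" "positive_operator b"
  shows "0 \<le> Re (\<tau> (a o\<^sub>L b))"
proof (rule nonneg_of_perturbation[where c = "Re (\<tau> b)"])
  fix \<delta> :: real assume \<delta>: "0 < \<delta>"
  obtain s w where s: "s \<in> sa_bicommutant a" "s o\<^sub>L s = a + \<delta> *\<^sub>R id_blinfun"
    using positive_sqrt[OF a(2) \<delta>] by metis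
  have sM: "s \<in> M" using s(1) sa_bicommutant_subset[OF a(1)] by blast
  have "positive_operator (s\<^sup>\<star> o\<^sub>L b o\<^sub>L s)"
    by (rule positive_conj[OF b(2) bounded[OF sM]])
  then have "0 \<le> Re (\<tau> (s o\<^sub>L b o\<^sub>L s))"
    unfolding sa_bicommutantD(2)[OF s(1)] by (intro Re_tau_positive closed sM b)
  also have "\<tau> (s o\<^sub>L b o\<^sub>L s) = \<tau> (s o\<^sub>L (s o\<^sub>L b))"
    by (intro tau_comm closed sM b)
  also have "s o\<^sub>L (s o\<^sub>L b) = (a o\<^sub>L b) + \<delta> *\<^sub>R b"
    unfolding blinfun_compose_assoc[symmetric] s(2) by (simp add: blinfun_compose_distribs)
  also have "\<tau> \<dots> = \<tau> (a o\<^sub>L b) + complex_of_real \<delta> * \<tau> b"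
    using a b by (simp add: tau_add tau_scaleR closed)
  finally show "0 \<le> Re (\<tau> (a o\<^sub>L b)) + \<delta> * Re (\<tau> b)" by simp
qed

lemma ip_tendsto:
  assumes "\<And>n. a n \<in> M" "\<And>n. b n \<in> M" "a' \<in> M" "b' \<in> M"
    and "(\<lambda>n::nat. ip (a n - a') (a n - a')) \<longlonglongrightarrow> 0" "(\<lambda>n. ip (b n - b') (b n - b')) \<longlonglongrightarrow> 0"
  shows "(\<lambda>n. ip (a n) (b n)) \<longlonglongrightarrow> ip a' b'"
proof -
  have da: "a n - a' \<in> M" and db: "b n - b' \<in> M" for n using assms by (auto intro: closed)
  have sa: "(\<lambda>n. sqrt (ip (a n - a') (a n - a'))) \<longlonglongrightarrow> 0"
    and sb: "(\<lambda>n. sqrt (ip (b n - b') (b n - b'))) \<longlonglongrightarrow> 0"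
    using tendsto_real_sqrt[OF assms(5)] tendsto_real_sqrt[OF assms(6)] by simp_all
  have 1: "(\<lambda>n. ip (a n - a') (b n - b')) \<longlonglongrightarrow> 0"
    by (rule Lim_null_comparison[where g = "\<lambda>n. sqrt (ip (a n - a') (a n - a')) * sqrt (ip (b n - b') (b n - b'))"])
      (use L2.Cauchy_Schwarz_abs[OF da db] tendsto_mult[OF sa sb] in auto)
  have 2: "(\<lambda>n. ip a' (b n - b')) \<longlonglongrightarrow> 0"
    by (rule Lim_null_comparison[where g = "\<lambda>n. sqrt (ip a' a') * sqrt (ip (b n - b') (b n - b'))"])
      (use L2.Cauchy_Schwarz_abs[OF assms(3) db] tendsto_mult[OF tendsto_const sb] in auto)
  have 3: "(\<lambda>n. ip (a n - a') b') \<longlonglongrightarrow> 0"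
    by (rule Lim_null_comparison[where g = "\<lambda>n. sqrt (ip (a n - a') (a n - a')) * sqrt (ip b' b')"])
      (use L2.Cauchy_Schwarz_abs[OF da assms(4)] tendsto_mult[OF sa tendsto_const] in auto)
  have "ip (a n) (b n) = ip (a n - a') (b n - b') + ip a' (b n - b') + ip (a n - a') b' + ip a' b'" for n
    using assms(1-4) by (simp add: L2.diff_left L2.diff_right closed)
  then show ?thesis
    using tendsto_add[OF tendsto_add[OF tendsto_add[OF 1 2] 3] tendsto_const[of "ip a' b'"]] by simp
qed

lemma ip_contraction_le_1:
  assumes z: "z \<in> M" "positive_operator z" "positive_operator (id_blinfun - z)"
  shows "norm z \<le> 1" "ip z z \<le> 1" "Re (\<tau> z) \<le> 1"
proof -
  have le: "inner (z \<xi>) \<xi> \<le> 1 * (norm \<xi>)\<^sup>2" for \<xi>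
    using z(3) by (simp add: positive_operator_iff blinfun.diff_left inner_diff_left power2_norm_eq_inner)
  show "norm z \<le> 1" by (rule norm_le_of_positive[OF z(2) le]) simp
  have d: "id_blinfun - z \<in> M" by (intro closed z)
  have "0 \<le> Re (\<tau> (id_blinfun - z))" by (rule Re_tau_positive[OF d z(3)])
  then show t: "Re (\<tau> z) \<le> 1" using z(1) by (simp add: tau_diff closed tau_id)
  have "0 \<le> Re (\<tau> (z o\<^sub>L (id_blinfun - z)))" by (rule tau_product_nonneg[OF z(1,2) d z(3)])
  also have "z o\<^sub>L (id_blinfun - z) = z - (z o\<^sub>L z)" by (simp add: blinfun_compose_distribs)
  also have "Re (\<tau> \<dots>) = Re (\<tau> z) - ip z z"
    using z by (simp add: tau_diff closed ip_def positive_operator_iff)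
  finally show "ip z z \<le> 1" using t by simp
qed

text \<open>
  A Radon--Nikodym argument. Let \<open>Y\<close> be the point of \<open>C = {z \<in> N. 0 \<le> z \<le> 1}\<close> nearest to \<open>x\<close> in
  \<open>L\<^sup>2\<close>-norm; it exists because \<open>C\<close> is complete. Let \<open>d \<in> L\<^sup>2\<close> be the projection of \<open>x - Y\<close> onto the closure
  of the self-adjoint part of \<open>N\<close>, and suppose for a moment that \<open>d\<close> lies in \<open>N\<close>, with positive part
  \<open>p = d z\<close> for a spectral projection \<open>z \<in> C\<close>. Then \<open>\<langle>x, d\<rangle> \<le> \<langle>x, p\<rangle> \<le> \<tau>(p) = \<langle>d, z\<rangle> \<le> \<langle>d, Y\<rangle>\<close> because \<open>0 \<le> x \<le> 1\<close> and
  because \<open>Y\<close> is nearest. Hence \<open>\<parallel>d\<parallel>\<^sup>2 = \<langle>x - Y, d\<rangle> \<le> 0\<close>, that is, \<open>Y\<close> has the same pairings with \<open>N\<close> as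
  \<open>x\<close>. In general, \<open>d\<close> is replaced by a Riesz sequence in \<open>N\<close>, and \<open>p\<close> and \<open>z\<close> by their smoothed versions.
\<close>

lemma unit_interval_projection:
  assumes N: "von_neumann_algebra N" "N \<subseteq> M"
    and x: "x \<in> M" "positive_operator x" "positive_operator (id_blinfun - x)"
  shows "\<exists>y\<in>N. positive_operator y \<and> (\<forall>n\<in>N. n\<^sup>\<star> = n \<longrightarrow> ip x n = ip y n)"
proof -
  interpret N: von_neumann N by unfold_locales (rule N)
  define W where "W = {n \<in> N. n\<^sup>\<star> = n}"
  have WM: "w \<in> M" "w \<in> N" "w\<^sup>\<star> = w" if "w \<in> W" for w using that N by (auto simp: W_def)
  have subW: "subspace W"
  proof (rule subspaceI)
    have "(0::'h operator)\<^sup>\<star> = 0" by (rule op_adjoint_eqI) (simp_all add: bounded_operators_closed)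
    then show "0 \<in> W" by (simp add: W_def N.closed)
    fix u v r assume u: "u \<in> W" and v: "v \<in> W"
    note uB = N.bounded[OF WM(2)[OF u]] and vB = N.bounded[OF WM(2)[OF v]]
    show "u + v \<in> W" using u v by (simp add: W_def N.closed adjoint_simps(1)[OF uB vB])
    show "r *\<^sub>R u \<in> W" using u by (simp add: W_def N.closed adjoint_simps(4)[OF uB uB])
  qed
  interpret W: psd_form W ip
    by unfold_locales (auto intro: subW L2.sym L2.add_left L2.scale_left L2.nonneg WM)
  define C where "C = {z \<in> N. positive_operator z \<and> positive_operator (id_blinfun - z)}"
  have CW: "C \<subseteq> W" by (auto simp: C_def W_def positive_operator_iff)
  have CM: "z \<in> M" "z \<in> N" "positive_operator z" "positive_operator (id_blinfun - z)" if "z \<in> C" for z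
    using that N by (auto simp: C_def)
  have C1: "norm z \<le> 1" "ip z z \<le> 1" if "z \<in> C" for z
    using ip_contraction_le_1[OF CM(1,3,4)[OF that]] by auto
  have convC: "convex C"
  proof (rule convexI)
    fix a b and u v :: real
    assume ab: "a \<in> C" "b \<in> C" and uv: "0 \<le> u" "0 \<le> v" "u + v = 1"
    have "id_blinfun - (u *\<^sub>R a + v *\<^sub>R b) = (u + v) *\<^sub>R id_blinfun - (u *\<^sub>R a + v *\<^sub>R b)"
      by (simp add: uv)
    also have "\<dots> = u *\<^sub>R (id_blinfun - a) + v *\<^sub>R (id_blinfun - b)"
      by (simp add: algebra_simps)
    finally have e: "id_blinfun - (u *\<^sub>R a + v *\<^sub>R b) = u *\<^sub>R (id_blinfun - a) + v *\<^sub>R (id_blinfun - b)" .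
    show "u *\<^sub>R a + v *\<^sub>R b \<in> C"
      unfolding C_def mem_Collect_eq e
      by (intro conjI N.closed positive_closed CM uv ab)
  qed
  have "id_blinfun \<in> C"
    using norm_shift_positive[of "0 :: 'h operator"]
    by (simp add: C_def N.closed positive_id positive_operator_iff bounded_operators_closed)
      (rule op_adjoint_eqI, simp_all add: bounded_operators_closed)
  then have C0: "C \<noteq> {}" by blast
  obtain y :: "nat \<Rightarrow> 'h operator" where y: "\<And>j. y j \<in> C"
    and yCau: "\<And>i j. ip (y i - y j) (y i - y j) \<le> 2 / (real i + 1) + 2 / (real j + 1)"
    and yvar: "\<And>j z. z \<in> C \<Longrightarrow>
       ip x (z - y j) - ip (y j) (z - y j) \<le> (1 + ip (z - y j) (z - y j)) / (2 * sqrt (real j + 1))"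
  proof (rule W.minimizing_sequence[OF CW convC C0, where f = "ip x" and K = "ip x x"])
    show "- ip x x \<le> ip z z - 2 * ip x z" if "z \<in> C" for z
    proof -
      have "0 \<le> ip (z - x) (z - x)" by (intro L2.nonneg closed CM(1)[OF that] x(1))
      then show ?thesis
        using CM(1)[OF that] x(1) by (simp add: L2.form_simps L2.sym[of z x])
    qed
  qed (use x(1) WM(1) in \<open>auto simp: L2.add_right L2.scale_right\<close>)
  obtain Y where Y: "Y \<in> N" "\<And>v. (\<lambda>n. y n v) \<longlonglongrightarrow> blinfun_apply Y v"
    "(\<lambda>n. ip (y n - Y) (y n - Y)) \<longlonglongrightarrow> 0"
    by (rule L2_complete[OF N CM(2)[OF y] C1(1)[OF y] yCau]) (rule that)
  have YC: "Y \<in> C"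
    unfolding C_def mem_Collect_eq
  proof (intro conjI)
    show "Y \<in> N" by (rule Y)
    show "positive_operator Y"
      by (rule positive_strong_limit[OF N.bounded[OF Y(1)] CM(3)[OF y] Y(2)])
    show "positive_operator (id_blinfun - Y)"
    proof (rule positive_strong_limit[OF _ CM(4)[OF y]])
      show "id_blinfun - Y \<in> bounded_operators" by (intro N.bounded N.closed Y)
      show "(\<lambda>n. (id_blinfun - y n) v) \<longlonglongrightarrow> (id_blinfun - Y) v" for v
        unfolding blinfun.diff_left by (intro tendsto_intros Y(2))
    qed
  qed
  have YM: "Y \<in> M" by (rule CM(1)[OF YC])
  have xY: "x - Y \<in> M" by (intro closed x YM)
  have var: "ip (x - Y) z \<le> ip (x - Y) Y" if z: "z \<in> C" for z
  proof -
    have zM: "z \<in> M" by (rule CM(1)[OF z])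
    have dM: "z - y j \<in> M" for j by (intro closed zM CM(1)[OF y])
    have le: "ip x (z - y j) - ip (y j) (z - y j) \<le> 5 / (2 * sqrt (real j + 1))" for j
    proof -
      have "ip (z - y j) (z - y j) \<le> 4"
        using L2.form_diff_le[OF zM CM(1)[OF y], of j] C1(2)[OF z] C1(2)[OF y, of j] by linarith
      then have "(1 + ip (z - y j) (z - y j)) / (2 * sqrt (real j + 1)) \<le> 5 / (2 * sqrt (real j + 1))"
        by (intro divide_right_mono) auto
      then show ?thesis using yvar[OF z, of j] by linarith
    qed
    have zy: "(\<lambda>j. ip ((z - y j) - (z - Y)) ((z - y j) - (z - Y))) \<longlonglongrightarrow> 0"
    proof -
      have "ip ((z - y j) - (z - Y)) ((z - y j) - (z - Y)) = ip (y j - Y) (y j - Y)" for j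
      proof -
        have m: "y j - Y \<in> M" by (intro closed YM CM(1)[OF y])
        then have "- (y j - Y) \<in> M" using closed(4)[of "y j - Y" "-1"] by simp
        then show ?thesis
          using L2.minus_left[OF m, of "- (y j - Y)"] L2.minus_right[OF m m] by simp
      qed
      then show ?thesis using Y(3) by simp
    qed
    have zYM: "z - Y \<in> M" by (intro closed zM YM)
    have xx: "(\<lambda>j::nat. ip (x - x) (x - x)) \<longlonglongrightarrow> 0" using L2.scale_left[of x 0 0] x(1) closed(7) by simp
    have "(\<lambda>j. ip x (z - y j) - ip (y j) (z - y j)) \<longlonglongrightarrow> ip x (z - Y) - ip Y (z - Y)"
      by (intro tendsto_diff ip_tendsto[OF x(1) dM x(1) zYM xx zy] ip_tendsto[OF CM(1)[OF y] dM YM zYM Y(3) zy])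
    moreover have "(\<lambda>j::nat. 5 / (2 * sqrt (real j + 1))) \<longlonglongrightarrow> 0" by real_asymp
    ultimately have "ip x (z - Y) - ip Y (z - Y) \<le> 0"
      by (rule LIMSEQ_le) (use le in blast)
    then show ?thesis using x(1) YM zM by (simp add: L2.form_simps)
  qed
  define f where "f n = ip (x - Y) n" for n
  have f_bound: "\<bar>f n\<bar> \<le> sqrt (ip (x - Y) (x - Y)) * sqrt (ip n n)" if "n \<in> W" for n
    unfolding f_def by (rule L2.Cauchy_Schwarz_abs[OF xY WM(1)[OF that]])
  obtain d R where d: "\<And>j. d j \<in> W"
    and dCau: "\<And>i j. ip (d i - d j) (d i - d j) \<le> 2 / (real i + 1) + 2 / (real j + 1)"
    and dR: "\<And>j. ip (d j) (d j) \<le> R"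
    and df: "\<And>j w. w \<in> W \<Longrightarrow> \<bar>f w - ip (d j) w\<bar> \<le> (1 + ip w w) / (2 * sqrt (real j + 1))"
  proof (rule W.Riesz_sequence[where f = f, OF _ _ f_bound])
    show "f (u + v) = f u + f v" if "u \<in> W" "v \<in> W" for u v
      using that by (simp add: f_def L2.add_right WM xY)
    show "f (r *\<^sub>R u) = r * f u" if "u \<in> W" for r u
      using that by (simp add: f_def L2.scale_right WM xY)
  qed (assumption, rule that)
  \<comment> \<open>The smoothing parameter \<open>e\<close> is chosen of the same order as the error of the Riesz sequence.\<close>
  have dd: "ip (d j) (d j) \<le> (3 + R) / sqrt (real j + 1)" for j
  proof -
    define e where "e = 1 / sqrt (real j + 1)"
    have e: "0 < e" by (simp add: e_def)
    note dj = WM[OF d[of j]]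
    obtain z p v where z: "z \<in> sa_bicommutant (d j)" "p \<in> sa_bicommutant (d j)" "v \<in> sa_bicommutant (d j)"
      and pos: "positive_operator z" "positive_operator (id_blinfun - z)"
      "positive_operator p" "positive_operator (p - d j)" "positive_operator (id_blinfun - v)"
      and dz: "d j o\<^sub>L z = p - (e / 2) *\<^sub>R v"
      by (rule approximate_positive_part[OF bounded[OF dj(1)] dj(3) e])
    have zN: "z \<in> N" "p \<in> N" "v \<in> N" using z N.sa_bicommutant_subset[OF dj(2)] by auto
    then have zM: "z \<in> M" "p \<in> M" "v \<in> M" using N by auto
    have zC: "z \<in> C" using zN pos by (simp add: C_def)
    have xs: "x\<^sup>\<star> = x" using x(2) by (simp add: positive_operator_iff)
    have "ip x (d j) \<le> ip x p"
    proof -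
      have pd: "p - d j \<in> M" by (intro closed zM dj)
      have "0 \<le> Re (\<tau> (x o\<^sub>L (p - d j)))" by (rule tau_product_nonneg[OF x(1,2) pd pos(4)])
      also have "\<dots> = ip x (p - d j)" by (simp add: ip_def xs)
      finally show ?thesis using x(1) zM dj by (simp add: L2.diff_right)
    qed
    also have "ip x p \<le> Re (\<tau> p)"
    proof -
      have ix: "id_blinfun - x \<in> M" by (intro closed x)
      have "0 \<le> Re (\<tau> ((id_blinfun - x) o\<^sub>L p))" by (rule tau_product_nonneg[OF ix x(3) zM(2) pos(3)])
      also have "(id_blinfun - x) o\<^sub>L p = p - (x o\<^sub>L p)" by (simp add: blinfun_compose_distribs)
      also have "Re (\<tau> \<dots>) = Re (\<tau> p) - ip x p" using x(1) zM by (simp add: tau_diff closed ip_def xs)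
      finally show ?thesis by simp
    qed
    also have "Re (\<tau> p) \<le> ip (d j) z + e / 2"
    proof -
      have iv: "id_blinfun - v \<in> M" by (intro closed zM)
      have "0 \<le> Re (\<tau> (id_blinfun - v))" by (rule Re_tau_positive[OF iv pos(5)])
      then have "Re (\<tau> v) \<le> 1" using zM by (simp add: tau_diff closed tau_id)
      then have v: "e / 2 * Re (\<tau> v) \<le> e / 2 * 1" using e by (intro mult_left_mono) auto
      have "ip (d j) z = Re (\<tau> (p - (e / 2) *\<^sub>R v))" by (simp add: ip_def dj(3) dz)
      also have "\<dots> = Re (\<tau> p) - e / 2 * Re (\<tau> v)"
        using zM by (simp only: tau_diff closed(4) tau_scaleR) simp
      finally show ?thesis using v by simp
    qed
    also have "ip (d j) z \<le> f z + e"
    proof -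
      have "\<bar>f z - ip (d j) z\<bar> \<le> (1 + ip z z) / (2 * sqrt (real j + 1))"
        using zC CW by (intro df) auto
      also have "\<dots> \<le> 2 / (2 * sqrt (real j + 1))"
        using C1(2)[OF zC] by (intro divide_right_mono) auto
      finally show ?thesis by (simp add: e_def)
    qed
    also have "f z \<le> f Y" unfolding f_def by (rule var[OF zC])
    also have "f Y \<le> ip (d j) Y + e"
    proof -
      have "\<bar>f Y - ip (d j) Y\<bar> \<le> (1 + ip Y Y) / (2 * sqrt (real j + 1))"
        using YC CW by (intro df) auto
      also have "\<dots> \<le> 2 / (2 * sqrt (real j + 1))"
        using C1(2)[OF YC] by (intro divide_right_mono) auto
      finally show ?thesis by (simp add: e_def)
    qed
    finally have "ip x (d j) \<le> ip (d j) Y + e + e + e / 2" by simp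
    moreover have "f (d j) = ip x (d j) - ip (d j) Y"
      using x(1) YM dj by (simp add: f_def L2.diff_left L2.sym[of Y])
    ultimately have "f (d j) \<le> 5 / 2 * e" by simp
    moreover have "\<bar>f (d j) - ip (d j) (d j)\<bar> \<le> (1 + R) / 2 * e"
    proof -
      have "\<bar>f (d j) - ip (d j) (d j)\<bar> \<le> (1 + ip (d j) (d j)) / (2 * sqrt (real j + 1))"
        by (rule df[OF d])
      also have "\<dots> \<le> (1 + R) / (2 * sqrt (real j + 1))"
        using dR[of j] by (intro divide_right_mono) auto
      finally show ?thesis by (simp add: e_def)
    qed
    ultimately have "ip (d j) (d j) \<le> 5 / 2 * e + (1 + R) / 2 * e" by linarith
    also have "\<dots> = (3 + R / 2) * e" by (simp add: field_simps)
    also have "\<dots> \<le> (3 + R) * e"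
      using e order_trans[OF L2.nonneg[OF dj(1)] dR] by (intro mult_right_mono) auto
    finally show ?thesis by (simp add: e_def)
  qed
  have f0: "f w = 0" if w: "w \<in> W" for w
  proof -
    have le: "\<bar>f w\<bar> \<le> sqrt ((3 + R) / sqrt (real j + 1)) * sqrt (ip w w) + (1 + ip w w) / (2 * sqrt (real j + 1))" for j
    proof -
      have "\<bar>ip (d j) w\<bar> \<le> sqrt (ip (d j) (d j)) * sqrt (ip w w)"
        by (rule L2.Cauchy_Schwarz_abs[OF WM(1)[OF d] WM(1)[OF w]])
      also have "\<dots> \<le> sqrt ((3 + R) / sqrt (real j + 1)) * sqrt (ip w w)"
        using L2.nonneg[OF WM(1)[OF w]] by (intro mult_right_mono real_sqrt_le_mono dd) auto
      finally show ?thesis using df[OF w, of j] by linarith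
    qed
    have "(\<lambda>j. sqrt ((3 + R) / sqrt (real j + 1)) * sqrt (ip w w) + (1 + ip w w) / (2 * sqrt (real j + 1)))
        \<longlonglongrightarrow> sqrt 0 * sqrt (ip w w) + 0"
      using inverse_sqrt_null[of "3 + R"] inverse_sqrt_null[of "(1 + ip w w) / 2"]
      by (intro tendsto_intros) (simp_all add: divide_divide_eq_left)
    then have "\<bar>f w\<bar> \<le> sqrt 0 * sqrt (ip w w) + 0" by (rule LIMSEQ_le_const) (use le in auto)
    then show ?thesis by simp
  qed
  show ?thesis
  proof (intro bexI[OF _ Y(1)] conjI ballI impI)
    show "positive_operator Y" by (rule CM(3)[OF YC])
    fix n assume n: "n \<in> N" "n\<^sup>\<star> = n"
    then have nW: "n \<in> W" by (simp add: W_def)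
    have "ip (x - Y) n = 0" using f0[OF nW] by (simp add: f_def)
    then show "ip x n = ip Y n" using x(1) YM WM(1)[OF nW] by (simp add: L2.diff_left)
  qed
qed

text \<open>
  The relation \<open>y = E\<^sub>N(x)\<close>, expressed by the defining property of the orthogonal projection onto
  \<open>L\<^sup>2(N, \<tau>)\<close>. It is linear in the pair and functional, so existence spreads from positive contractions
  to all of \<open>M\<close>, and it is easy to transport along automorphisms.
\<close>

definition represents :: "'h operator set \<Rightarrow> 'h operator \<Rightarrow> 'h operator \<Rightarrow> bool" where
  "represents N x y \<longleftrightarrow> y \<in> N \<and> (\<forall>n\<in>N. \<tau> (x o\<^sub>L n) = \<tau> (y o\<^sub>L n))"

lemma op_scaleC_compose:
  "op_scaleC c x o\<^sub>L n = op_scaleC c (x o\<^sub>L n)"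
  "x \<in> bounded_operators \<Longrightarrow> x o\<^sub>L op_scaleC c n = op_scaleC c (x o\<^sub>L n)"
  by (auto intro!: blinfun_eqI simp: bounded_operatorsD)

context
  fixes N assumes N: "N \<in> vn_subalgebras M"
begin

interpretation N: von_neumann N
  using N by unfold_locales (simp add: vn_subalgebras_def)

lemma subalgebra: "n \<in> N \<Longrightarrow> n \<in> M"
  using N by (auto simp: vn_subalgebras_def)

text \<open>
  For self-adjoint \<open>x\<close> the real part of \<open>\<tau>(x n)\<close> depends on \<open>n\<close> only through \<open>(n + n\<^sup>\<star>) / 2\<close>, and the imaginary
  part is obtained by replacing \<open>n\<close> with \<open>\<i> n\<close>.
\<close>

lemma represents_of_real_part:
  assumes x: "x \<in> M" "x\<^sup>\<star> = x" and y: "y \<in> N" "y\<^sup>\<star> = y"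
    and eq: "\<And>n. n \<in> N \<Longrightarrow> n\<^sup>\<star> = n \<Longrightarrow> ip x n = ip y n"
  shows "represents N x y"
proof -
  have Re_sym: "Re (\<tau> (a o\<^sub>L n)) = ip a ((1/2) *\<^sub>R (n + n\<^sup>\<star>))" if a: "a \<in> M" "a\<^sup>\<star> = a" and n: "n \<in> N" for a n
  proof -
    note nM = subalgebra[OF n] and nsM = adjoint[OF subalgebra[OF n]]
    have "Re (\<tau> (a o\<^sub>L n)) = Re (\<tau> ((a o\<^sub>L n)\<^sup>\<star>))" using Re_tau_adjoint[OF closed(3)[OF a(1) nM]] by simp
    also have "(a o\<^sub>L n)\<^sup>\<star> = n\<^sup>\<star> o\<^sub>L a" by (simp add: adjoint_simps(3)[OF bounded[OF a(1)] bounded[OF nM]] a(2))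
    also have "\<tau> \<dots> = \<tau> (a o\<^sub>L n\<^sup>\<star>)" by (rule tau_comm[OF nsM a(1)])
    finally have "Re (\<tau> (a o\<^sub>L n)) = Re (\<tau> (a o\<^sub>L n\<^sup>\<star>))" .
    then show ?thesis
      using a nM nsM by (simp add: ip_def L2.form_simps blinfun_compose_distribs tau_add tau_scaleR closed)
  qed
  have Re_eq: "Re (\<tau> (x o\<^sub>L n)) = Re (\<tau> (y o\<^sub>L n))" if n: "n \<in> N" for n
  proof -
    let ?h = "(1/2) *\<^sub>R (n + n\<^sup>\<star>)"
    note nB = N.bounded[OF n] and nsN = N.adjoint[OF n]
    note sB = N.bounded[OF N.closed(1)[OF n nsN]]
    have "?h\<^sup>\<star> = ?h"
      by (simp add: adjoint_simps(4)[OF sB sB] adjoint_simps(1)[OF nB N.bounded[OF nsN]]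
          adjoint_simps(5)[OF nB nB] add.commute)
    moreover have "?h \<in> N" by (intro N.closed n nsN)
    ultimately have "ip x ?h = ip y ?h" by (rule eq[rotated])
    then show ?thesis using Re_sym[OF x n] Re_sym[OF subalgebra[OF y(1)] y(2) n] by simp
  qed
  have "\<tau> (x o\<^sub>L n) = \<tau> (y o\<^sub>L n)" if n: "n \<in> N" for n
  proof (rule complex_eqI)
    show "Re (\<tau> (x o\<^sub>L n)) = Re (\<tau> (y o\<^sub>L n))" by (rule Re_eq[OF n])
    have "Re (\<tau> (x o\<^sub>L op_scaleC \<i> n)) = Re (\<tau> (y o\<^sub>L op_scaleC \<i> n))"
      by (rule Re_eq[OF N.closed(5)[OF n]])
    then show "Im (\<tau> (x o\<^sub>L n)) = Im (\<tau> (y o\<^sub>L n))"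
      using x(1) y(1) n by (simp add: op_scaleC_compose(2) bounded N.bounded tau_scaleC closed subalgebra)
  qed
  then show ?thesis using y by (simp add: represents_def)
qed

lemma represents_add:
  assumes "represents N x y" "represents N x' y'" "x \<in> M" "x' \<in> M"
  shows "represents N (x + x') (y + y')"
  using assms by (simp add: represents_def N.closed blinfun_compose_distribs tau_add closed subalgebra)

lemma represents_scaleC:
  assumes "represents N x y" "x \<in> M"
  shows "represents N (op_scaleC c x) (op_scaleC c y)"
  using assms by (simp add: represents_def N.closed op_scaleC_compose(1) tau_scaleC closed subalgebra)

lemma represents_self: "n \<in> N \<Longrightarrow> represents N n n"
  by (simp add: represents_def)

lemma represents_unique:
  assumes "represents N x y" "represents N x y'"
  shows "y = y'"
proof -
  have y: "y \<in> N" "y' \<in> N" using assms by (auto simp: represents_def)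
  let ?d = "y - y'"
  have dN: "?d \<in> N" by (intro N.closed y)
  note dM = subalgebra[OF dN] and sN = N.adjoint[OF dN]
  have "\<tau> (?d o\<^sub>L ?d\<^sup>\<star>) = \<tau> (y o\<^sub>L ?d\<^sup>\<star>) - \<tau> (y' o\<^sub>L ?d\<^sup>\<star>)"
    using y sN by (simp add: blinfun_compose_distribs tau_diff closed subalgebra)
  also have "\<dots> = 0"
    using assms[unfolded represents_def, THEN conjunct2, rule_format, OF sN] by simp
  finally have "ip ?d ?d = 0" using tau_comm[OF adjoint[OF dM] dM] by (simp add: ip_def)
  then show ?thesis using ip_eq_0[OF dM] by simp
qed

lemma represents_positive:
  assumes x: "x \<in> M" "positive_operator x"
  shows "\<exists>y. represents N x y \<and> positive_operator y"
proof -
  \<comment> \<open>The summand \<open>1\<close> keeps \<open>K\<close> positive when \<open>x = 0\<close>.\<close>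
  define K where "K = norm x + 1"
  have K: "0 < K" unfolding K_def by (simp add: add_nonneg_pos)
  let ?x = "(1/K) *\<^sub>R x"
  have xs: "x\<^sup>\<star> = x" using x(2) by (simp add: positive_operator_iff)
  have "id_blinfun - ?x = (1/K) *\<^sub>R ((norm x *\<^sub>R id_blinfun - x) + id_blinfun)"
  proof -
    have e: "(norm x *\<^sub>R id_blinfun - x) + id_blinfun = K *\<^sub>R id_blinfun - x"
      by (simp add: K_def scaleR_add_left)
    show ?thesis unfolding e using K by (simp add: scaleR_right_diff_distrib)
  qed
  then have 1: "positive_operator (id_blinfun - ?x)"
    using K by (simp only:) (intro positive_closed norm_shift_positive bounded x xs positive_id, simp)
  have 2: "positive_operator ?x" using K by (intro positive_closed x) simp
  have vN: "von_neumann_algebra N" "N \<subseteq> M" using N by (auto simp: vn_subalgebras_def)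
  obtain y where y: "y \<in> N" "positive_operator y" "\<And>n. n \<in> N \<Longrightarrow> n\<^sup>\<star> = n \<Longrightarrow> ip ?x n = ip y n"
    using unit_interval_projection[OF vN closed(4)[OF x(1)] 2 1] by blast
  have "represents N ?x y"
    by (rule represents_of_real_part[OF closed(4)[OF x(1)] _ y(1) _ y(3)])
      (use 2 y(2) in \<open>auto simp: positive_operator_iff\<close>)
  then have "represents N (op_scaleC (complex_of_real K) ?x) (op_scaleC (complex_of_real K) y)"
    by (rule represents_scaleC[OF _ closed(4)[OF x(1)]])
  then have "represents N x (K *\<^sub>R y)" using K by (simp add: op_scaleC_of_real)
  moreover have "positive_operator (K *\<^sub>R y)" using K by (intro positive_closed y) simp
  ultimately show ?thesis by blast
qed

lemma represents_exists:
  assumes x: "x \<in> M"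
  shows "\<exists>y. represents N x y"
proof -
  have sa: "\<exists>y. represents N a y" if a: "a \<in> M" "a\<^sup>\<star> = a" for a
  proof -
    let ?p = "a + norm a *\<^sub>R id_blinfun" and ?q = "op_scaleC (complex_of_real (- norm a)) id_blinfun"
    have pM: "?p \<in> M" by (intro closed a)
    have "positive_operator ?p" using a by (intro norm_shift_positive bounded)
    then obtain y where y: "represents N ?p y" using represents_positive[OF pM] by blast
    have "represents N ?q ?q" by (intro represents_self N.closed)
    then have "represents N (?p + ?q) (y + ?q)" by (rule represents_add[OF y _ pM closed(5)[OF closed(6)]])
    moreover have "?p + ?q = a" unfolding op_scaleC_of_real by simp
    ultimately have "represents N a (y + ?q)" by (simp only:)
    then show ?thesis by (rule exI)
  qed
  let ?a = "x + x\<^sup>\<star>" and ?b = "op_scaleC (- \<i>) (x - x\<^sup>\<star>)"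
  note xs = adjoint[OF x] and xB = bounded[OF x]
  note sB = bounded[OF xs]
  have aM: "?a \<in> M" "?b \<in> M" using x xs by (simp_all add: closed)
  have "?a\<^sup>\<star> = ?a" by (simp add: adjoint_simps(1)[OF xB sB] adjoint_simps(5)[OF xB xB] add.commute)
  then obtain ya where ya: "represents N ?a ya" using sa aM by blast
  have dB: "x - x\<^sup>\<star> \<in> bounded_operators" by (intro bounded_operators_closed xB sB)
  have "?b\<^sup>\<star> = op_scaleC \<i> (x\<^sup>\<star> - x)"
    by (simp add: adjoint_simps(6)[OF dB dB] adjoint_simps(2)[OF xB sB] adjoint_simps(5)[OF xB xB])
  also have "\<dots> = ?b"
  proof (rule blinfun_eqI)
    fix v
    have "\<i> *\<^sub>C w = (- \<i>) *\<^sub>C (- w)" for w :: 'h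
      using scaleC_scaleC[of "- \<i>" "-1" w] scaleC_of_real[of "-1" w] by simp
    then show "op_scaleC \<i> (x\<^sup>\<star> - x) v = ?b v" by (simp add: blinfun.diff_left)
  qed
  finally obtain yb where yb: "represents N ?b yb" using sa aM by blast
  have "represents N (op_scaleC (1/2) ?a + op_scaleC (\<i>/2) ?b) (op_scaleC (1/2) ya + op_scaleC (\<i>/2) yb)"
    by (intro represents_add represents_scaleC ya yb aM closed(5))
  moreover have "op_scaleC (1/2) ?a + op_scaleC (\<i>/2) ?b = x"
  proof (rule blinfun_eqI)
    fix v
    have half: "(1/2) *\<^sub>C w = (1/2) *\<^sub>R w" for w :: 'h
      using scaleC_of_real[of "1/2" w] by simp
    have "(op_scaleC (1/2) ?a + op_scaleC (\<i>/2) ?b) v = (1/2) *\<^sub>C ((x + x\<^sup>\<star>) v) + (1/2) *\<^sub>C ((x - x\<^sup>\<star>) v)"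
      by (simp add: blinfun.add_left scaleC_scaleC)
    also have "\<dots> = (1/2) *\<^sub>R ((x + x\<^sup>\<star>) v + (x - x\<^sup>\<star>) v)"
      unfolding half by (simp only: scaleR_add_right)
    also have "(x + x\<^sup>\<star>) v + (x - x\<^sup>\<star>) v = 2 *\<^sub>R x v"
      by (simp add: blinfun.add_left blinfun.diff_left scaleR_2)
    finally show "(op_scaleC (1/2) ?a + op_scaleC (\<i>/2) ?b) v = x v" by simp
  qed
  ultimately show ?thesis by auto
qed

lemma trace_preserving_represents:
  assumes E: "trace_preserving_cond_exp M \<tau> N E" and x: "x \<in> M"
  shows "represents N x (E x)"
  unfolding represents_def
proof (intro conjI ballI)
  show "E x \<in> N" using E x by (auto simp: trace_preserving_cond_exp_def)
  fix n assume n: "n \<in> N"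
  have "\<tau> (x o\<^sub>L n) = \<tau> (E (x o\<^sub>L n))"
    using E closed(3)[OF x subalgebra[OF n]] by (simp add: trace_preserving_cond_exp_def)
  also have "E (x o\<^sub>L n) = E (id_blinfun o\<^sub>L x o\<^sub>L n)" by simp
  also have "\<dots> = id_blinfun o\<^sub>L E x o\<^sub>L n"
    using E N.closed(6) x n unfolding trace_preserving_cond_exp_def by blast
  finally show "\<tau> (x o\<^sub>L n) = \<tau> (E x o\<^sub>L n)" by simp
qed

text \<open>
  The trace-preserving conditional expectation exists and is unique, so the definite description
  that defines it denotes.
\<close>

lemma cond_exp_onto_represents:
  "cond_exp_onto M \<tau> N \<in> extensional M \<and> trace_preserving_cond_exp M \<tau> N (cond_exp_onto M \<tau> N)"
proof -
  define E where "E = restrict (\<lambda>x. THE y. represents N x y) M"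
  have rep: "represents N x (E x)" if "x \<in> M" for x
  proof -
    have "\<exists>!y. represents N x y" using represents_exists[OF that] represents_unique by blast
    then show ?thesis unfolding E_def using that by (simp add: theI')
  qed
  have E_eqI: "E x = y" if "x \<in> M" "represents N x y" for x y
    using represents_unique[OF rep[OF that(1)] that(2)] .
  have "trace_preserving_cond_exp M \<tau> N E"
    unfolding trace_preserving_cond_exp_def
  proof (intro conjI ballI allI)
    show "E ` M \<subseteq> N" using rep by (auto simp: represents_def)
    show "E (x + y) = E x + E y" if "x \<in> M" "y \<in> M" for x y
      using that by (intro E_eqI closed represents_add rep)
    show "E (op_scaleC c x) = op_scaleC c (E x)" if "x \<in> M" for c x
      using that by (intro E_eqI closed represents_scaleC rep)
    show "positive_operator (E x)" if "x \<in> positive_cone M" for x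
    proof -
      have x: "x \<in> M" "positive_operator x" using that by (auto simp: positive_cone_def)
      then obtain y where "represents N x y" "positive_operator y" using represents_positive by blast
      then show ?thesis using E_eqI[OF x(1)] by simp
    qed
    show "E n = n" if "n \<in> N" for n
      by (rule E_eqI[OF subalgebra[OF that] represents_self[OF that]])
    show "E (a o\<^sub>L x o\<^sub>L b) = a o\<^sub>L E x o\<^sub>L b" if a: "a \<in> N" and x: "x \<in> M" and b: "b \<in> N" for a x b
    proof (rule E_eqI)
      have ExN: "E x \<in> N" using rep[OF x] by (simp add: represents_def)
      show "a o\<^sub>L x o\<^sub>L b \<in> M" by (intro closed x subalgebra a b)
      show "represents N (a o\<^sub>L x o\<^sub>L b) (a o\<^sub>L E x o\<^sub>L b)"
        unfolding represents_def
      proof (intro conjI ballI)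
        show "a o\<^sub>L E x o\<^sub>L b \<in> N" by (intro N.closed a b ExN)
        fix n assume n: "n \<in> N"
        have cyc: "\<tau> (a o\<^sub>L z o\<^sub>L b o\<^sub>L n) = \<tau> (z o\<^sub>L (b o\<^sub>L n o\<^sub>L a))" if z: "z \<in> M" for z
          using tau_comm[of a "z o\<^sub>L (b o\<^sub>L n)"] a b n z
          by (simp add: blinfun_compose_assoc closed subalgebra)
        have "b o\<^sub>L n o\<^sub>L a \<in> N" by (intro N.closed a b n)
        then have "\<tau> (x o\<^sub>L (b o\<^sub>L n o\<^sub>L a)) = \<tau> (E x o\<^sub>L (b o\<^sub>L n o\<^sub>L a))"
          using rep[OF x] by (simp add: represents_def)
        then show "\<tau> (a o\<^sub>L x o\<^sub>L b o\<^sub>L n) = \<tau> (a o\<^sub>L E x o\<^sub>L b o\<^sub>L n)"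
          by (simp only: cyc[OF x] cyc[OF subalgebra[OF ExN]])
      qed
    qed
    show "\<tau> (E x) = \<tau> x" if "x \<in> M" for x
    proof -
      have "\<tau> (x o\<^sub>L id_blinfun) = \<tau> (E x o\<^sub>L id_blinfun)"
        using rep[OF that] N.closed(6) unfolding represents_def by blast
      then show ?thesis by simp
    qed
  qed
  moreover have "E \<in> extensional M" by (simp add: E_def)
  moreover have "E' = E" if "E' \<in> extensional M" "trace_preserving_cond_exp M \<tau> N E'" for E'
  proof (rule extensionalityI[OF that(1) \<open>E \<in> extensional M\<close>])
    show "E' x = E x" if "x \<in> M" for x
      using E_eqI[OF that trace_preserving_represents[OF \<open>trace_preserving_cond_exp M \<tau> N E'\<close> that]] by simp
  qed
  ultimately have "cond_exp_onto M \<tau> N = E"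
    unfolding cond_exp_onto_def by (intro the_equality conjI; (elim conjE)?)
  then show ?thesis using \<open>trace_preserving_cond_exp M \<tau> N E\<close> \<open>E \<in> extensional M\<close> by simp
qed

lemma represents_cond_exp: "x \<in> M \<Longrightarrow> represents N x (cond_exp_onto M \<tau> N x)"
  using trace_preserving_represents cond_exp_onto_represents by blast

lemma cond_exp_eqI: "x \<in> M \<Longrightarrow> represents N x y \<Longrightarrow> cond_exp_onto M \<tau> N x = y"
  using represents_unique represents_cond_exp by blast

end

end

section \<open>Operator inequalities and the topologies\<close>

context tracial
begin

text \<open>
  The operators in the sequence need not be uniformly bounded: on bounded vectors they converge
  pointwise, and those vectors are dense.
\<close>

lemma positive_L2_limit:
  assumes T: "T \<in> M" and S: "\<And>n. S n \<in> M" "\<And>n. positive_operator (S n)"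
    and lim: "(\<lambda>n::nat. L2_norm \<tau> (S n - T)) \<longlonglongrightarrow> 0"
  shows "positive_operator T"
proof -
  let ?L = "{v. tau_bounded v}"
  have TB: "T \<in> bounded_operators" by (rule bounded[OF T])
  note S' = S(2)[unfolded positive_operator_iff]
  have conv: "(\<lambda>n. S n v) \<longlonglongrightarrow> T v" if v: "tau_bounded v" for v
  proof -
    obtain C where C: "0 \<le> C" "\<And>y. y \<in> M \<Longrightarrow> norm (blinfun_apply y v) \<le> C * L2_norm \<tau> y"
      using v by (auto elim: tau_boundedE)
    have le: "norm (S n v - T v) \<le> C * L2_norm \<tau> (S n - T)" for n
      using C(2)[OF closed(2)[OF S(1) T]] by (simp add: blinfun.diff_left)
    have "(\<lambda>n. C * L2_norm \<tau> (S n - T)) \<longlonglongrightarrow> 0"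
      using tendsto_mult[OF tendsto_const[of C] lim] by simp
    then have "(\<lambda>n. S n v - T v) \<longlonglongrightarrow> 0"
      by (rule Lim_null_comparison[OF always_eventually[OF allI[OF le]]])
    then show ?thesis by (rule LIM_zero_cancel)
  qed
  have approx: "\<exists>f. (\<forall>n. tau_bounded (f n)) \<and> f \<longlonglongrightarrow> v" for v
  proof -
    have "v \<in> closure ?L" by (simp add: tau_bounded_dense)
    then show ?thesis unfolding closure_sequential by simp
  qed
  have sym: "inner (T u) v = inner u (T v)" if "tau_bounded u" "tau_bounded v" for u v
  proof (rule LIMSEQ_unique)
    show "(\<lambda>n. inner (S n u) v) \<longlonglongrightarrow> inner (T u) v" by (intro tendsto_intros conv that)
    have "(\<lambda>n. inner u (S n v)) \<longlonglongrightarrow> inner u (T v)" by (intro tendsto_intros conv that)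
    moreover have "inner (S n u) v = inner u (S n v)" for n
      using S' by (intro self_adjoint_inner) auto
    ultimately show "(\<lambda>n. inner (S n u) v) \<longlonglongrightarrow> inner u (T v)" by simp
  qed
  have nonneg: "0 \<le> inner (T u) u" if "tau_bounded u" for u
  proof (rule LIMSEQ_le_const)
    show "(\<lambda>n. inner (S n u) u) \<longlonglongrightarrow> inner (T u) u" by (intro tendsto_intros conv that)
    show "\<exists>N. \<forall>n\<ge>N. 0 \<le> inner (S n u) u" using S' by auto
  qed
  have "T\<^sup>\<star> = T"
  proof (rule op_adjoint_eqI[OF TB])
    fix u v
    obtain f where f: "\<And>n. tau_bounded (f n)" "f \<longlonglongrightarrow> u" using approx by blast
    obtain g where g: "\<And>n. tau_bounded (g n)" "g \<longlonglongrightarrow> v" using approx by blast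
    show "inner (T u) v = inner u (T v)"
    proof (rule LIMSEQ_unique)
      show "(\<lambda>n. inner (T (f n)) (g n)) \<longlonglongrightarrow> inner (T u) v" by (intro tendsto_intros f g)
      show "(\<lambda>n. inner (T (f n)) (g n)) \<longlonglongrightarrow> inner u (T v)"
        unfolding sym[OF f(1) g(1)] by (intro tendsto_intros f g)
    qed
  qed
  moreover have "0 \<le> inner (T v) v" for v
  proof -
    obtain f where f: "\<And>n. tau_bounded (f n)" "f \<longlonglongrightarrow> v" using approx by blast
    have "(\<lambda>n. inner (T (f n)) (f n)) \<longlonglongrightarrow> inner (T v) v" by (intro tendsto_intros f)
    then show ?thesis by (rule LIMSEQ_le_const) (use nonneg f in auto)
  qed
  ultimately show ?thesis using TB by (simp add: positive_operator_iff)
qed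

lemma Metric_space_L2:
  "Metric_space M (\<lambda>x y. if x \<in> M \<and> y \<in> M then L2_norm \<tau> (x - y) else 0)"
proof
  have comm: "L2_norm \<tau> (x - y) = L2_norm \<tau> (y - x)" if "x \<in> M" "y \<in> M" for x y
    using that by (simp add: L2_norm_eq L2.form_simps L2.sym[of y x])
  show "0 \<le> (if x \<in> M \<and> y \<in> M then L2_norm \<tau> (x - y) else 0)" for x y
    using L2.nonneg[of "x - y"] by (simp add: L2_norm_eq closed)
  show "(if x \<in> M \<and> y \<in> M then L2_norm \<tau> (x - y) else 0) = (if y \<in> M \<and> x \<in> M then L2_norm \<tau> (y - x) else 0)" for x y
    using comm by auto
  show "(if x \<in> M \<and> y \<in> M then L2_norm \<tau> (x - y) else 0) = 0 \<longleftrightarrow> x = y" if "x \<in> M" "y \<in> M" for x y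
  proof
    assume "(if x \<in> M \<and> y \<in> M then L2_norm \<tau> (x - y) else 0) = 0"
    then have "ip (x - y) (x - y) = 0" using that by (simp add: L2_norm_eq)
    then show "x = y" using ip_eq_0[OF closed(2)[OF that]] by simp
  next
    assume "x = y"
    then show "(if x \<in> M \<and> y \<in> M then L2_norm \<tau> (x - y) else 0) = 0"
      using that L2.scale_left[of 0 0 0] closed(7) L2.diff_left[of x x "0"] by (simp add: L2_norm_eq)
  qed
  show "(if x \<in> M \<and> z \<in> M then L2_norm \<tau> (x - z) else 0) \<le>
      (if x \<in> M \<and> y \<in> M then L2_norm \<tau> (x - y) else 0) + (if y \<in> M \<and> z \<in> M then L2_norm \<tau> (y - z) else 0)"
    if "x \<in> M" "y \<in> M" "z \<in> M" for x y z
    using L2.seminorm_triangle[of "x - y" "y - z"] that by (simp add: L2_norm_eq closed)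
qed

text \<open>
  Operator inequalities survive limits in \<open>L\<^sup>2\<close>-norm.
\<close>

lemma openin_not_ge:
  assumes b: "b \<in> M"
  shows "openin (L2_topology M \<tau>) {y \<in> M. \<not> operator_le b y}"
proof -
  interpret D: Metric_space M "\<lambda>x y. if x \<in> M \<and> y \<in> M then L2_norm \<tau> (x - y) else 0"
    by (rule Metric_space_L2)
  show ?thesis
    unfolding L2_topology_def D.openin_mtopology
  proof (intro conjI allI impI)
    fix y assume "y \<in> {y \<in> M. \<not> operator_le b y}"
    then have y: "y \<in> M" "\<not> operator_le b y" by auto
    show "\<exists>r>0. D.mball y r \<subseteq> {y \<in> M. \<not> operator_le b y}"
    proof (rule ccontr)
      assume no: "\<not> (\<exists>r>0. D.mball y r \<subseteq> {y \<in> M. \<not> operator_le b y})"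
      have "\<exists>z. z \<in> M \<and> L2_norm \<tau> (z - y) < 1 / (real n + 1) \<and> operator_le b z" for n
      proof -
        have "0 < 1 / (real n + 1)" by simp
        then obtain z where z: "z \<in> D.mball y (1 / (real n + 1))" "\<not> (z \<in> M \<and> \<not> operator_le b z)"
          using no by blast
        then have "z \<in> M" "L2_norm \<tau> (y - z) < 1 / (real n + 1)" by (auto simp: y)
        then show ?thesis using z(2) D.commute[of y z] y(1) by auto
      qed
      then obtain z where z: "\<And>n. z n \<in> M" "\<And>n. L2_norm \<tau> (z n - y) < 1 / (real n + 1)" "\<And>n. operator_le b (z n)"
        by metis
      have "positive_operator (y - b)"
      proof (rule positive_L2_limit[where S = "\<lambda>n. z n - b"])
        show "y - b \<in> M" "z n - b \<in> M" for n by (intro closed y b z)+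
        show "positive_operator (z n - b)" for n using z(3)[of n] by (simp add: operator_le_def)
        have "(\<lambda>n. L2_norm \<tau> (z n - y)) \<longlonglongrightarrow> 0"
        proof (rule tendsto_sandwich[OF _ _ tendsto_const])
          show "\<forall>\<^sub>F n in sequentially. 0 \<le> L2_norm \<tau> (z n - y)"
            using L2.nonneg[OF closed(2)[OF z(1) y(1)]] by (simp add: L2_norm_eq)
          show "\<forall>\<^sub>F n in sequentially. L2_norm \<tau> (z n - y) \<le> 1 / (real n + 1)"
            using z(2) by (intro always_eventually allI less_imp_le)
          show "(\<lambda>n. 1 / (real n + 1)) \<longlonglongrightarrow> 0" by real_asymp
        qed
        then show "(\<lambda>n. L2_norm \<tau> (z n - b - (y - b))) \<longlonglongrightarrow> 0" by simp
      qed
      then show False using y(2) by (simp add: operator_le_def)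
    qed
  qed auto
qed

lemma topspace_effros_marechal: "topspace (effros_marechal_topology M \<tau>) \<subseteq> vn_subalgebras M"
  by (auto simp: effros_marechal_topology_def)

text \<open>
  Upper semicontinuity of \<open>\<lambda>\<close>: for each fixed \<open>x\<close> the condition \<open>c x \<le> E\<^sub>N(x)\<close> is closed in \<open>N\<close>.
\<close>

lemma closedin_index_bound:
  "closedin (effros_marechal_topology M \<tau>)
     {N \<in> topspace (effros_marechal_topology M \<tau>).
        \<forall>x\<in>positive_cone M. operator_le (c *\<^sub>R x) (cond_exp_onto M \<tau> N x)}"
  (is "closedin ?X ?V")
proof -
  define Bad where "Bad x = {N \<in> vn_subalgebras M. cond_exp_onto M \<tau> N x \<in> {y \<in> M. \<not> operator_le (c *\<^sub>R x) y}}" for x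
  have op: "openin ?X (Bad x)" if "x \<in> positive_cone M" for x
  proof -
    have x: "x \<in> M" using that by (simp add: positive_cone_def)
    show ?thesis
      unfolding effros_marechal_topology_def Bad_def
      by (rule topology_generated_by_Basis) (use x openin_not_ge[OF closed(4)[OF x]] in blast)
  qed
  have "topspace ?X - ?V = (\<Union>x\<in>positive_cone M. Bad x)"
  proof (intro equalityI subsetI)
    fix N assume "N \<in> topspace ?X - ?V"
    then obtain x where N: "N \<in> vn_subalgebras M" and x: "x \<in> positive_cone M"
      "\<not> operator_le (c *\<^sub>R x) (cond_exp_onto M \<tau> N x)"
      using topspace_effros_marechal by blast
    have xM: "x \<in> M" using x(1) by (simp add: positive_cone_def)
    have "cond_exp_onto M \<tau> N x \<in> M"
      using represents_cond_exp[OF N xM] subalgebra[OF N] unfolding represents_def by blast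
    then show "N \<in> (\<Union>x\<in>positive_cone M. Bad x)" using N x by (auto simp: Bad_def)
  next
    fix N assume "N \<in> (\<Union>x\<in>positive_cone M. Bad x)"
    then obtain x where x: "x \<in> positive_cone M" "N \<in> Bad x" by blast
    then have "N \<in> topspace ?X" using openin_subset[OF op[OF x(1)]] by blast
    then show "N \<in> topspace ?X - ?V" using x by (auto simp: Bad_def)
  qed
  moreover have "openin ?X (\<Union>x\<in>positive_cone M. Bad x)" using op by (intro openin_Union) auto
  ultimately show ?thesis by (simp add: closedin_def)
qed

section \<open>Invariance and minimality\<close>

text \<open>
  If \<open>s\<^sup>2 = x + \<delta>\<close> with \<open>s \<in> M\<close> self-adjoint, then \<open>\<theta>(x) + \<delta> = \<theta>(s)\<^sup>2\<close> is positive; let \<open>\<delta> \<rightarrow> 0\<close>.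
\<close>

lemma star_automorphism_positive:
  assumes \<theta>: "star_automorphism M \<theta>" and x: "x \<in> M" "positive_operator x"
  shows "positive_operator (\<theta> x)"
proof -
  have bij: "bij_betw \<theta> M M"
    and add: "\<And>x y. x \<in> M \<Longrightarrow> y \<in> M \<Longrightarrow> \<theta> (x + y) = \<theta> x + \<theta> y"
    and scaleC: "\<And>c x. x \<in> M \<Longrightarrow> \<theta> (op_scaleC c x) = op_scaleC c (\<theta> x)"
    and mult: "\<And>x y. x \<in> M \<Longrightarrow> y \<in> M \<Longrightarrow> \<theta> (x o\<^sub>L y) = \<theta> x o\<^sub>L \<theta> y"
    and star: "\<And>x. x \<in> M \<Longrightarrow> \<theta> (x\<^sup>\<star>) = (\<theta> x)\<^sup>\<star>"
    using \<theta> by (auto simp: star_automorphism_def)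
  have in_M: "\<theta> y \<in> M" if "y \<in> M" for y using bij that by (auto simp: bij_betw_def)
  have one: "\<theta> id_blinfun = id_blinfun"
  proof -
    have "id_blinfun \<in> \<theta> ` M" using bij closed(6) by (simp add: bij_betw_def)
    then obtain u where u: "id_blinfun = \<theta> u" "u \<in> M" by (rule imageE)
    have "\<theta> (id_blinfun o\<^sub>L u) = \<theta> id_blinfun o\<^sub>L \<theta> u" by (rule mult[OF closed(6) u(2)])
    then show ?thesis by (simp add: u(1)[symmetric])
  qed
  have xs: "x\<^sup>\<star> = x" using x(2) by (simp add: positive_operator_iff)
  have "0 \<le> inner (\<theta> x \<xi>) \<xi>" for \<xi>
  proof (rule nonneg_of_perturbation[where c = "inner \<xi> \<xi>"])
    fix \<delta> :: real assume \<delta>: "0 < \<delta>"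
    obtain s w where s: "s \<in> sa_bicommutant x" "s o\<^sub>L s = x + \<delta> *\<^sub>R id_blinfun"
      using positive_sqrt[OF x(2) \<delta>] by metis
    have sM: "s \<in> M" using s(1) sa_bicommutant_subset[OF x(1)] by blast
    have "\<theta> s o\<^sub>L \<theta> s = \<theta> (x + op_scaleC (complex_of_real \<delta>) id_blinfun)"
      by (simp only: mult[OF sM sM, symmetric] s(2) op_scaleC_of_real)
    also have "\<dots> = \<theta> x + op_scaleC (complex_of_real \<delta>) id_blinfun"
      by (simp only: add[OF x(1) closed(5)[OF closed(6)]] scaleC[OF closed(6)] one)
    also have "\<dots> = \<theta> x + \<delta> *\<^sub>R id_blinfun" by (simp only: op_scaleC_of_real)
    finally have sq: "\<theta> s (\<theta> s \<xi>) = \<theta> x \<xi> + \<delta> *\<^sub>R \<xi>"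
      by (metis blinfun.add_left blinfun.scaleR_left blinfun_apply_blinfun_compose blinfun_apply_id_blinfun id_apply)
    have "(\<theta> s)\<^sup>\<star> = \<theta> s" using star[OF sM] sa_bicommutantD(2)[OF s(1)] by simp
    then have "inner (\<theta> s (\<theta> s \<xi>)) \<xi> = inner (\<theta> s \<xi>) (\<theta> s \<xi>)"
      by (rule self_adjoint_inner[OF bounded[OF in_M[OF sM]]])
    then have "0 \<le> inner (\<theta> s (\<theta> s \<xi>)) \<xi>" by simp
    then show "0 \<le> inner (\<theta> x \<xi>) \<xi> + \<delta> * inner \<xi> \<xi>" by (simp add: sq inner_add_left)
  qed
  moreover have "(\<theta> x)\<^sup>\<star> = \<theta> x" using star[OF x(1)] xs by simp
  ultimately show ?thesis using bounded[OF in_M[OF x(1)]] by (simp add: positive_operator_iff)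
qed

lemma cond_exp_equivariant:
  assumes \<theta>: "star_automorphism M \<theta>" "\<And>x. x \<in> M \<Longrightarrow> \<tau> (\<theta> x) = \<tau> x"
    and N: "N \<in> vn_subalgebras M" "\<theta> ` N \<in> vn_subalgebras M" and x: "x \<in> M"
  shows "cond_exp_onto M \<tau> (\<theta> ` N) (\<theta> x) = \<theta> (cond_exp_onto M \<tau> N x)"
proof (rule cond_exp_eqI[OF N(2)])
  let ?y = "cond_exp_onto M \<tau> N x"
  have mult: "\<And>x y. x \<in> M \<Longrightarrow> y \<in> M \<Longrightarrow> \<theta> (x o\<^sub>L y) = \<theta> x o\<^sub>L \<theta> y"
    using \<theta>(1) by (simp add: star_automorphism_def)
  show "\<theta> x \<in> M" using \<theta>(1) x by (auto simp: star_automorphism_def bij_betw_def)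
  have rep: "?y \<in> N" "\<And>n. n \<in> N \<Longrightarrow> \<tau> (x o\<^sub>L n) = \<tau> (?y o\<^sub>L n)"
    using represents_cond_exp[OF N(1) x] unfolding represents_def by blast+
  show "represents (\<theta> ` N) (\<theta> x) (\<theta> ?y)"
    unfolding represents_def
  proof (intro conjI ballI)
    show "\<theta> ?y \<in> \<theta> ` N" using rep(1) by (rule imageI)
    fix m assume "m \<in> \<theta> ` N"
    then obtain n where n: "n \<in> N" "m = \<theta> n" by blast
    have "\<tau> (\<theta> x o\<^sub>L \<theta> n) = \<tau> (x o\<^sub>L n)"
      using subalgebra[OF N(1) n(1)] x by (simp add: mult[symmetric] \<theta>(2) closed)
    also have "\<dots> = \<tau> (?y o\<^sub>L n)" by (rule rep(2)[OF n(1)])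
    also have "\<dots> = \<tau> (\<theta> ?y o\<^sub>L \<theta> n)"
      using subalgebra[OF N(1) n(1)] subalgebra[OF N(1) rep(1)] by (simp add: mult[symmetric] \<theta>(2) closed)
    finally show "\<tau> (\<theta> x o\<^sub>L m) = \<tau> (\<theta> ?y o\<^sub>L m)" by (simp only: n(2))
  qed
qed

text \<open>
  By equivariance, \<open>E\<^bsub>\<alpha>\<^sub>g(N)\<^esub>(x) - c x = \<alpha>\<^sub>g(E\<^sub>N(x\<^sub>0) - c x\<^sub>0)\<close> for \<open>x\<^sub>0 = \<alpha>\<^sub>g\<^sup>-\<^sup>1(x)\<close>.
\<close>

lemma index_bound_invariant:
  assumes \<Gamma>: "group \<Gamma>" and act: "trace_preserving_action \<Gamma> M \<tau> \<alpha>" and g: "g \<in> carrier \<Gamma>"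
    and N: "N \<in> vn_subalgebras M" "\<alpha> g ` N \<in> vn_subalgebras M"
    and bound: "\<And>x. x \<in> positive_cone M \<Longrightarrow> operator_le (c *\<^sub>R x) (cond_exp_onto M \<tau> N x)"
    and x: "x \<in> positive_cone M"
  shows "operator_le (c *\<^sub>R x) (cond_exp_onto M \<tau> (\<alpha> g ` N) x)"
proof -
  interpret group \<Gamma> by (rule \<Gamma>)
  let ?h = "inv\<^bsub>\<Gamma>\<^esub> g"
  have h: "?h \<in> carrier \<Gamma>" using g by simp
  have aut: "star_automorphism M (\<alpha> k)" "\<And>x. x \<in> M \<Longrightarrow> \<tau> (\<alpha> k x) = \<tau> x" if "k \<in> carrier \<Gamma>" for k
    using act that by (auto simp: trace_preserving_action_def)
  have xM: "x \<in> M" "positive_operator x" using x by (auto simp: positive_cone_def)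
  define x0 where "x0 = \<alpha> ?h x"
  have x0M: "x0 \<in> M" using aut(1)[OF h] xM(1) by (auto simp: x0_def star_automorphism_def bij_betw_def)
  have x0: "x0 \<in> positive_cone M"
    using star_automorphism_positive[OF aut(1)[OF h] xM] x0M by (simp add: x0_def positive_cone_def)
  have gx0: "\<alpha> g x0 = x"
  proof -
    have "\<alpha> g x0 = \<alpha> (g \<otimes>\<^bsub>\<Gamma>\<^esub> ?h) x"
      using act[unfolded trace_preserving_action_def] g h xM(1) unfolding x0_def by metis
    also have "g \<otimes>\<^bsub>\<Gamma>\<^esub> ?h = \<one>\<^bsub>\<Gamma>\<^esub>" by (rule r_inv[OF g])
    also have "\<alpha> \<one>\<^bsub>\<Gamma>\<^esub> x = x" using act xM(1) by (simp add: trace_preserving_action_def)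
    finally show ?thesis .
  qed
  let ?y = "cond_exp_onto M \<tau> N x0"
  have yM: "?y \<in> M"
    using represents_cond_exp[OF N(1) x0M] subalgebra[OF N(1)] unfolding represents_def by blast
  have d: "?y - c *\<^sub>R x0 \<in> M" by (intro closed yM x0M)
  have "\<alpha> g (?y - c *\<^sub>R x0) = \<alpha> g ?y - c *\<^sub>R x"
  proof -
    have "?y - c *\<^sub>R x0 = ?y + op_scaleC (complex_of_real (- c)) x0"
      unfolding op_scaleC_of_real by simp
    also have "\<alpha> g \<dots> = \<alpha> g ?y + op_scaleC (complex_of_real (- c)) (\<alpha> g x0)"
      using aut(1)[OF g] yM x0M closed(5)[OF x0M] by (simp only: star_automorphism_def)
    finally show ?thesis unfolding op_scaleC_of_real gx0 by simp
  qed
  moreover have "positive_operator (?y - c *\<^sub>R x0)"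
    using bound[OF x0] by (simp only: operator_le_def)
  then have "positive_operator (\<alpha> g (?y - c *\<^sub>R x0))"
    by (rule star_automorphism_positive[OF aut(1)[OF g] d])
  moreover have "cond_exp_onto M \<tau> (\<alpha> g ` N) x = \<alpha> g ?y"
    using cond_exp_equivariant[OF aut(1)[OF g] aut(2)[OF g] N x0M] by (simp only: gx0)
  ultimately show ?thesis by (simp only: operator_le_def)
qed

text \<open>
  The members of \<open>U\<close> that satisfy the bound with constant \<open>c\<close> form a closed invariant subset; it
  contains \<open>N1\<close>, so by minimality it is all of \<open>U\<close>.
\<close>

lemma URA_index_bound:
  assumes \<Gamma>: "group \<Gamma>" and act: "trace_preserving_action \<Gamma> M \<tau> \<alpha>" and U: "URA \<Gamma> M \<tau> \<alpha> U"
    and N1: "N1 \<in> U" and N2: "N2 \<in> U" and c: "c \<in> pp_constants M \<tau> N1"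
  shows "c \<in> pp_constants M \<tau> N2"
proof -
  let ?X = "effros_marechal_topology M \<tau>"
  let ?P = "\<lambda>N. \<forall>x\<in>positive_cone M. operator_le (c *\<^sub>R x) (cond_exp_onto M \<tau> N x)"
  let ?V = "U \<inter> {N \<in> topspace ?X. ?P N}"
  have clU: "closedin ?X U" and invU: "\<And>g N. g \<in> carrier \<Gamma> \<Longrightarrow> N \<in> U \<Longrightarrow> \<alpha> g ` N \<in> U"
    and minU: "\<And>V. V \<subseteq> U \<Longrightarrow> V \<noteq> {} \<Longrightarrow> closed_invariant \<Gamma> M \<tau> \<alpha> V \<Longrightarrow> V = U"
    using U by (auto simp: URA_def closed_invariant_def)
  have Utop: "U \<subseteq> topspace ?X" using clU by (rule closedin_subset)
  have Uvn: "N \<in> vn_subalgebras M" if "N \<in> U" for N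
    using that Utop topspace_effros_marechal by blast
  have "closed_invariant \<Gamma> M \<tau> \<alpha> ?V"
    unfolding closed_invariant_def
  proof (intro conjI ballI)
    show "closedin ?X ?V" by (rule closedin_Int[OF clU closedin_index_bound])
    fix g N assume g: "g \<in> carrier \<Gamma>" and N: "N \<in> ?V"
    then have gN: "\<alpha> g ` N \<in> U" using invU by blast
    have NU: "N \<in> U" and bound: "\<And>x. x \<in> positive_cone M \<Longrightarrow> operator_le (c *\<^sub>R x) (cond_exp_onto M \<tau> N x)"
      using N by auto
    have "?P (\<alpha> g ` N)"
      using index_bound_invariant[OF \<Gamma> act g Uvn[OF NU] Uvn[OF gN] bound] by blast
    then show "\<alpha> g ` N \<in> ?V" using gN Utop by auto
  qed
  moreover have "N1 \<in> ?V" using N1 c Utop by (auto simp: pp_constants_def)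
  ultimately have "?V = U" using minU[of ?V] by blast
  then have "?P N2" using N2 by blast
  then show ?thesis using c by (simp add: pp_constants_def)
qed

end

theorem lemma4p5:
  fixes \<Gamma> :: "('g, 'm) monoid_scheme"
    and M :: "'h::complex_hilbert_space operator set"
    and \<tau> :: "'h operator \<Rightarrow> complex"
    and \<alpha> :: "'g \<Rightarrow> 'h operator \<Rightarrow> 'h operator"
    and U :: "'h operator set set"
  assumes "group \<Gamma>"
    and "countable (carrier \<Gamma>)"
    and "von_neumann_algebra M"
    and "separable_predual M"
    and "faithful_normal_tracial_state M \<tau>"
    and "trace_preserving_action \<Gamma> M \<tau> \<alpha>"
    and "URA \<Gamma> M \<tau> \<alpha> U"
  shows "\<forall>N\<^sub>1\<in>U. \<forall>N\<^sub>2\<in>U. pimsner_popa_index M \<tau> N\<^sub>1 = pimsner_popa_index M \<tau> N\<^sub>2"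
proof (intro ballI)
  interpret tracial M \<tau> by unfold_locales (rule assms)+
  fix N1 N2 assume "N1 \<in> U" "N2 \<in> U"
  then have "pp_constants M \<tau> N1 = pp_constants M \<tau> N2"
    using URA_index_bound[OF assms(1,6,7)] by blast
  then show "pimsner_popa_index M \<tau> N1 = pimsner_popa_index M \<tau> N2"
    by (simp add: pimsner_popa_index_def pp_lambda_def)
qed

end
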